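(* Let $K$ be an infinite field, let $D$ be a finite-dimensional central division algebra of degree $s$ over $K$ (so $\dim_K D = s^2$), let $n \geqslant 1$, and let $J$ be a two-sided ideal in the ring $P_{D,n}$ of polynomial functions $D^n \to D$. Then: (a) $\mathcal{I}(\mathcal{Z}(J)) = \operatorname{Rad}_D(J)$. (b) Moreover, if $\operatorname{char}(K)$ does not divide $s!$, then $\operatorname{Rad}_D(J) = \operatorname{Rad}'_D(J)$.
   Context: **Polynomial functions.** A function $f \colon D^n \to D$ is a polynomial function if it is a finite sum of functions of the form $(x_1,\ldots,x_n) \mapsto a_1 x_{i_1} a_2 x_{i_2} \cdots a_r x_{i_r} a_{r+1}$ with $a_1,\ldots,a_{r+1} \in D$. Equivalently (a known fact): fix a $K$-basis $b_1,\ldots,b_{s^2}$ of $D$ and write $x_i = y_{i1} b_1 + \cdots + y_{is^2} b_{s^2}$, which identifies $D^n$ with $K^{ns^2}$; then $f = f_1 b_1 + \cdots + f_{s^2} b_{s^2}$, where each $f_k \colon K^{ns^2} \to K$ is given by a polynomial with coefficients in $K$ in the variables $y_{ij}$ ($1 \leqslant i \leqslant n$, $1 \leqslant j \leqslant s^2$). This condition does not depend on the choice of basis. $P_{D,n}$ denotes the ring of polynomial functions $D^n \to D$ under pointwise operations. **Center.** $C_{D,n}$ denotes the center of $P_{D,n}$. It is the ring of polynomial functions $D^n \to K$, where $K$ is identified with the center of $D$; that is, it is the commutative polynomial ring $K[y_{ij}]$ in $ns^2$ variables. **Zero loci and vanishing ideals.** For a two-sided ideal $J \subset P_{D,n}$,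 $\mathcal{Z}(J) = \{ (d_1,\ldots,d_n) \in D^n \mid f(d_1,\ldots,d_n) = 0 \ \forall f \in J\}$. For a subset $X \subset D^n$, $\mathcal{I}(X) = \{ f \in P_{D,n} \mid f(d_1,\ldots,d_n) = 0 \ \forall (d_1,\ldots,d_n) \in X\}$. **Norm.** $N_D \colon D \to K$ is the (reduced) norm of $D$; in the coordinates with respect to a $K$-basis of $D$ it is a homogeneous polynomial of degree $s$, and $N_D(a) = a^s$ for $a \in K$. For $f \in P_{D,n}$, $N_D(f) \in C_{D,n}$ denotes the composition of $f \colon D^n \to D$ with $N_D \colon D \to K$, where $K$ is identified with the center of $D$. **Quasi-anisotropic polynomials.** A homogeneous polynomial $p \in K[z_1,\ldots,z_m]$ is quasi-anisotropic if, for $b_1,\ldots,b_m \in K$, $p(b_1,\ldots,b_m) = 0$ is only possible when $b_m = 0$. **Radicals.** For a two-sided ideal $J \subset P_{D,n}$: $\operatorname{Rad}_D(J)$ is the set of all $f \in P_{D,n}$ for which there exist $m \geqslant 1$, a homogeneous quasi-anisotropic polynomial $p \in K[z_1,\ldots,z_m]$ and $f_1,\ldots,f_{m-1} \in C_{D,n}$ such that $p(f_1,\ldots,f_{m-1},N_D(f)) \in J$. $\operatorname{Rad}'_D(J)$ is the set of all $f \in P_{D,n}$ for which there exist $m \geqslant 1$, a homogeneous quasi-anisotropic polynomial $p \in K[z_1,\ldots,z_m]$ and $f_1,\ldots,f_{m-1} \in P_{D,n}$ such that $p(N_D(f_1),\ldots,N_D(f_{m-1}),N_D(f)) \in J$.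 *)

theory Defs
  imports
    "HOL-Library.Poly_Mapping"
    "HOL-Algebra.Ideal"
    "HOL-Algebra.Algebraic_Closure_Type"
    "Jordan_Normal_Form.Determinant"
begin

text \<open>
  The division algebra is the type \<open>'d\<close>, a \<open>'k\<close>-algebra via \<open>scale\<close>. The field \<open>'k\<close> is identified
  with the centre of \<open>'d\<close> by \<open>a \<mapsto> a *s 1\<close>. The explicit finite spanning set is needed because
  \<open>dim\<close> is \<open>0\<close> by convention on infinite-dimensional spaces.
\<close>

locale central_division_algebra = vector_space scale
  for scale :: "'k::field \<Rightarrow> 'd::division_ring \<Rightarrow> 'd" (infixr \<open>*s\<close> 75) +
  fixes s :: nat
  assumes scale_mult_left: "(a *s x) * y = a *s (x * y)"
    and scale_mult_right: "x * (a *s y) = a *s (x * y)"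
    and center_eq: "{z :: 'd. \<forall>x. z * x = x * z} = range (\<lambda>a. a *s 1)"
    and finite_dim: "\<exists>B. finite B \<and> span B = UNIV"
    and dim_eq: "dim UNIV = s\<^sup>2"

section \<open>Polynomial functions\<close>

text \<open>
  Points of \<open>D\<^sup>n\<close> are functions \<open>'n \<Rightarrow> 'd\<close> on a finite type with \<open>n = CARD('n)\<close>. The pair
  \<open>(a\<^sub>1, [(i\<^sub>1, a\<^sub>2), \<dots>, (i\<^sub>r, a\<^bsub>r+1\<^esub>)])\<close> encodes \<open>a\<^sub>1 x\<^bsub>i\<^sub>1\<^esub> a\<^sub>2 \<cdots> x\<^bsub>i\<^sub>r\<^esub> a\<^bsub>r+1\<^esub>\<close>;
  here \<open>r = 0\<close>, a constant, is allowed.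
\<close>

definition word_fun :: "'d::division_ring \<times> ('n \<times> 'd) list \<Rightarrow> ('n \<Rightarrow> 'd) \<Rightarrow> 'd" where
  "word_fun w x = fst w * prod_list (map (\<lambda>(i, a). x i * a) (snd w))"

definition poly_funs :: "(('n::finite \<Rightarrow> 'd::division_ring) \<Rightarrow> 'd) set" where
  "poly_funs = {f. \<exists>ws. f = (\<lambda>x. \<Sum>w\<leftarrow>ws. word_fun w x)}"

definition poly_fun_ring :: "(('n::finite \<Rightarrow> 'd::division_ring) \<Rightarrow> 'd) ring" where
  "poly_fun_ring = \<lparr>carrier = poly_funs,
     monoid.mult = (\<lambda>f g x. f x * g x), one = (\<lambda>_. 1),
     zero = (\<lambda>_. 0), add = (\<lambda>f g x. f x + g x)\<rparr>"

definition poly_fun_center :: "(('n::finite \<Rightarrow> 'd::division_ring) \<Rightarrow> 'd) set" where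
  "poly_fun_center = {f \<in> carrier poly_fun_ring. \<forall>g \<in> carrier poly_fun_ring.
     f \<otimes>\<^bsub>poly_fun_ring\<^esub> g = g \<otimes>\<^bsub>poly_fun_ring\<^esub> f}"

definition zero_locus ::
    "(('n::finite \<Rightarrow> 'd::division_ring) \<Rightarrow> 'd) set \<Rightarrow> ('n \<Rightarrow> 'd) set" where
  "zero_locus J = {x. \<forall>f \<in> J. f x = 0}"

definition vanishing_ideal ::
    "('n::finite \<Rightarrow> 'd::division_ring) set \<Rightarrow> (('n \<Rightarrow> 'd) \<Rightarrow> 'd) set" where
  "vanishing_ideal A = {f \<in> carrier poly_fun_ring. \<forall>x \<in> A. f x = 0}"

section \<open>Reduced norm\<close>

text \<open>
  A \<open>K\<close>-algebra homomorphism from \<open>D\<close> to the \<open>s \<times> s\<close> matrices over the algebraic closure \<open>L\<close> of \<open>K\<close>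
  is the same as an \<open>L\<close>-algebra homomorphism from \<open>D \<otimes>\<^sub>K L\<close>. The last condition says that the latter
  is onto, hence (both sides having dimension \<open>s\<^sup>2\<close>) an isomorphism.
\<close>

definition splitting_rep ::
    "('k::field \<Rightarrow> 'd::division_ring \<Rightarrow> 'd) \<Rightarrow> nat \<Rightarrow> ('d \<Rightarrow> 'k alg_closure mat) \<Rightarrow> bool" where
  "splitting_rep scale s \<phi> \<longleftrightarrow>
     (\<forall>x. \<phi> x \<in> carrier_mat s s) \<and> \<phi> 1 = 1\<^sub>m s \<and>
     (\<forall>x y. \<phi> (x + y) = \<phi> x + \<phi> y) \<and> (\<forall>x y. \<phi> (x * y) = \<phi> x * \<phi> y) \<and>
     (\<forall>a x. \<phi> (scale a x) = to_ac a \<cdot>\<^sub>m \<phi> x) \<and>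
     (\<forall>M \<in> carrier_mat s s. \<exists>A c. finite A \<and>
        (\<forall>i<s. \<forall>j<s. M $$ (i, j) = (\<Sum>x\<in>A. c x * \<phi> x $$ (i, j))))"

text \<open>
  By the Skolem--Noether theorem the determinant does not depend on the chosen splitting, and it
  lies in \<open>K\<close>; \<open>of_ac\<close> reads it back as an element of \<open>K\<close>.
\<close>

definition reduced_norm ::
    "('k::field \<Rightarrow> 'd::division_ring \<Rightarrow> 'd) \<Rightarrow> nat \<Rightarrow> 'd \<Rightarrow> 'k" where
  "reduced_norm scale s x = of_ac (det ((SOME \<phi>. splitting_rep scale s \<phi>) x))"

definition norm_fun ::
    "('k::field \<Rightarrow> 'd::division_ring \<Rightarrow> 'd) \<Rightarrow> nat \<Rightarrow> (('n \<Rightarrow> 'd) \<Rightarrow> 'd) \<Rightarrow> ('n \<Rightarrow> 'd) \<Rightarrow> 'd" where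
  "norm_fun scale s f x = scale (reduced_norm scale s (f x)) 1"

section \<open>Quasi-anisotropic polynomials\<close>

text \<open>Polynomials in variables \<open>z\<^sub>i\<close>, \<open>i :: nat\<close>, map exponent vectors to coefficients.\<close>

type_synonym 'k mvpoly = "(nat \<Rightarrow>\<^sub>0 nat) \<Rightarrow>\<^sub>0 'k"

definition in_vars :: "nat \<Rightarrow> 'k::zero mvpoly \<Rightarrow> bool" where
  "in_vars m p \<longleftrightarrow> (\<forall>t \<in> Poly_Mapping.keys p. Poly_Mapping.keys t \<subseteq> {1..m})"

definition homogeneous :: "'k::zero mvpoly \<Rightarrow> bool" where
  "homogeneous p \<longleftrightarrow> (\<exists>d. \<forall>t \<in> Poly_Mapping.keys p.
     (\<Sum>i \<in> Poly_Mapping.keys t. Poly_Mapping.lookup t i) = d)"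

text \<open>
  Evaluation of \<open>p(z\<^sub>1, \<dots>, z\<^sub>m)\<close> in a \<open>'k\<close>-algebra that need not be commutative. It is used only at
  central elements, where the order of the factors is irrelevant.
\<close>

definition mveval ::
    "('k::zero \<Rightarrow> 'a::ring_1 \<Rightarrow> 'a) \<Rightarrow> nat \<Rightarrow> 'k mvpoly \<Rightarrow> (nat \<Rightarrow> 'a) \<Rightarrow> 'a" where
  "mveval scale m p v =
     (\<Sum>t \<in> Poly_Mapping.keys p. scale (Poly_Mapping.lookup p t)
       (\<Prod>i\<leftarrow>[1..<Suc m]. v i ^ Poly_Mapping.lookup t i))"

definition quasi_anisotropic :: "nat \<Rightarrow> 'k::field mvpoly \<Rightarrow> bool" where
  "quasi_anisotropic m p \<longleftrightarrow> (\<forall>b :: nat \<Rightarrow> 'k. mveval (*) m p b = 0 \<longrightarrow> b m = 0)"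

section \<open>Radicals\<close>

definition Rad ::
    "('k::field \<Rightarrow> 'd::division_ring \<Rightarrow> 'd) \<Rightarrow> nat \<Rightarrow>
     (('n::finite \<Rightarrow> 'd) \<Rightarrow> 'd) set \<Rightarrow> (('n \<Rightarrow> 'd) \<Rightarrow> 'd) set" where
  "Rad scale s J = {f \<in> carrier poly_fun_ring. \<exists>m\<ge>1. \<exists>p g.
     in_vars m p \<and> homogeneous p \<and> quasi_anisotropic m p \<and>
     (\<forall>i \<in> {1..<m}. g i \<in> poly_fun_center) \<and> g m = norm_fun scale s f \<and>
     (\<lambda>x. mveval scale m p (\<lambda>i. g i x)) \<in> J}"

definition Rad' ::
    "('k::field \<Rightarrow> 'd::division_ring \<Rightarrow> 'd) \<Rightarrow> nat \<Rightarrow>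
     (('n::finite \<Rightarrow> 'd) \<Rightarrow> 'd) set \<Rightarrow> (('n \<Rightarrow> 'd) \<Rightarrow> 'd) set" where
  "Rad' scale s J = {f \<in> carrier poly_fun_ring. \<exists>m\<ge>1. \<exists>p g.
     in_vars m p \<and> homogeneous p \<and> quasi_anisotropic m p \<and>
     (\<forall>i \<in> {1..<m}. g i \<in> carrier poly_fun_ring) \<and> g m = f \<and>
     (\<lambda>x. mveval scale m p (\<lambda>i. norm_fun scale s (g i) x)) \<in> J}"

end

(*
  The central part of an ideal J generates the same zeros as J: coordinate projections of D are
  K-linear, and by a density argument every K-linear map of D is a sum of two-sided multiplications
  x |-> a x b, so J contains the coordinates of its members. This reduces (a) to polynomial
  functions over K and to the function g = N(f).
  If K is algebraically closed, some power of g lies in J by Hilbert's Nullstellensatz. Otherwise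
  there is a polynomial without roots, hence an anisotropic binary form q; by Hilbert's basis theorem
  a single F in J has the same zeros as J, and P(y, t) = q(F(y), 1 - g(y) t) has no zeros at all.
  Homogenising P at y_i g, 1 and g yields the required quasi-anisotropic polynomial, with value
  a multiple of F. For (b), each central function is a linear combination of s-th powers of central
  functions, and these powers are norms.
  The reduced norm lies in K: this is clear for x whose matrix has a cyclic vector, by comparison
  with the companion matrix of the minimal polynomial, and such x are Zariski dense.
*)

theory Submission
  imports Defs "HOL-Library.Function_Algebras" "HOL-Computational_Algebra.Polynomial"
begin

section \<open>Hilbert's basis theorem\<close>

text \<open>The homogenisation works because the last variable carries the norm g. Dividing by it
  turns y_i g and 1 into y_i and t = 1/g; there the second argument of q is 0, and q leaves its
  leading coefficient times a power of F. Where g vanishes the quotients say nothing, and a positive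
  power of g in front covers these points. Quasi-anisotropy concerns only zeros with b_m \<noteq> 0,
  and there the form is a power of b_m times a value of P, which is never 0. The obstacle in the
  reduced norm is that K need not be perfect, so descent by Galois groups is not at hand. In its
  place stands a K-linear projection of the algebraic closure onto K: it fixes the unique solution
  of a linear system over K, and every function with values in K. A splitting is built without
  tensor products. The K-linear maps from D to the closure form a module under translation by D; a
  nonzero submodule of least dimension is irreducible, and the density theorem that yields the
  coordinate projections of D also yields surjectivity onto the matrices.\<close>

text \<open>Rings are subsets of a type, since the polynomial functions in growing sets of variables
  all live in one function type.\<close>

definition subring_set :: "'a::comm_ring_1 set \<Rightarrow> bool" where
  "subring_set A \<longleftrightarrow> 1 \<in> A \<and> (\<forall>x\<in>A. - x \<in> A) \<and> (\<forall>x\<in>A. \<forall>y\<in>A. x + y \<in> A \<and> x * y \<in> A)"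

definition ideal_of :: "'a::comm_ring_1 set \<Rightarrow> 'a set \<Rightarrow> bool" where
  "ideal_of A I \<longleftrightarrow> I \<subseteq> A \<and> 0 \<in> I \<and> (\<forall>x\<in>I. \<forall>y\<in>I. x + y \<in> I) \<and> (\<forall>a\<in>A. \<forall>x\<in>I. a * x \<in> I)"

text \<open>That \<open>G\<close> generates \<open>I\<close> is expressed by minimality: every ideal
  containing \<open>G\<close> contains \<open>I\<close>. This avoids writing out linear
  combinations.\<close>

definition noetherian :: "'a::comm_ring_1 set \<Rightarrow> bool" where
  "noetherian A \<longleftrightarrow> (\<forall>I. ideal_of A I \<longrightarrow>
     (\<exists>G. finite G \<and> G \<subseteq> I \<and> (\<forall>I'. ideal_of A I' \<longrightarrow> G \<subseteq> I' \<longrightarrow> I \<subseteq> I')))"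

definition polys_over :: "'a::comm_ring_1 set \<Rightarrow> 'a poly set" where
  "polys_over A = {f. \<forall>i. coeff f i \<in> A}"

text \<open>The ring A[x], as the values at \<open>x\<close> of polynomials over \<open>A\<close>;
  the representing polynomial need not be unique.\<close>

definition adjoin :: "'a::comm_ring_1 set \<Rightarrow> 'a \<Rightarrow> 'a set" where
  "adjoin A x = (\<lambda>f. poly f x) ` polys_over A"

lemma subring_setD:
  assumes "subring_set A"
  shows "0 \<in> A" "1 \<in> A" "x \<in> A \<Longrightarrow> - x \<in> A" "x \<in> A \<Longrightarrow> y \<in> A \<Longrightarrow> x + y \<in> A"
    "x \<in> A \<Longrightarrow> y \<in> A \<Longrightarrow> x - y \<in> A" "x \<in> A \<Longrightarrow> y \<in> A \<Longrightarrow> x * y \<in> A" "x \<in> A \<Longrightarrow> x ^ n \<in> A"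
proof -
  show 1: "1 \<in> A" and n: "x \<in> A \<Longrightarrow> - x \<in> A" and a: "x \<in> A \<Longrightarrow> y \<in> A \<Longrightarrow> x + y \<in> A"
    and m: "x \<in> A \<Longrightarrow> y \<in> A \<Longrightarrow> x * y \<in> A" for x y
    using assms by (auto simp: subring_set_def)
  show "0 \<in> A" using a[OF 1 n[OF 1]] by simp
  show "x \<in> A \<Longrightarrow> y \<in> A \<Longrightarrow> x - y \<in> A" using a[of x "- y"] n[of y] by simp
  show "x \<in> A \<Longrightarrow> x ^ n \<in> A" by (induction n) (auto intro: 1 m)
qed

lemma subring_set_sum:
  assumes "subring_set A" "\<And>i. i \<in> S \<Longrightarrow> f i \<in> A"
  shows "sum f S \<in> A"
  using assms(2) by (induction S rule: infinite_finite_induct) (auto intro: subring_setD[OF assms(1)])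

lemma ideal_ofD:
  assumes "ideal_of A I"
  shows "I \<subseteq> A" "0 \<in> I" "x \<in> I \<Longrightarrow> y \<in> I \<Longrightarrow> x + y \<in> I" "a \<in> A \<Longrightarrow> x \<in> I \<Longrightarrow> a * x \<in> I"
  using assms by (auto simp: ideal_of_def)

lemma ideal_of_diff:
  assumes "subring_set A" "ideal_of A I" "x \<in> I" "y \<in> I"
  shows "x - y \<in> I"
proof -
  have "x + (- 1) * y \<in> I"
    by (intro ideal_ofD[OF assms(2)] subring_setD[OF assms(1)] assms)
  thus ?thesis by simp
qed

lemma noetherianE:
  assumes "noetherian A" "ideal_of A I"
  obtains G where "finite G" "G \<subseteq> I" "\<And>I'. ideal_of A I' \<Longrightarrow> G \<subseteq> I' \<Longrightarrow> I \<subseteq> I'"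
proof -
  have "\<exists>G. finite G \<and> G \<subseteq> I \<and> (\<forall>I'. ideal_of A I' \<longrightarrow> G \<subseteq> I' \<longrightarrow> I \<subseteq> I')"
    using assms unfolding noetherian_def by (elim allE impE)
  thus thesis using that by (elim exE conjE) simp
qed

lemma polys_overD: "f \<in> polys_over A \<Longrightarrow> coeff f i \<in> A"
  by (simp add: polys_over_def)

lemma polys_over_closed:
  assumes A: "subring_set A"
  shows "f \<in> polys_over A \<Longrightarrow> g \<in> polys_over A \<Longrightarrow> f + g \<in> polys_over A"
    "f \<in> polys_over A \<Longrightarrow> g \<in> polys_over A \<Longrightarrow> f - g \<in> polys_over A"
    "f \<in> polys_over A \<Longrightarrow> g \<in> polys_over A \<Longrightarrow> f * g \<in> polys_over A"
    "a \<in> A \<Longrightarrow> f \<in> polys_over A \<Longrightarrow> smult a f \<in> polys_over A"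
    "a \<in> A \<Longrightarrow> monom a n \<in> polys_over A"
    "0 \<in> polys_over A" "1 \<in> polys_over A"
    "f \<in> polys_over A \<Longrightarrow> f ^ n \<in> polys_over A"
proof -
  show m: "f \<in> polys_over A \<Longrightarrow> g \<in> polys_over A \<Longrightarrow> f * g \<in> polys_over A" for f g
    by (auto simp: polys_over_def coeff_mult intro!: subring_set_sum[OF A] subring_setD[OF A])
  show o: "1 \<in> polys_over A"
    by (auto simp: polys_over_def coeff_1 intro!: subring_setD[OF A])
  show "f \<in> polys_over A \<Longrightarrow> f ^ n \<in> polys_over A"
    by (induction n) (auto intro: m o)
qed (auto simp: polys_over_def intro!: subring_setD[OF A])

lemma adjoinI: "f \<in> polys_over A \<Longrightarrow> poly f x \<in> adjoin A x"
  by (simp add: adjoin_def)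

lemma subring_set_adjoin:
  assumes A: "subring_set A" shows "subring_set (adjoin A x)"
  unfolding subring_set_def
proof (intro conjI ballI)
  show "1 \<in> adjoin A x"
    using adjoinI[OF polys_over_closed(7)[OF A], of x] by simp
next
  fix u assume "u \<in> adjoin A x"
  then obtain f where f: "f \<in> polys_over A" "u = poly f x" by (auto simp: adjoin_def)
  show "- u \<in> adjoin A x"
    using adjoinI[OF polys_over_closed(2)[OF A polys_over_closed(6)[OF A] f(1)], of x] f by simp
next
  fix u v assume "u \<in> adjoin A x" and "v \<in> adjoin A x"
  then obtain f g where f: "f \<in> polys_over A" "u = poly f x" "g \<in> polys_over A" "v = poly g x"
    by (auto simp: adjoin_def)
  show "u + v \<in> adjoin A x"
    using adjoinI[OF polys_over_closed(1)[OF A f(1) f(3)], of x] f by simp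
  show "u * v \<in> adjoin A x"
    using adjoinI[OF polys_over_closed(3)[OF A f(1) f(3)], of x] f by simp
qed

text \<open>The classical argument with ideals of leading coefficients, carried out on representing
  polynomials because \<open>x\<close> may be algebraic over \<open>A\<close>. The coefficient
  ideals stabilise at a degree \<open>d\<close>, and lifts of generators in degrees up to
  \<open>d\<close> suffice to cancel leading terms.\<close>

theorem hilbert_basis:
  assumes A: "subring_set A" and N: "noetherian A"
  shows "noetherian (adjoin A x)"
  unfolding noetherian_def
proof (intro allI impI)
  fix I assume I: "ideal_of (adjoin A x) I"
  \<comment> \<open>Coefficients at \<open>n\<close> of polynomials of degree at most
    \<open>n\<close> with value in both \<open>J\<close> and \<open>I\<close>. Asking for
    \<open>I\<close> as well keeps the difference in \<open>I\<close> when a leading term is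
    cancelled below.\<close>
  define L where "L J n = {coeff f n |f. f \<in> polys_over A \<and> poly f x \<in> J \<and> poly f x \<in> I \<and> degree f \<le> n}" for J n
  have ideal_L: "ideal_of A (L J n)" if J: "ideal_of (adjoin A x) J" for J n
    unfolding ideal_of_def
  proof (intro conjI ballI)
    show "L J n \<subseteq> A" by (auto simp: L_def polys_overD)
    show "0 \<in> L J n"
      unfolding L_def using polys_over_closed(6)[OF A] ideal_ofD(2)[OF I] ideal_ofD(2)[OF J]
      by (intro CollectI exI[of _ 0]) auto
  next
    fix a b assume "a \<in> L J n" "b \<in> L J n"
    then obtain f g where "f \<in> polys_over A" "poly f x \<in> J" "poly f x \<in> I" "degree f \<le> n" "a = coeff f n"
      "g \<in> polys_over A" "poly g x \<in> J" "poly g x \<in> I" "degree g \<le> n" "b = coeff g n"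
      by (auto simp: L_def)
    thus "a + b \<in> L J n" unfolding L_def
      using polys_over_closed(1)[OF A] ideal_ofD(3)[OF I] ideal_ofD(3)[OF J]
      by (intro CollectI exI[of _ "f + g"]) (auto intro: degree_add_le)
  next
    fix a b assume a: "a \<in> A" and "b \<in> L J n"
    then obtain g where g: "g \<in> polys_over A" "poly g x \<in> J" "poly g x \<in> I" "degree g \<le> n" "b = coeff g n"
      by (auto simp: L_def)
    have "a \<in> adjoin A x" using adjoinI[OF polys_over_closed(5)[OF A a, of 0], of x] by (simp add: poly_monom)
    thus "a * b \<in> L J n" unfolding L_def
      using g polys_over_closed(4)[OF A a] ideal_ofD(4)[OF I] ideal_ofD(4)[OF J] degree_smult_le[of a g]
      by (intro CollectI exI[of _ "smult a g"]) auto
  qed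
  have xA: "x ^ k \<in> adjoin A x" for k
    using adjoinI[OF polys_over_closed(5)[OF A subring_setD(2)[OF A], of k], of x] by (simp add: poly_monom)
  have L_mono: "L I n \<subseteq> L I m" if "n \<le> m" for n m
  proof
    fix a assume "a \<in> L I n"
    then obtain f where f: "f \<in> polys_over A" "poly f x \<in> I" "degree f \<le> n" "a = coeff f n"
      by (auto simp: L_def)
    have "coeff (monom 1 (m - n) * f) m = a" using that f by (simp add: coeff_monom_mult)
    moreover have "degree (monom 1 (m - n) * f) \<le> m"
      using degree_mult_le[of "monom 1 (m - n)" f] degree_monom_le[of "1::'a" "m - n"] f(3) that by linarith
    moreover have "monom 1 (m - n) * f \<in> polys_over A"
      by (intro polys_over_closed[OF A] subring_setD[OF A] f)
    moreover have "poly (monom 1 (m - n) * f) x \<in> I"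
      using ideal_ofD(4)[OF I xA f(2)] by (simp add: poly_monom)
    ultimately show "a \<in> L I m" unfolding L_def by blast
  qed
  have ideal_UL: "ideal_of A (\<Union>n. L I n)"
    unfolding ideal_of_def
  proof (intro conjI ballI)
    fix a b assume "a \<in> (\<Union>n. L I n)" "b \<in> (\<Union>n. L I n)"
    then obtain n m where "a \<in> L I n" "b \<in> L I m" by blast
    hence "a \<in> L I (max n m)" "b \<in> L I (max n m)" using L_mono by (meson max.cobounded1 max.cobounded2 subsetD)+
    thus "a + b \<in> (\<Union>n. L I n)" using ideal_ofD(3)[OF ideal_L[OF I]] by blast
  next
    show "(\<Union>n. L I n) \<subseteq> A" "0 \<in> (\<Union>n. L I n)"
      using ideal_ofD(1,2)[OF ideal_L[OF I]] by blast+
    show "\<And>a x. a \<in> A \<Longrightarrow> x \<in> (\<Union>n. L I n) \<Longrightarrow> a * x \<in> (\<Union>n. L I n)"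
      using ideal_ofD(4)[OF ideal_L[OF I]] by blast
  qed
  obtain G where G: "finite G" "G \<subseteq> (\<Union>n. L I n)"
    "\<And>I'. ideal_of A I' \<Longrightarrow> G \<subseteq> I' \<Longrightarrow> (\<Union>n. L I n) \<subseteq> I'"
    by (rule noetherianE[OF N ideal_UL]) (rule that)
  have "\<exists>d. G \<subseteq> L I d" using G(1,2)
  proof (induction G)
    case (insert a G)
    then obtain d n where "G \<subseteq> L I d" "a \<in> L I n" by auto
    hence "insert a G \<subseteq> L I (max d n)" using L_mono by (meson insert_subset max.cobounded1 max.cobounded2 subset_iff)
    thus ?case ..
  qed auto
  then obtain d where "G \<subseteq> L I d" ..
  hence L_stable: "L I n \<subseteq> L I d" for n using G(3)[OF ideal_L[OF I]] by blast
  have "\<exists>Gk. finite Gk \<and> Gk \<subseteq> L I k \<and> (\<forall>I'. ideal_of A I' \<longrightarrow> Gk \<subseteq> I' \<longrightarrow> L I k \<subseteq> I')" for k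
    using noetherianE[OF N ideal_L[OF I]] by metis
  then obtain Gk where Gk: "\<And>k. finite (Gk k)" "\<And>k. Gk k \<subseteq> L I k"
    "\<And>k I'. ideal_of A I' \<Longrightarrow> Gk k \<subseteq> I' \<Longrightarrow> L I k \<subseteq> I'" by metis
  have "\<exists>f. \<forall>k. \<forall>a\<in>Gk k. f k a \<in> polys_over A \<and> poly (f k a) x \<in> I \<and> degree (f k a) \<le> k \<and> coeff (f k a) k = a"
  proof (intro choice allI bchoice ballI)
    fix k a assume "a \<in> Gk k"
    with Gk(2) have "a \<in> L I k" by blast
    thus "\<exists>f. f \<in> polys_over A \<and> poly f x \<in> I \<and> degree f \<le> k \<and> coeff f k = a"
      unfolding L_def by blast
  qed
  then obtain f where f: "\<And>k a. a \<in> Gk k \<Longrightarrow> f k a \<in> polys_over A \<and> poly (f k a) x \<in> I \<and> degree (f k a) \<le> k \<and> coeff (f k a) k = a"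
    by blast
  show "\<exists>G. finite G \<and> G \<subseteq> I \<and> (\<forall>I'. ideal_of (adjoin A x) I' \<longrightarrow> G \<subseteq> I' \<longrightarrow> I \<subseteq> I')"
  proof (intro exI[of _ "\<Union>k\<le>d. (\<lambda>a. poly (f k a) x) ` Gk k"] conjI allI impI)
    show "finite (\<Union>k\<le>d. (\<lambda>a. poly (f k a) x) ` Gk k)" using Gk(1) by blast
    show "(\<Union>k\<le>d. (\<lambda>a. poly (f k a) x) ` Gk k) \<subseteq> I" using f by blast
  next
    fix I' assume I': "ideal_of (adjoin A x) I'" "(\<Union>k\<le>d. (\<lambda>a. poly (f k a) x) ` Gk k) \<subseteq> I'"
    have key: "L I k \<subseteq> L I' k" if "k \<le> d" for k
    proof (rule Gk(3)[OF ideal_L[OF I'(1)]], rule subsetI)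
      fix a assume a: "a \<in> Gk k"
      with that I'(2) have "poly (f k a) x \<in> I'" by blast
      thus "a \<in> L I' k" using f[OF a] unfolding L_def by (intro CollectI exI[of _ "f k a"]) auto
    qed
    have "poly h x \<in> I'" if "h \<in> polys_over A" "poly h x \<in> I" for h
      using that
    proof (induction "degree h" arbitrary: h rule: less_induct)
      case less
      \<comment> \<open>Beyond \<open>d\<close> every leading coefficient already occurs in degree
        \<open>d\<close>; the cancelling polynomial is taken from there and shifted up by a power of
        the variable.\<close>
      define k where "k = min d (degree h)"
      have "coeff h (degree h) \<in> L I (degree h)" using less.prems unfolding L_def by blast
      hence "coeff h (degree h) \<in> L I k" using L_stable unfolding k_def min_def by auto
      hence "coeff h (degree h) \<in> L I' k" using key[of k] by (auto simp: k_def)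
      then obtain g where g: "g \<in> polys_over A" "poly g x \<in> I'" "poly g x \<in> I" "degree g \<le> k" "coeff g k = coeff h (degree h)"
        unfolding L_def by auto
      define g' where "g' = monom 1 (degree h - k) * g"
      have g': "g' \<in> polys_over A" "poly g' x \<in> I'" "poly g' x \<in> I"
        using ideal_ofD(4)[OF I xA g(3)] ideal_ofD(4)[OF I'(1) xA g(2)]
        by (auto simp: g'_def poly_monom intro!: polys_over_closed[OF A] subring_setD[OF A] g)
      have "degree g' \<le> (degree h - k) + k"
        unfolding g'_def by (rule order.trans[OF degree_mult_le] add_mono degree_monom_le g(4))+
      hence dg: "degree g' \<le> degree h" by (simp add: k_def)
      have cg: "coeff g' (degree h) = coeff h (degree h)"
        unfolding g'_def using g(5) by (simp add: coeff_monom_mult k_def)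
      have mem: "h - g' \<in> polys_over A" "poly (h - g') x \<in> I"
        using less.prems g' by (auto intro!: polys_over_closed[OF A] ideal_of_diff[OF subring_set_adjoin[OF A] I])
      have "poly (h - g') x \<in> I'"
      proof (cases "h - g' = 0")
        case True thus ?thesis using ideal_ofD(2)[OF I'(1)] by simp
      next
        case False
        have "degree (h - g') \<le> degree h" using dg by (intro degree_diff_le) auto
        moreover have "degree (h - g') \<noteq> degree h"
          using False cg by (metis coeff_diff diff_self leading_coeff_0_iff)
        ultimately have "degree (h - g') < degree h" by simp
        thus ?thesis by (rule less.hyps[OF _ mem])
      qed
      hence "poly (h - g') x + poly g' x \<in> I'" using ideal_ofD(3)[OF I'(1)] g' by blast
      thus ?case by simp
    qed
    thus "I \<subseteq> I'" using ideal_ofD(1)[OF I] unfolding adjoin_def by blast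
  qed
qed

section \<open>The Nullstellensatz for polynomial functions\<close>

text \<open>Functions take the place of formal polynomials, and \<open>V\<close> lists the variables
  that may occur. The pointwise operations of the function type make this a
  \<open>subring_set\<close>.\<close>

inductive_set polyfun :: "'i set \<Rightarrow> (('i \<Rightarrow> 'a::comm_ring_1) \<Rightarrow> 'a) set" for V where
  polyfun_const: "(\<lambda>_. c) \<in> polyfun V"
| polyfun_var: "i \<in> V \<Longrightarrow> (\<lambda>x. x i) \<in> polyfun V"
| polyfun_add: "f \<in> polyfun V \<Longrightarrow> g \<in> polyfun V \<Longrightarrow> (\<lambda>x. f x + g x) \<in> polyfun V"
| polyfun_mult: "f \<in> polyfun V \<Longrightarrow> g \<in> polyfun V \<Longrightarrow> (\<lambda>x. f x * g x) \<in> polyfun V"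

lemma sum_fun_apply: "(\<Sum>i\<in>S. f i) x = (\<Sum>i\<in>S. f i x)"
  by (induction S rule: infinite_finite_induct) auto

lemma power_fun_apply: "(f ^ n) x = f x ^ n" for f :: "'a \<Rightarrow> 'b::comm_ring_1"
  by (induction n) auto

lemma subring_set_polyfun: "subring_set (polyfun V)"
  unfolding subring_set_def
proof (intro conjI ballI)
  show "1 \<in> polyfun V" using polyfun_const[of 1] by (simp add: one_fun_def)
  show "- f \<in> polyfun V" if "f \<in> polyfun V" for f :: "('a \<Rightarrow> 'b) \<Rightarrow> 'b"
    using polyfun_mult[OF polyfun_const[of "- 1"] that] by (simp add: fun_Compl_def)
qed (auto simp: plus_fun_def times_fun_def intro: polyfun_add polyfun_mult)

lemmas polyfun_closed = subring_setD[OF subring_set_polyfun] subring_set_sum[OF subring_set_polyfun]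

lemma polyfun_sum: "(\<And>j. j \<in> S \<Longrightarrow> f j \<in> polyfun V) \<Longrightarrow> (\<lambda>x. \<Sum>j\<in>S. f j x) \<in> polyfun V"
  by (induction S rule: infinite_finite_induct) (auto intro: polyfun_const polyfun_add)

lemma polyfun_power: "f \<in> polyfun V \<Longrightarrow> (\<lambda>x. f x ^ n) \<in> polyfun V"
  by (induction n) (auto intro: polyfun_const polyfun_mult)

lemma polyfun_prod: "(\<And>j. j \<in> S \<Longrightarrow> f j \<in> polyfun V) \<Longrightarrow> (\<lambda>x. \<Prod>j\<in>S. f j x) \<in> polyfun V"
  by (induction S rule: infinite_finite_induct) (auto intro: polyfun_const polyfun_mult)

lemma polyfun_subtract: "f \<in> polyfun V \<Longrightarrow> g \<in> polyfun V \<Longrightarrow> (\<lambda>x. f x - g x) \<in> polyfun V"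
  using polyfun_add[OF _ polyfun_mult[OF polyfun_const[of "- 1"]], of f V g] by simp

lemma polyfun_mono: "f \<in> polyfun V \<Longrightarrow> V \<subseteq> W \<Longrightarrow> f \<in> polyfun W"
  by (induction rule: polyfun.induct) (auto intro: polyfun.intros)

lemma polyfun_cong: "f \<in> polyfun V \<Longrightarrow> (\<And>i. i \<in> V \<Longrightarrow> a i = b i) \<Longrightarrow> f a = f b"
  by (induction rule: polyfun.induct) auto

lemma adjoin_least:
  assumes "subring_set B" "A \<subseteq> B" "x \<in> B"
  shows "adjoin A x \<subseteq> B"
proof
  fix y assume "y \<in> adjoin A x"
  then obtain f where f: "f \<in> polys_over A" "y = poly f x" by (auto simp: adjoin_def)
  have "coeff f i \<in> B" for i using polys_overD[OF f(1)] assms(2) by blast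
  thus "y \<in> B" unfolding f(2) poly_altdef
    by (intro subring_set_sum[OF assms(1)] subring_setD[OF assms(1)] assms(3))
qed

lemma adjoin_base: "subring_set A \<Longrightarrow> A \<subseteq> adjoin A x"
proof
  fix a assume "subring_set A" "a \<in> A"
  thus "a \<in> adjoin A x" using adjoinI[OF polys_over_closed(5)[of A a 0], of x] by (simp add: poly_monom)
qed

lemma adjoin_gen: "subring_set A \<Longrightarrow> x \<in> adjoin A x"
  using adjoinI[OF polys_over_closed(5)[of A 1 1], of x] subring_setD(2)[of A] by (simp add: poly_monom)

text \<open>Adding a variable adjoins one element, so facts about \<open>adjoin\<close> drive
  inductions on the number of variables.\<close>

lemma polyfun_insert:
  "(polyfun (insert i V) :: (('i \<Rightarrow> 'a::comm_ring_1) \<Rightarrow> 'a) set) = adjoin (polyfun V) (\<lambda>x. x i)"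
proof
  note S = subring_setD[OF subring_set_adjoin[OF subring_set_polyfun[of V], of "\<lambda>x :: 'i \<Rightarrow> 'a. x i"]]
  show "(polyfun (insert i V) :: (('i \<Rightarrow> 'a) \<Rightarrow> 'a) set) \<subseteq> adjoin (polyfun V) (\<lambda>x. x i)"
  proof
    fix f :: "('i \<Rightarrow> 'a) \<Rightarrow> 'a" assume "f \<in> polyfun (insert i V)"
    thus "f \<in> adjoin (polyfun V) (\<lambda>x. x i)"
    proof induction
      case (polyfun_const c)
      show ?case by (rule subsetD[OF adjoin_base[OF subring_set_polyfun] polyfun.polyfun_const])
    next
      case (polyfun_var j)
      show ?case
      proof (cases "j = i")
        case True thus ?thesis using adjoin_gen[OF subring_set_polyfun] by simp
      next
        case False
        with polyfun_var have "j \<in> V" by simp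
        thus ?thesis by (rule subsetD[OF adjoin_base[OF subring_set_polyfun] polyfun.polyfun_var])
      qed
    next
      case (polyfun_add f g)
      show ?case using S(4)[OF polyfun_add.IH] unfolding plus_fun_def .
    next
      case (polyfun_mult f g)
      show ?case using S(6)[OF polyfun_mult.IH] unfolding times_fun_def .
    qed
  qed
  show "adjoin (polyfun V) (\<lambda>x. x i) \<subseteq> polyfun (insert i V)"
  proof (rule adjoin_least[OF subring_set_polyfun])
    show "polyfun V \<subseteq> polyfun (insert i V)" using polyfun_mono[of _ V "insert i V"] by blast
  qed (simp add: polyfun_var)
qed

lemma polyfun_empty: "(polyfun {} :: (('i \<Rightarrow> 'a::comm_ring_1) \<Rightarrow> 'a) set) = range (\<lambda>c _. c)"
proof
  show "(polyfun {} :: (('i \<Rightarrow> 'a) \<Rightarrow> 'a) set) \<subseteq> range (\<lambda>c _. c)"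
  proof
    fix f :: "('i \<Rightarrow> 'a) \<Rightarrow> 'a" assume "f \<in> polyfun {}"
    thus "f \<in> range (\<lambda>c _. c)" by induction auto
  qed
qed (auto intro: polyfun_const)

lemma noetherian_polyfun:
  assumes "finite V"
  shows "noetherian (polyfun V :: (('i \<Rightarrow> 'k::field) \<Rightarrow> 'k) set)"
  using assms
proof (induction V)
  case empty
  show ?case unfolding noetherian_def
  proof (intro allI impI)
    fix I assume I: "ideal_of (polyfun {}) (I :: (('i \<Rightarrow> 'k) \<Rightarrow> 'k) set)"
    show "\<exists>G. finite G \<and> G \<subseteq> I \<and> (\<forall>I'. ideal_of (polyfun {}) I' \<longrightarrow> G \<subseteq> I' \<longrightarrow> I \<subseteq> I')"
    \<comment> \<open>The constants form a field: an ideal is zero or generated by any nonzero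
      constant in it.\<close>
    proof (cases "\<exists>c. c \<noteq> 0 \<and> (\<lambda>_. c) \<in> I")
      case True
      then obtain c where c: "c \<noteq> 0" "(\<lambda>_. c) \<in> I" by blast
      show ?thesis
      proof (intro exI[of _ "{\<lambda>_. c}"] conjI allI impI subsetI)
        fix I' and f :: "('i \<Rightarrow> 'k) \<Rightarrow> 'k"
        assume I': "ideal_of (polyfun {}) I'" "{\<lambda>_::'i \<Rightarrow> 'k. c} \<subseteq> I'" and "f \<in> I"
        then obtain b where b: "f = (\<lambda>_. b)" using ideal_ofD(1)[OF I] by (auto simp: polyfun_empty)
        have "(\<lambda>_. b / c) * (\<lambda>_. c) \<in> I'"
          using I' by (intro ideal_ofD(4)[OF I'(1)] polyfun_const) auto
        thus "f \<in> I'" using c b by (simp add: times_fun_def)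
      qed (use c in auto)
    next
      case False
      hence "I \<subseteq> {0}" using ideal_ofD(1)[OF I] by (auto simp: polyfun_empty zero_fun_def subset_iff)
      thus ?thesis using ideal_ofD(2) by (intro exI[of _ "{}"]) blast
    qed
  qed
next
  case (insert i V)
  thus ?case unfolding polyfun_insert by (intro hilbert_basis subring_set_polyfun)
qed

section \<open>Prime ideals of polynomial functions and their zeros\<close>

definition prime_ideal_of :: "'a::comm_ring_1 set \<Rightarrow> 'a set \<Rightarrow> bool" where
  "prime_ideal_of A P \<longleftrightarrow> ideal_of A P \<and> 1 \<notin> P \<and> (\<forall>x\<in>A. \<forall>y\<in>A. x * y \<in> P \<longrightarrow> x \<in> P \<or> y \<in> P)"

lemma prime_ideal_ofD:
  assumes "prime_ideal_of A P"
  shows "ideal_of A P" "1 \<notin> P" "x \<in> A \<Longrightarrow> y \<in> A \<Longrightarrow> x * y \<in> P \<Longrightarrow> x \<in> P \<or> y \<in> P"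
  using assms by (auto simp: prime_ideal_of_def)

lemma prime_ideal_of_power:
  assumes "subring_set A" "prime_ideal_of A P" "x \<in> A" "x ^ n \<in> P"
  shows "x \<in> P"
  using assms(4)
proof (induction n)
  case (Suc n)
  thus ?case using prime_ideal_ofD(3)[OF assms(2,3) subring_setD(7)[OF assms(1,3)], of n] by auto
qed (use prime_ideal_ofD[OF assms(2)] in auto)

lemma prime_ideal_of_contract:
  assumes "prime_ideal_of B P" "subring_set A" "A \<subseteq> B"
  shows "prime_ideal_of A (P \<inter> A)"
proof -
  note P = prime_ideal_ofD[OF assms(1)]
  have "ideal_of A (P \<inter> A)"
    unfolding ideal_of_def
    using ideal_ofD(2)[OF P(1)] subring_setD(1)[OF assms(2)] assms(3)
    by (auto intro!: ideal_ofD(3,4)[OF P(1)] subring_setD(4,6)[OF assms(2)])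
  moreover have "x \<in> P \<inter> A \<or> y \<in> P \<inter> A" if "x \<in> A" "y \<in> A" "x * y \<in> P \<inter> A" for x y
    using P(3)[of x y] that assms(3) by blast
  ultimately show ?thesis unfolding prime_ideal_of_def using P(2) by simp
qed

text \<open>An ideal maximal among those that contain \<open>I\<close> and avoid the powers of
  \<open>g\<close> is prime: if \<open>x\<close> and \<open>y\<close> lie outside it, adding either
  one brings in a power of \<open>g\<close>, and the product of these two powers lies in the ideal
  as soon as \<open>x * y\<close> does.\<close>

lemma prime_ideal_avoiding_powers:
  assumes A: "subring_set A" and I: "ideal_of A I" and g: "g \<in> A" and e: "\<And>e. g ^ e \<notin> I"
  obtains P where "prime_ideal_of A P" "I \<subseteq> P" "g \<notin> P"
proof -
  define S where "S = {Q. ideal_of A Q \<and> I \<subseteq> Q \<and> (\<forall>e. g ^ e \<notin> Q)}"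
  have "\<exists>P\<in>S. \<forall>Q\<in>S. P \<subseteq> Q \<longrightarrow> Q = P"
  proof (rule subset_Zorn_nonempty)
    show "S \<noteq> {}" using I e by (auto simp: S_def)
    fix C assume C: "C \<noteq> {}" "subset.chain S C"
    hence CS: "\<And>Q. Q \<in> C \<Longrightarrow> ideal_of A Q \<and> I \<subseteq> Q \<and> (\<forall>e. g ^ e \<notin> Q)"
      by (auto simp: subset.chain_def S_def)
    have "ideal_of A (\<Union>C)"
      unfolding ideal_of_def
    proof (intro conjI ballI)
      fix x y assume "x \<in> \<Union>C" "y \<in> \<Union>C"
      then obtain Q R where Q: "Q \<in> C" "x \<in> Q" "R \<in> C" "y \<in> R" by blast
      have "Q \<subseteq> R \<or> R \<subseteq> Q" using C(2) Q by (auto simp: subset.chain_def)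
      then obtain T where "T \<in> C" "x \<in> T" "y \<in> T" using Q by blast
      thus "x + y \<in> \<Union>C" using CS ideal_ofD(3) by blast
    next
      show "\<Union>C \<subseteq> A" "0 \<in> \<Union>C" using C(1) CS ideal_ofD(1,2) by blast+
      show "\<And>a x. a \<in> A \<Longrightarrow> x \<in> \<Union>C \<Longrightarrow> a * x \<in> \<Union>C" using CS ideal_ofD(4) by blast
    qed
    thus "\<Union>C \<in> S" using C(1) CS by (auto simp: S_def)
  qed
  then obtain P where PS: "P \<in> S" "\<And>Q. Q \<in> S \<Longrightarrow> P \<subseteq> Q \<Longrightarrow> Q = P" by blast
  hence P: "ideal_of A P" "I \<subseteq> P" "\<And>e. g ^ e \<notin> P" by (auto simp: S_def)
  have max: "Q = P" if "ideal_of A Q" "P \<subseteq> Q" "\<And>e. g ^ e \<notin> Q" for Q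
    using that P(2) by (intro PS(2)) (auto simp: S_def)
  have hit: "\<exists>e. \<exists>p\<in>P. \<exists>a\<in>A. g ^ e = p + a * x" if x: "x \<in> A" "x \<notin> P" for x
  proof -
    define Q where "Q = {p + a * x |p a. p \<in> P \<and> a \<in> A}"
    have "ideal_of A Q"
      unfolding ideal_of_def
    proof (intro conjI ballI)
      show "Q \<subseteq> A" using ideal_ofD(1)[OF P(1)] x by (auto simp: Q_def intro!: subring_setD[OF A])
      show "0 \<in> Q" unfolding Q_def using ideal_ofD(2)[OF P(1)] subring_setD(1)[OF A]
        by (intro CollectI exI[of _ 0]) auto
    next
      fix y z assume "y \<in> Q" "z \<in> Q"
      then obtain p a q b where *: "p \<in> P" "a \<in> A" "q \<in> P" "b \<in> A" "y = p + a * x" "z = q + b * x"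
        by (auto simp: Q_def)
      hence "y + z = (p + q) + (a + b) * x" "p + q \<in> P" "a + b \<in> A"
        using ideal_ofD(3)[OF P(1)] subring_setD(4)[OF A] by (auto simp: algebra_simps)
      thus "y + z \<in> Q" unfolding Q_def by blast
    next
      fix b y assume b: "b \<in> A" and "y \<in> Q"
      then obtain p a where *: "p \<in> P" "a \<in> A" "y = p + a * x" by (auto simp: Q_def)
      hence "b * y = b * p + (b * a) * x" "b * p \<in> P" "b * a \<in> A"
        using b ideal_ofD(4)[OF P(1)] subring_setD(6)[OF A] by (auto simp: algebra_simps)
      thus "b * y \<in> Q" unfolding Q_def by blast
    qed
    moreover have "P \<subseteq> Q"
    proof
      fix p assume "p \<in> P"
      hence "p = p + 0 * x" "p \<in> P" "0 \<in> A" using subring_setD(1)[OF A] by auto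
      thus "p \<in> Q" unfolding Q_def by blast
    qed
    moreover have "x \<in> Q" unfolding Q_def
      using ideal_ofD(2)[OF P(1)] subring_setD(2)[OF A] by (intro CollectI exI[of _ 0] exI[of _ 1]) auto
    ultimately have "\<exists>e. g ^ e \<in> Q" using max[of Q] x(2) by blast
    thus ?thesis unfolding Q_def by blast
  qed
  have "prime_ideal_of A P"
    unfolding prime_ideal_of_def
  proof (intro conjI ballI impI)
    show "1 \<notin> P" using P(3)[of 0] by simp
    fix x y assume xy: "x \<in> A" "y \<in> A" "x * y \<in> P"
    show "x \<in> P \<or> y \<in> P"
    proof (rule ccontr)
      assume "\<not> (x \<in> P \<or> y \<in> P)"
      then obtain e p a d q b where *: "p \<in> P" "a \<in> A" "g ^ e = p + a * x" "q \<in> P" "b \<in> A" "g ^ d = q + b * y"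
        using hit xy by metis
      have "g ^ (e + d) = (q + b * y) * p + (a * x) * q + (a * b) * (x * y)"
        by (simp add: power_add * algebra_simps)
      moreover have "q + b * y \<in> A" "a * x \<in> A" "a * b \<in> A"
        using * xy ideal_ofD(1)[OF P(1)] by (auto intro!: subring_setD[OF A])
      ultimately have "g ^ (e + d) \<in> P"
        using * xy by (auto intro!: ideal_ofD(3,4)[OF P(1)])
      thus False using P(3) by blast
    qed
  qed (rule P(1))
  thus thesis using that P(2) P(3)[of 1] by simp
qed

text \<open>Division with remainder without inverting the leading coefficient: each cancellation
  multiplies by it once, hence the power on the left.\<close>

lemma pseudo_division:
  assumes A: "subring_set A" and q: "q \<in> polys_over A" "degree q > 0" and f: "f \<in> polys_over A"
  shows "\<exists>k h r. h \<in> polys_over A \<and> r \<in> polys_over A \<and> degree r < degree q \<and>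
    smult (lead_coeff q ^ k) f = q * h + r"
  using f
proof (induction "degree f" arbitrary: f rule: less_induct)
  case less
  let ?c = "lead_coeff q" and ?b = "lead_coeff f"
  show ?case
  proof (cases "degree f < degree q")
    case True
    thus ?thesis using less.prems polys_over_closed(6)[OF A]
      by (intro exI[of _ 0] exI[of _ 0] exI[of _ f]) auto
  next
    case False
    define g where "g = monom ?b (degree f - degree q)"
    define f' where "f' = smult ?c f - q * g"
    have g: "g \<in> polys_over A" unfolding g_def
      by (intro polys_over_closed[OF A] polys_overD less.prems)
    have f': "f' \<in> polys_over A" unfolding f'_def
      by (intro polys_over_closed[OF A] polys_overD less.prems q g)
    have "degree (q * g) \<le> degree q + (degree f - degree q)"
      unfolding g_def by (rule order.trans[OF degree_mult_le] add_mono degree_monom_le order.refl)+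
    hence "degree f' \<le> degree f"
      unfolding f'_def using False by (intro degree_diff_le) (auto intro: degree_smult_le[THEN order.trans])
    moreover have "coeff f' (degree f) = 0"
      using False by (simp add: f'_def g_def mult.commute[of q] coeff_monom_mult)
    ultimately have "degree f' < degree f"
      using False q(2) leading_coeff_0_iff[of f'] by (cases "f' = 0") (auto simp del: leading_coeff_0_iff simp: le_less)
    then obtain k h r where *: "h \<in> polys_over A" "r \<in> polys_over A" "degree r < degree q"
      "smult (?c ^ k) f' = q * h + r" using less.hyps f' by metis
    have "smult (?c ^ Suc k) f = q * (smult (?c ^ k) g + h) + r"
      using *(4) unfolding f'_def by (simp add: algebra_simps smult_diff_right)
    moreover have "smult (?c ^ k) g + h \<in> polys_over A"
      by (intro polys_over_closed[OF A] subring_setD(7)[OF A] polys_overD q g *)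
    ultimately show ?thesis using * by blast
  qed
qed

text \<open>\<open>q\<close> is a product of linear factors, each of which divides \<open>w\<close>;
  the exponent \<open>degree q\<close> allows for multiple roots. It is applied in the
  contrapositive, to find a root of \<open>q\<close> that is not a root of \<open>w\<close>.\<close>

lemma dvd_power_of_roots:
  fixes q w :: "'k::field poly"
  assumes ac: "\<And>h :: 'k poly. degree h > 0 \<Longrightarrow> \<exists>x. poly h x = 0"
    and "q \<noteq> 0" "\<And>x. poly q x = 0 \<Longrightarrow> poly w x = 0"
  shows "q dvd w ^ degree q"
  using assms(2,3)
proof (induction "degree q" arbitrary: q)
  case 0
  thus ?case by (auto simp: is_unit_iff_degree)
next
  case (Suc n)
  then obtain x where x: "poly q x = 0" using ac[of q] by auto
  then obtain q' where q': "q = [:- x, 1:] * q'" by (auto simp: poly_eq_0_iff_dvd elim: dvdE)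
  from x Suc.prems have "poly w x = 0" by blast
  then have w: "[:- x, 1:] dvd w" by (simp add: poly_eq_0_iff_dvd)
  have "q' \<noteq> 0" using Suc.prems q' by auto
  hence "degree q = 1 + degree q'" unfolding q' by (subst degree_mult_eq) auto
  hence d: "n = degree q'" using Suc.hyps(2) by simp
  have "q' dvd w ^ degree q'" using Suc.hyps(1)[OF d \<open>q' \<noteq> 0\<close>] Suc.prems(2) q' by auto
  hence "[:- x, 1:] * q' dvd w * w ^ degree q'" using w by (rule mult_dvd_mono[rotated])
  thus ?case unfolding Suc.hyps(2)[symmetric] d q'[symmetric] by simp
qed

text \<open>Specialises coefficients that are themselves functions at a point \<open>a\<close>. The
  degree can drop, which is why leading coefficients must be kept nonzero at \<open>a\<close> later
  on.\<close>

definition poly_at :: "('b \<Rightarrow> 'a::comm_ring_1) poly \<Rightarrow> 'b \<Rightarrow> 'a poly" where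
  "poly_at f a = map_poly (\<lambda>c. c a) f"

lemma coeff_poly_at [simp]: "coeff (poly_at f a) n = coeff f n a"
  by (simp add: poly_at_def coeff_map_poly)

lemma degree_poly_at_le: "degree (poly_at f a) \<le> degree f"
  by (intro degree_le) (simp add: coeff_eq_0)

lemma ideal_of_sum:
  assumes "ideal_of A I" "\<And>j. j \<in> S \<Longrightarrow> f j \<in> I"
  shows "sum f S \<in> I"
  using assms(2) by (induction S rule: infinite_finite_induct) (auto intro: ideal_ofD[OF assms(1)])

lemma poly_at_add: "poly_at (f + g) a = poly_at f a + poly_at g a"
  by (intro poly_eqI) simp

lemma poly_at_mult: "poly_at (f * g) a = poly_at f a * poly_at g a"
  by (intro poly_eqI) (simp add: coeff_mult sum_fun_apply)

lemma poly_at_smult: "poly_at (smult c g) a = smult (c a) (poly_at g a)"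
  by (intro poly_eqI) simp

lemma poly_at_power: "poly_at (f ^ n) a = poly_at f a ^ n"
proof (induction n)
  case 0 thus ?case by (intro poly_eqI) (simp add: coeff_1)
qed (simp add: poly_at_mult)

lemma poly_poly_at: "poly f Xi a = poly (poly_at f a) (Xi a)"
proof -
  have "poly (poly_at f a) (Xi a) = (\<Sum>i\<le>degree f. coeff f i a * Xi a ^ i)"
    unfolding poly_altdef coeff_poly_at using degree_poly_at_le[of f a] coeff_eq_0[of "poly_at f a"]
    by (intro sum.mono_neutral_left) auto
  thus ?thesis by (simp add: poly_altdef sum_fun_apply power_fun_apply)
qed

text \<open>Zeros of the contracted ideal extend to zeros of \<open>P\<close> outside a hypersurface
  \<open>u = 0\<close>, and the extension can keep \<open>v\<close> nonzero. The proof distinguishes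
  whether the new variable is transcendental or algebraic modulo \<open>P\<close>; in the algebraic
  case \<xi> is a root of a specialised minimal equation.\<close>

lemma prime_point_step:
  fixes P :: "(('i \<Rightarrow> 'k::field) \<Rightarrow> 'k) set"
  assumes inf: "infinite (UNIV :: 'k set)"
    and ac: "\<And>h :: 'k poly. degree h > 0 \<Longrightarrow> \<exists>x. poly h x = 0"
    and i: "i \<notin> V" and P: "prime_ideal_of (polyfun (insert i V)) P"
    and v: "v \<in> polyfun (insert i V)" "v \<notin> P"
  shows "\<exists>u \<in> polyfun V. u \<notin> P \<and> (\<forall>a. (\<forall>f \<in> P \<inter> polyfun V. f a = 0) \<and> u a \<noteq> 0 \<longrightarrow>
    (\<exists>\<xi>. (\<forall>f \<in> P. f (a(i := \<xi>)) = 0) \<and> v (a(i := \<xi>)) \<noteq> 0))"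
proof -
  define Xi :: "('i \<Rightarrow> 'k) \<Rightarrow> 'k" where "Xi = (\<lambda>x. x i)"
  define A :: "(('i \<Rightarrow> 'k) \<Rightarrow> 'k) set" where "A = polyfun V"
  define B :: "(('i \<Rightarrow> 'k) \<Rightarrow> 'k) set" where "B = polyfun (insert i V)"
  have B: "B = adjoin A Xi" unfolding A_def B_def Xi_def by (rule polyfun_insert)
  have sA: "subring_set A" and sB: "subring_set B" unfolding A_def B_def by (rule subring_set_polyfun)+
  have AB: "A \<subseteq> B" unfolding B by (rule adjoin_base[OF sA])
  have XB: "Xi \<in> B" unfolding B by (rule adjoin_gen[OF sA])
  note PB = P[folded B_def]
  note PI = ideal_ofD[OF prime_ideal_ofD(1)[OF PB]] and PP = prime_ideal_ofD(2,3)[OF PB]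
  have polyB: "poly f Xi \<in> B" if "f \<in> polys_over A" for f unfolding B by (rule adjoinI[OF that])
  have rep: "\<exists>q \<in> polys_over A. f = poly q Xi" if "f \<in> B" for f
    using that unfolding B adjoin_def by blast
  have eval: "poly q Xi (a(i := \<xi>)) = poly (poly_at q a) \<xi>" if "q \<in> polys_over A" for q a \<xi>
  proof -
    have "poly_at q (a(i := \<xi>)) = poly_at q a"
    proof (rule poly_eqI)
      fix n
      show "coeff (poly_at q (a(i := \<xi>))) n = coeff (poly_at q a) n"
        unfolding coeff_poly_at
        by (rule polyfun_cong[OF polys_overD[OF that, unfolded A_def]]) (use i in auto)
    qed
    thus ?thesis by (simp add: poly_poly_at Xi_def)
  qed
  have in_P: "poly q Xi \<in> P" if "q \<in> polys_over A" "\<And>n. coeff q n \<in> P" for q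
  proof -
    have "Xi ^ n * coeff q n \<in> P" for n using PI(4)[OF subring_setD(7)[OF sB XB] that(2)] .
    hence "(\<Sum>n\<le>degree q. Xi ^ n * coeff q n) \<in> P"
      by (rule ideal_of_sum[OF prime_ideal_ofD(1)[OF PB]])
    thus ?thesis by (simp add: poly_altdef mult.commute)
  qed
  \<comment> \<open>The genuine equations of the new variable modulo \<open>P\<close>. A polynomial
    with value in \<open>P\<close> and of smaller degree than all of these has all coefficients in
    \<open>P\<close>, because its leading coefficient must lie in \<open>P\<close> and can be
    stripped off.\<close>
  define Q where "Q = {q \<in> polys_over A. poly q Xi \<in> P \<and> lead_coeff q \<notin> P}"
  have strip: "coeff q n \<in> P" if "q \<in> polys_over A" "poly q Xi \<in> P" "\<And>q'. q' \<in> Q \<Longrightarrow> degree q < degree q'" for q n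
    using that
  proof (induction "degree q" arbitrary: q n rule: less_induct)
    case less
    have lead: "lead_coeff q \<in> P"
      using less.prems unfolding Q_def by blast
    define q' where "q' = q - monom (lead_coeff q) (degree q)"
    have q': "q' \<in> polys_over A"
      unfolding q'_def by (intro polys_over_closed[OF sA] polys_overD less.prems)
    have "Xi ^ degree q * lead_coeff q \<in> P" by (rule PI(4)[OF subring_setD(7)[OF sB XB] lead])
    hence "poly q Xi - Xi ^ degree q * lead_coeff q \<in> P"
      by (rule ideal_of_diff[OF sB prime_ideal_ofD(1)[OF PB] less.prems(2)])
    hence q'P: "poly q' Xi \<in> P" by (simp add: q'_def poly_monom mult.commute)
    have "coeff q' n \<in> P"
    proof (cases "q' = 0")
      case False
      have "degree q' \<le> degree q" unfolding q'_def by (intro degree_diff_le degree_monom_le) simp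
      moreover have "coeff q' (degree q) = 0" by (simp add: q'_def)
      hence "degree q' \<noteq> degree q" using False leading_coeff_0_iff[of q'] by metis
      ultimately have "degree q' < degree q" by simp
      thus ?thesis using less.prems(3) by (intro less.hyps q' q'P) force+
    qed (simp add: PI(2))
    moreover have "coeff q n = coeff q' n + (if n = degree q then lead_coeff q else 0)"
      by (simp add: q'_def)
    ultimately show ?case using PI(2,3) lead by (auto split: if_splits)
  qed
  obtain w where w: "w \<in> polys_over A" "v = poly w Xi" using rep v(1) B_def by blast
  show ?thesis
  proof (cases "Q = {}")
    \<comment> \<open>Transcendental case: members of \<open>P\<close> specialise to the zero
      polynomial, so every \<xi> outside the finitely many roots of the specialised \<open>w\<close>
      will do.\<close>
    case True
    obtain n where n: "coeff w n \<notin> P" using in_P[OF w(1)] w(2) v(2) by blast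
    show ?thesis
    proof (intro bexI[of _ "coeff w n"] conjI allI impI n)
      show "coeff w n \<in> polyfun V" using polys_overD[OF w(1)] by (simp add: A_def)
      fix a assume a: "(\<forall>f \<in> P \<inter> polyfun V. f a = 0) \<and> coeff w n a \<noteq> 0"
      hence "poly_at w a \<noteq> 0" by (metis coeff_0 coeff_poly_at)
      hence "finite {\<xi>. poly (poly_at w a) \<xi> = 0}" by (rule poly_roots_finite)
      then obtain \<xi> where \<xi>: "poly (poly_at w a) \<xi> \<noteq> 0" using inf ex_new_if_finite by blast
      have "f (a(i := \<xi>)) = 0" if f: "f \<in> P" for f
      proof -
        obtain q where q: "q \<in> polys_over A" "f = poly q Xi" using rep PI(1) f by blast
        have "coeff q n \<in> P \<inter> polyfun V" for n
          using strip[OF q(1)] q f True polys_overD[OF q(1)] by (auto simp: A_def)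
        hence "poly_at q a = 0" using a by (intro poly_eqI) simp
        thus ?thesis by (simp add: q(2) eval[OF q(1)])
      qed
      thus "\<exists>\<xi>. (\<forall>f \<in> P. f (a(i := \<xi>)) = 0) \<and> v (a(i := \<xi>)) \<noteq> 0"
        using \<xi> eval[OF w(1), of a \<xi>] w(2) by (intro exI[of _ \<xi>]) simp
    qed
  next
    case False
    \<comment> \<open>Algebraic case: an equation of least degree plays the part of the minimal
      polynomial.\<close>
    define q where "q = arg_min degree (\<lambda>q. q \<in> Q)"
    have q: "q \<in> Q" and q_min: "\<And>q'. q' \<in> Q \<Longrightarrow> degree q \<le> degree q'"
      unfolding q_def using False arg_min_natI[of "\<lambda>q. q \<in> Q"] arg_min_nat_le[of "\<lambda>q. q \<in> Q" _ degree] by auto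
    define c where "c = lead_coeff q"
    have qA: "q \<in> polys_over A" and qP: "poly q Xi \<in> P" and cP: "c \<notin> P" using q by (auto simp: Q_def c_def)
    have cA: "c \<in> A" unfolding c_def by (rule polys_overD[OF qA])
    have deg: "degree q > 0"
    proof (rule ccontr)
      assume "\<not> degree q > 0"
      then obtain b where "q = [:b:]" using degree_eq_zeroE by blast
      thus False using qP cP by (simp add: c_def)
    qed
    have low: "coeff r n \<in> P" if "r \<in> polys_over A" "poly r Xi \<in> P" "degree r < degree q" for r n
      using strip[OF that(1,2)] q_min that(3) by (meson less_le_trans)
    \<comment> \<open>The power \<open>degree q\<close> of \<open>w\<close> is taken because the
      specialised \<open>q\<close> may have multiple roots, so that
      \<open>dvd_power_of_roots\<close> concerns exactly this power.\<close>
    obtain k h r where d: "h \<in> polys_over A" "r \<in> polys_over A" "degree r < degree q"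
      "smult (c ^ k) (w ^ degree q) = q * h + r"
      using pseudo_division[OF sA qA deg polys_over_closed(8)[OF sA w(1)]] unfolding c_def by blast
    have "\<exists>n. coeff r n \<notin> P"
    proof (rule ccontr)
      assume "\<nexists>n. coeff r n \<notin> P"
      hence "poly r Xi \<in> P" using in_P[OF d(2)] by blast
      moreover have "poly h Xi * poly q Xi \<in> P" using PI(4)[OF polyB[OF d(1)] qP] .
      ultimately have "poly h Xi * poly q Xi + poly r Xi \<in> P" using PI(3) by blast
      also have "poly h Xi * poly q Xi + poly r Xi = c ^ k * v ^ degree q"
        using arg_cong[OF d(4), of "\<lambda>p. poly p Xi"] by (simp add: w(2) mult.commute)
      finally have "c ^ k * v ^ degree q \<in> P" .
      moreover have "c ^ k \<in> B" "v ^ degree q \<in> B" using cA AB v(1) by (auto simp: B_def intro!: subring_setD(7)[OF subring_set_polyfun])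
      ultimately have "c ^ k \<in> P \<or> v ^ degree q \<in> P" using PP(2) by blast
      thus False using prime_ideal_of_power[OF sB PB] cP v cA AB by (auto simp: B_def)
    qed
    then obtain n where n: "coeff r n \<notin> P" ..
    have rn: "coeff r n \<in> A" by (rule polys_overD[OF d(2)])
    show ?thesis
    \<comment> \<open>At points with \<open>c a\<close> nonzero the degree of \<open>q\<close> is
      kept, and with \<open>coeff r n a\<close> nonzero the remainder stays nonzero; then the
      specialised \<open>q\<close> cannot divide the power of \<open>w\<close>.\<close>
    proof (intro bexI[of _ "c * coeff r n"] conjI allI impI)
      show "c * coeff r n \<in> polyfun V" using subring_setD(6)[OF sA cA rn] by (simp add: A_def)
      show "c * coeff r n \<notin> P" using PP(2) cP n cA rn AB by blast
      fix a assume a: "(\<forall>f \<in> P \<inter> polyfun V. f a = 0) \<and> (c * coeff r n) a \<noteq> 0"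
      hence ca: "c a \<noteq> 0" and ra: "poly_at r a \<noteq> 0" by (auto simp: poly_eq_iff)
      have da: "degree (poly_at q a) = degree q"
        using degree_poly_at_le[of q a] le_degree[of "poly_at q a" "degree q"] ca by (simp add: c_def)
      have "\<not> poly_at q a dvd poly_at w a ^ degree q"
      proof
        assume "poly_at q a dvd poly_at w a ^ degree q"
        hence "poly_at q a dvd smult (c a ^ k) (poly_at w a ^ degree q)" by (rule dvd_smult)
        also have "smult (c a ^ k) (poly_at w a ^ degree q) = poly_at q a * poly_at h a + poly_at r a"
          using arg_cong[OF d(4), of "\<lambda>p. poly_at p a"]
          by (simp add: poly_at_smult poly_at_power poly_at_add poly_at_mult power_fun_apply)
        finally have "poly_at q a dvd poly_at r a" by (simp add: dvd_add_right_iff)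
        hence "degree (poly_at q a) \<le> degree (poly_at r a)" using ra by (rule dvd_imp_degree_le)
        thus False using da d(3) degree_poly_at_le[of r a] by simp
      qed
      then obtain \<xi> where \<xi>: "poly (poly_at q a) \<xi> = 0" "poly (poly_at w a) \<xi> \<noteq> 0"
        using dvd_power_of_roots[OF ac, of "poly_at q a" "poly_at w a"] da deg by force
      have "f (a(i := \<xi>)) = 0" if f: "f \<in> P" for f
      proof -
        \<comment> \<open>Dividing by \<open>q\<close> leaves a remainder with value in
          \<open>P\<close> and degree below \<open>q\<close>, hence with coefficients in
          \<open>P\<close>; it vanishes at \<open>a\<close>, and a root of \<open>q\<close> becomes
          a zero of \<open>f\<close>.\<close>
        obtain F where F: "F \<in> polys_over A" "f = poly F Xi" using rep PI(1) f by blast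
        obtain k h r where d: "h \<in> polys_over A" "r \<in> polys_over A" "degree r < degree q"
          "smult (c ^ k) F = q * h + r"
          using pseudo_division[OF sA qA deg F(1)] unfolding c_def by blast
        have "c ^ k * f \<in> P" using cA AB by (intro PI(4)[OF _ f] subring_setD(7)[OF sB]) auto
        moreover have "poly h Xi * poly q Xi \<in> P" using PI(4)[OF polyB[OF d(1)] qP] .
        ultimately have "c ^ k * f - poly h Xi * poly q Xi \<in> P"
          by (rule ideal_of_diff[OF sB prime_ideal_ofD(1)[OF PB]])
        also have "c ^ k * f - poly h Xi * poly q Xi = poly r Xi"
          using arg_cong[OF d(4), of "\<lambda>p. poly p Xi"] by (simp add: F(2) algebra_simps)
        finally have "coeff r n \<in> P \<inter> polyfun V" for n
          using low[OF d(2)] d(3) polys_overD[OF d(2)] by (auto simp: A_def)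
        hence "poly_at r a = 0" using a by (intro poly_eqI) simp
        hence "smult (c a ^ k) (poly_at F a) = poly_at q a * poly_at h a"
          using arg_cong[OF d(4), of "\<lambda>p. poly_at p a"]
          by (simp add: poly_at_smult poly_at_add poly_at_mult power_fun_apply)
        hence "c a ^ k * poly (poly_at F a) \<xi> = 0" using \<xi>(1) by (metis mult_zero_left poly_mult poly_smult)
        thus ?thesis using ca by (simp add: F(2) eval[OF F(1)])
      qed
      thus "\<exists>\<xi>. (\<forall>f \<in> P. f (a(i := \<xi>)) = 0) \<and> v (a(i := \<xi>)) \<noteq> 0"
        using \<xi>(2) eval[OF w(1), of a \<xi>] w(2) by (intro exI[of _ \<xi>]) simp
    qed
  qed
qed

text \<open>The function \<open>v\<close> that must stay nonzero is what carries the induction: the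
  \<open>u\<close> produced for one variable is the \<open>v\<close> for the remaining ones.\<close>

lemma nullstellensatz_prime:
  fixes P :: "(('i \<Rightarrow> 'k::field) \<Rightarrow> 'k) set"
  assumes inf: "infinite (UNIV :: 'k set)"
    and ac: "\<And>h :: 'k poly. degree h > 0 \<Longrightarrow> \<exists>x. poly h x = 0"
    and "finite V" "prime_ideal_of (polyfun V) P" "v \<in> polyfun V" "v \<notin> P"
  shows "\<exists>a. (\<forall>f\<in>P. f a = 0) \<and> v a \<noteq> 0"
  using assms(3-)
proof (induction V arbitrary: P v)
  case empty
  note I = ideal_ofD[OF prime_ideal_ofD(1)[OF empty.prems(1)]]
  have "f a = 0" if f: "f \<in> P" for f a
  proof -
    obtain c where c: "f = (\<lambda>_. c)" using f I(1) by (auto simp: polyfun_empty)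
    have "c = 0"
    proof (rule ccontr)
      assume "c \<noteq> 0"
      moreover have "(\<lambda>_. inverse c) * f \<in> P" by (intro I(4) f polyfun_const)
      ultimately have "1 \<in> P" by (simp add: c times_fun_def one_fun_def)
      thus False using prime_ideal_ofD(2)[OF empty.prems(1)] by blast
    qed
    thus ?thesis by (simp add: c)
  qed
  moreover have "v a \<noteq> 0" for a
  proof
    assume "v a = 0"
    hence "v = 0" using empty.prems(2) by (auto simp: polyfun_empty zero_fun_def)
    thus False using I(2) empty.prems(3) unfolding zero_fun_def by simp
  qed
  ultimately show ?case by blast
next
  case (insert i V)
  have sub: "polyfun V \<subseteq> (polyfun (insert i V) :: (('i \<Rightarrow> 'k) \<Rightarrow> 'k) set)"
    using polyfun_mono[of _ V "insert i V"] by blast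
  obtain u where u: "u \<in> polyfun V" "u \<notin> P"
    "\<And>a. (\<forall>f \<in> P \<inter> polyfun V. f a = 0) \<Longrightarrow> u a \<noteq> 0 \<Longrightarrow>
       \<exists>\<xi>. (\<forall>f \<in> P. f (a(i := \<xi>)) = 0) \<and> v (a(i := \<xi>)) \<noteq> 0"
    using prime_point_step[OF inf ac insert.hyps(2) insert.prems] by blast
  have "prime_ideal_of (polyfun V) (P \<inter> polyfun V)"
    by (rule prime_ideal_of_contract[OF insert.prems(1) subring_set_polyfun sub])
  hence "\<exists>a. (\<forall>f\<in>P \<inter> polyfun V. f a = 0) \<and> u a \<noteq> 0"
    by (rule insert.IH) (use u in auto)
  thus ?case using u(3) by blast
qed

text \<open>Algebraic closedness is a hypothesis on the polynomials over the field and not a type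
  class, because for K it is available only in one branch of a case distinction.\<close>

theorem nullstellensatz:
  fixes I :: "(('i \<Rightarrow> 'k::field) \<Rightarrow> 'k) set"
  assumes "infinite (UNIV :: 'k set)"
    and "\<And>h :: 'k poly. degree h > 0 \<Longrightarrow> \<exists>x. poly h x = 0"
    and "finite V" "ideal_of (polyfun V) I" "g \<in> polyfun V" "\<And>a. (\<forall>f\<in>I. f a = 0) \<Longrightarrow> g a = 0"
  shows "\<exists>e. g ^ e \<in> I"
proof (rule ccontr)
  assume "\<nexists>e. g ^ e \<in> I"
  then obtain P where P: "prime_ideal_of (polyfun V) P" "I \<subseteq> P" "g \<notin> P"
    using prime_ideal_avoiding_powers[OF subring_set_polyfun assms(4,5)] by blast
  then obtain a where "\<forall>f\<in>P. f a = 0" "g a \<noteq> 0"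
    using nullstellensatz_prime[OF assms(1-3) P(1) assms(5) P(3)] by blast
  thus False using assms(6) P(2) by blast
qed

section \<open>Anisotropic binary forms and systems of equations\<close>

definition binary_form :: "'k::comm_ring_1 poly \<Rightarrow> 'k \<Rightarrow> 'k \<Rightarrow> 'k" where
  "binary_form h u v = (\<Sum>j\<le>degree h. coeff h j * u ^ j * v ^ (degree h - j))"

lemma binary_form_right_0: "binary_form h u 0 = lead_coeff h * u ^ degree h"
proof -
  have "binary_form h u 0 = (\<Sum>j\<in>{degree h}. coeff h j * u ^ j * 0 ^ (degree h - j))"
    unfolding binary_form_def by (intro sum.mono_neutral_right) (auto simp: power_0_left)
  thus ?thesis by simp
qed

text \<open>The form is v^n h(u/v) with n the degree of h, so a zero with v \<noteq> 0 would give a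
  root of h; at v = 0 only the leading term remains.\<close>

lemma binary_form_eq_0:
  fixes h :: "'k::field poly"
  assumes "degree h > 0" "\<And>x. poly h x \<noteq> 0" "binary_form h u v = 0"
  shows "u = 0 \<and> v = 0"
proof -
  have v: "v = 0"
  proof (rule ccontr)
    assume v: "v \<noteq> 0"
    have "binary_form h u v = v ^ degree h * poly h (u / v)"
      unfolding binary_form_def poly_altdef sum_distrib_left
      using v by (intro sum.cong) (auto simp: power_divide power_diff)
    thus False using v assms(2,3) by simp
  qed
  have "h \<noteq> 0" using assms(1) by auto
  thus ?thesis using v assms by (auto simp: binary_form_right_0)
qed

text \<open>Since the degree is positive, every monomial contains \<open>u\<close> or
  \<open>v\<close>.\<close>

lemma binary_form_in_ideal:
  assumes A: "subring_set A" "ideal_of A I" "\<And>j. (\<lambda>_. coeff h j) \<in> A" and uv: "u \<in> I" "v \<in> I" and d: "degree h > 0"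
  shows "(\<lambda>a. binary_form h (u a) (v a)) \<in> I"
proof -
  note I = ideal_ofD[OF A(2)]
  have IA: "x \<in> A" if "x \<in> I" for x using I(1) that by blast
  have t: "(\<lambda>_. coeff h j) * u ^ j * v ^ (degree h - j) \<in> I" for j
  proof (cases j)
    case 0
    then obtain m where m: "degree h - j = Suc m" using d by (cases "degree h") auto
    have "((\<lambda>_. coeff h j) * u ^ j * v ^ m) * v \<in> I"
      by (intro I(4) subring_setD[OF A(1)] A(3) IA uv)
    thus ?thesis by (simp add: m mult_ac)
  next
    case (Suc m)
    have "((\<lambda>_. coeff h j) * u ^ m * v ^ (degree h - j)) * u \<in> I"
      by (intro I(4) subring_setD[OF A(1)] A(3) IA uv)
    thus ?thesis by (simp add: Suc mult_ac)
  qed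
  have "(\<Sum>j\<le>degree h. (\<lambda>_. coeff h j) * u ^ j * v ^ (degree h - j)) \<in> I"
    by (rule ideal_of_sum[OF A(2) t])
  also have "(\<Sum>j\<le>degree h. (\<lambda>_. coeff h j) * u ^ j * v ^ (degree h - j)) = (\<lambda>a. binary_form h (u a) (v a))"
    by (rule ext) (simp add: binary_form_def sum_fun_apply power_fun_apply)
  finally show ?thesis .
qed

text \<open>The anisotropic form merges two members of \<open>I\<close> into one whose zeros are
  exactly their common zeros; the finitely many generators are absorbed one after another.\<close>

lemma single_equation:
  fixes I :: "(('i \<Rightarrow> 'k::field) \<Rightarrow> 'k) set"
  assumes "finite V" and I: "ideal_of (polyfun V) I"
    and h: "degree h > 0" "\<And>x :: 'k. poly h x \<noteq> 0"
  shows "\<exists>F\<in>I. \<forall>a. F a = 0 \<longrightarrow> (\<forall>f\<in>I. f a = 0)"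
proof -
  obtain G where G: "finite G" "G \<subseteq> I" "\<And>I'. ideal_of (polyfun V) I' \<Longrightarrow> G \<subseteq> I' \<Longrightarrow> I \<subseteq> I'"
    by (rule noetherianE[OF noetherian_polyfun[OF assms(1)] I]) (rule that)
  have "\<exists>F\<in>I. \<forall>a. F a = 0 \<longrightarrow> (\<forall>f\<in>G. f a = 0)" using G(1,2)
  proof (induction G)
    case empty
    thus ?case using ideal_ofD(2)[OF I] by blast
  next
    case (insert g G)
    then obtain F where F: "F \<in> I" "\<forall>a. F a = 0 \<longrightarrow> (\<forall>f\<in>G. f a = 0)" by auto
    show ?case
    proof (intro bexI[of _ "\<lambda>a. binary_form h (F a) (g a)"] allI impI)
      fix a assume "binary_form h (F a) (g a) = 0"
      thus "\<forall>f\<in>insert g G. f a = 0" using binary_form_eq_0[OF h] F(2) by blast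
    next
      show "(\<lambda>a. binary_form h (F a) (g a)) \<in> I"
        using insert.prems F(1) by (intro binary_form_in_ideal[OF subring_set_polyfun I polyfun_const _ _ h(1)]) auto
    qed
  qed
  then obtain F where F: "F \<in> I" "\<And>a. F a = 0 \<Longrightarrow> (\<forall>f\<in>G. f a = 0)" by blast
  have "f a = 0" if "f \<in> I" "F a = 0" for f a
  proof -
    \<comment> \<open>The functions vanishing at \<open>a\<close> form an ideal containing the
      generators, hence they contain \<open>I\<close>; generation by minimality is used exactly in
      this form.\<close>
    have "ideal_of (polyfun V) {f \<in> polyfun V. f a = 0}"
      unfolding ideal_of_def by (auto intro: polyfun_closed)
    moreover have "G \<subseteq> {f \<in> polyfun V. f a = 0}" using F(2)[OF that(2)] G(2) ideal_ofD(1)[OF I] by blast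
    ultimately have "I \<subseteq> {f \<in> polyfun V. f a = 0}" by (rule G(3))
    thus ?thesis using that(1) by blast
  qed
  thus ?thesis using F(1) by blast
qed

section \<open>Homogeneous forms\<close>

abbreviation (input) total_degree :: "(nat \<Rightarrow>\<^sub>0 nat) \<Rightarrow> nat" where
  "total_degree t \<equiv> \<Sum>i \<in> Poly_Mapping.keys t. Poly_Mapping.lookup t i"

text \<open>Forms of degree \<open>e\<close>, as functions; the polynomial behind them is extracted
  only at the end. The degree is explicit so that it can be followed through products, and the zero
  function has every degree.\<close>

definition hom_forms :: "nat \<Rightarrow> nat \<Rightarrow> ((nat \<Rightarrow> 'k::field) \<Rightarrow> 'k) set" where
  "hom_forms m e = {mveval (*) m p |p. in_vars m p \<and>
     (\<forall>t\<in>Poly_Mapping.keys p. total_degree t = e)}"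

lemma prod_list_upt: "(\<Prod>i\<leftarrow>[1..<Suc m]. f i) = (\<Prod>i\<in>{1..m}. f i)" for f :: "nat \<Rightarrow> 'a::comm_monoid_mult"
  by (metis atLeastLessThanSuc_atLeastAtMost distinct_upt prod.distinct_set_conv_list set_upt)

lemma mveval_superset:
  assumes "finite S" "Poly_Mapping.keys p \<subseteq> S"
  shows "mveval (*) m p (v :: nat \<Rightarrow> 'k::field) =
    (\<Sum>t\<in>S. Poly_Mapping.lookup p t * (\<Prod>i\<in>{1..m}. v i ^ Poly_Mapping.lookup t i))"
  unfolding mveval_def prod_list_upt using assms
  by (intro sum.mono_neutral_left) (auto simp: in_keys_iff)

lemma hom_forms_monom:
  assumes "(\<Sum>i\<in>{1..m}. d i) = e"
  shows "(\<lambda>v. c * (\<Prod>i\<in>{1..m}. v i ^ d i)) \<in> hom_forms m e"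
proof -
  define t where "t = Poly_Mapping.Abs_poly_mapping (\<lambda>i. d i when i \<in> {1..m})"
  have t: "Poly_Mapping.lookup t i = (d i when i \<in> {1..m})" for i
    unfolding t_def by (subst lookup_Abs_poly_mapping) (auto simp: when_def intro: finite_subset[of _ "{1..m}"])
  have kt: "Poly_Mapping.keys t \<subseteq> {1..m}" by (auto simp: in_keys_iff t when_def split: if_splits)
  have "total_degree t = (\<Sum>i\<in>{1..m}. Poly_Mapping.lookup t i)"
    using kt by (intro sum.mono_neutral_left) (auto simp: in_keys_iff)
  also have "\<dots> = e" using assms by (simp add: t)
  finally have e: "total_degree t = e" .
  define p where "p = Poly_Mapping.single t c"
  have kp: "Poly_Mapping.keys p \<subseteq> {t}" by (simp add: p_def)
  have "mveval (*) m p = (\<lambda>v. c * (\<Prod>i\<in>{1..m}. v i ^ d i))"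
    by (rule ext) (subst mveval_superset[OF _ kp], simp_all add: p_def t)
  thus ?thesis unfolding hom_forms_def in_vars_def using kp kt e
    by (intro CollectI exI[of _ p]) (auto simp: subset_iff)
qed

lemma hom_forms_add:
  assumes "f \<in> hom_forms m e" "g \<in> hom_forms m e"
  shows "(\<lambda>v. f v + g v) \<in> hom_forms m e"
proof -
  obtain p q where p: "f = mveval (*) m p" "in_vars m p"
      "\<forall>t \<in> Poly_Mapping.keys p. total_degree t = e"
    and q: "g = mveval (*) m q" "in_vars m q"
      "\<forall>t \<in> Poly_Mapping.keys q. total_degree t = e"
    using assms unfolding hom_forms_def by blast
  let ?S = "Poly_Mapping.keys p \<union> Poly_Mapping.keys q"
  have k: "Poly_Mapping.keys (p + q) \<subseteq> ?S" by (rule Poly_Mapping.keys_add)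
  have "mveval (*) m (p + q) = (\<lambda>v. f v + g v)"
    unfolding p q
    by (rule ext) (simp add: mveval_superset[OF _ k] mveval_superset[of ?S p] mveval_superset[of ?S q]
        lookup_add algebra_simps sum.distrib)
  moreover have "in_vars m (p + q)" using k p(2) q(2) unfolding in_vars_def by blast
  moreover have "\<forall>t \<in> Poly_Mapping.keys (p + q). total_degree t = e"
    using k p(3) q(3) by blast
  ultimately show ?thesis unfolding hom_forms_def by (intro CollectI exI[of _ "p + q"]) simp
qed

lemma hom_forms_zero: "(\<lambda>_. 0) \<in> hom_forms m e"
  unfolding hom_forms_def by (intro CollectI exI[of _ 0]) (auto simp: in_vars_def mveval_def)

lemma hom_forms_sum:
  "(\<And>j. j \<in> S \<Longrightarrow> f j \<in> hom_forms m e) \<Longrightarrow> (\<lambda>v. \<Sum>j\<in>S. f j v) \<in> hom_forms m e"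
  by (induction S rule: infinite_finite_induct) (auto intro: hom_forms_zero hom_forms_add)

lemma hom_formsE:
  assumes "f \<in> hom_forms m e"
  obtains S :: "(nat \<Rightarrow>\<^sub>0 nat) set" and c d where "finite S" "\<And>t. t \<in> S \<Longrightarrow> (\<Sum>i\<in>{1..m}. d t i) = e"
    "f = (\<lambda>v. \<Sum>t\<in>S. c t * (\<Prod>i\<in>{1..m}. v i ^ d t i))"
proof -
  obtain p where p: "f = mveval (*) m p" "in_vars m p"
      "\<forall>t \<in> Poly_Mapping.keys p. total_degree t = e"
    using assms unfolding hom_forms_def by blast
  show thesis
  proof (rule that)
    show "finite (Poly_Mapping.keys p)" by simp
    show "f = (\<lambda>v. \<Sum>t\<in>Poly_Mapping.keys p. Poly_Mapping.lookup p t * (\<Prod>i\<in>{1..m}. v i ^ Poly_Mapping.lookup t i))"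
      unfolding p by (rule ext) (rule mveval_superset, auto)
    fix t assume t: "t \<in> Poly_Mapping.keys p"
    have "(\<Sum>i\<in>{1..m}. Poly_Mapping.lookup t i) = total_degree t"
      using p(2) t unfolding in_vars_def by (intro sum.mono_neutral_right) (auto simp: in_keys_iff)
    thus "(\<Sum>i\<in>{1..m}. Poly_Mapping.lookup t i) = e" using p(3) t by simp
  qed
qed

lemma hom_forms_mult:
  assumes "f \<in> hom_forms m e" "g \<in> hom_forms m e'"
  shows "(\<lambda>v. f v * g v) \<in> hom_forms m (e + e')"
proof -
  obtain S c d where f: "finite (S :: (nat \<Rightarrow>\<^sub>0 nat) set)" "\<And>t. t \<in> S \<Longrightarrow> (\<Sum>i\<in>{1..m}. d t i) = e"
    "f = (\<lambda>v. \<Sum>t\<in>S. c t * (\<Prod>i\<in>{1..m}. v i ^ d t i))" by (rule hom_formsE[OF assms(1)]) (rule that)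
  obtain S' c' d' where g: "finite (S' :: (nat \<Rightarrow>\<^sub>0 nat) set)" "\<And>t. t \<in> S' \<Longrightarrow> (\<Sum>i\<in>{1..m}. d' t i) = e'"
    "g = (\<lambda>v. \<Sum>t\<in>S'. c' t * (\<Prod>i\<in>{1..m}. v i ^ d' t i))" by (rule hom_formsE[OF assms(2)]) (rule that)
  have "(\<lambda>v. f v * g v) = (\<lambda>v. \<Sum>t\<in>S. \<Sum>t'\<in>S'. (c t * c' t') * (\<Prod>i\<in>{1..m}. v i ^ (d t i + d' t' i)))"
    unfolding f g sum_product by (simp add: power_add prod.distrib mult_ac)
  also have "\<dots> \<in> hom_forms m (e + e')"
    by (intro hom_forms_sum hom_forms_monom) (simp only: sum.distrib f(2) g(2))
  finally show ?thesis .
qed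

lemma hom_forms_const: "(\<lambda>_. c) \<in> hom_forms m 0"
  using hom_forms_monom[of "\<lambda>_. 0" m 0 c] by simp

lemma hom_forms_var:
  assumes "i \<in> {1..m}" shows "(\<lambda>v :: nat \<Rightarrow> 'a::field. v i) \<in> hom_forms m 1"
proof -
  have "(\<Prod>j\<in>{1..m}. v j ^ (if j = i then 1 else 0)) = v i" for v :: "nat \<Rightarrow> 'a"
    using assms by (subst prod.remove[of _ i]) (auto intro!: prod.neutral)
  hence "(\<lambda>v. 1 * (\<Prod>j\<in>{1..m}. v j ^ (if j = i then 1 else 0))) = (\<lambda>v. v i :: 'a)" by simp
  moreover have "(\<lambda>v. 1 * (\<Prod>j\<in>{1..m}. v j ^ (if j = i then 1 else 0))) \<in> (hom_forms m 1 :: ((nat \<Rightarrow> 'a) \<Rightarrow> 'a) set)"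
    using assms by (intro hom_forms_monom) simp
  ultimately show ?thesis by (simp only:)
qed

lemma hom_forms_prod:
  "(\<And>j. j \<in> S \<Longrightarrow> f j \<in> hom_forms m (d j)) \<Longrightarrow> (\<lambda>v. \<Prod>j\<in>S. f j v) \<in> hom_forms m (\<Sum>j\<in>S. d j)"
  by (induction S rule: infinite_finite_induct) (auto intro: hom_forms_const hom_forms_mult)

lemma hom_forms_power: "f \<in> hom_forms m d \<Longrightarrow> (\<lambda>v. f v ^ k) \<in> hom_forms m (k * d)"
  using hom_forms_prod[of "{..<k}" "\<lambda>_. f" m "\<lambda>_. d"] by simp

lemma hom_forms_smult: "f \<in> hom_forms m d \<Longrightarrow> (\<lambda>v. c * f v) \<in> hom_forms m d"
  using hom_forms_mult[OF hom_forms_const, of f m d c] by simp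

text \<open>Composition with linear forms keeps the degree; it serves to replace a central function
  by a combination of norms.\<close>

lemma hom_forms_linear_subst:
  assumes "f \<in> hom_forms m e" "\<And>i. i \<in> {1..m} \<Longrightarrow> l i \<in> hom_forms m' 1"
  shows "(\<lambda>v. f (\<lambda>i. l i v)) \<in> hom_forms m' e"
proof -
  obtain S c d where f: "finite (S :: (nat \<Rightarrow>\<^sub>0 nat) set)" "\<And>t. t \<in> S \<Longrightarrow> (\<Sum>i\<in>{1..m}. d t i) = e"
    "f = (\<lambda>v. \<Sum>t\<in>S. c t * (\<Prod>i\<in>{1..m}. v i ^ d t i))" by (rule hom_formsE[OF assms(1)]) (rule that)
  show ?thesis unfolding f(3)
  proof (intro hom_forms_sum hom_forms_smult)
    fix t assume "t \<in> S"
    hence "e = (\<Sum>i\<in>{1..m}. d t i * 1)" using f(2) by simp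
    thus "(\<lambda>v. \<Prod>i\<in>{1..m}. l i v ^ d t i) \<in> hom_forms m' e"
      using hom_forms_prod[of "{1..m}" "\<lambda>i v. l i v ^ d t i" m' "\<lambda>i. d t i * 1"]
        hom_forms_power[OF assms(2)] by auto
  qed
qed

text \<open>Homogenisation. Since \<open>b / 0 = 0\<close>, the form vanishes at \<open>b m = 0\<close> as soon as \<open>e > 0\<close>.\<close>

lemma hom_forms_homogenize:
  fixes P :: "('i \<Rightarrow> 'k::field) \<Rightarrow> 'k"
  assumes "P \<in> polyfun V" "m \<ge> 1" "\<And>j. j \<in> V \<Longrightarrow> idx j \<in> {1..m}"
  shows "\<exists>e0. \<forall>e\<ge>e0. (\<lambda>b. b m ^ e * P (\<lambda>j. b (idx j) / b m)) \<in> hom_forms m e"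
  (is "\<exists>e0. \<forall>e\<ge>e0. ?H P e \<in> _")
  using assms(1)
proof induction
  case (polyfun_const c)
  have "(\<lambda>b :: nat \<Rightarrow> 'k. b m ^ e * c) \<in> hom_forms m e" for e
    using hom_forms_smult[OF hom_forms_power[OF hom_forms_var[of m m]], of c e] assms(2) by (simp add: mult.commute)
  thus ?case by blast
next
  case (polyfun_var j)
  \<comment> \<open>For \<open>e = 1\<close> the left side is \<open>b (idx j)\<close> except at
    \<open>b m = 0\<close>, where division by zero makes it 0, so it need not be a form. From
    \<open>e = 2\<close> on the remaining factor \<open>b m\<close> vanishes there as well.\<close>
  have "(\<lambda>b :: nat \<Rightarrow> 'k. b m ^ e * (b (idx j) / b m)) \<in> hom_forms m e" if e: "e \<ge> 2" for e
  proof -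
    obtain d where d: "e = Suc (Suc d)" using e by (metis add_2_eq_Suc le_Suc_ex)
    have "(\<lambda>b. b m ^ e * (b (idx j) / b m)) = (\<lambda>b. b m ^ Suc d * b (idx j) :: 'k)"
      by (rule ext) (simp add: d)
    also have "\<dots> \<in> hom_forms m (Suc d * 1 + 1)"
      using assms(2,3) polyfun_var by (intro hom_forms_mult hom_forms_power hom_forms_var) auto
    also have "Suc d * 1 + 1 = e" by (simp add: d)
    finally show ?thesis .
  qed
  thus ?case by blast
next
  case (polyfun_add f g)
  then obtain d e where de: "\<And>k. k \<ge> d \<Longrightarrow> ?H f k \<in> hom_forms m k"
    "\<And>k. k \<ge> e \<Longrightarrow> ?H g k \<in> hom_forms m k" by blast
  show ?case
  proof (intro exI[of _ "max d e"] allI impI)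
    fix k assume "k \<ge> max d e"
    thus "?H (\<lambda>x. f x + g x) k \<in> hom_forms m k"
      using hom_forms_add[OF de(1)[of k] de(2)[of k]] by (simp add: distrib_left)
  qed
next
  case (polyfun_mult f g)
  then obtain d e where de: "\<And>k. k \<ge> d \<Longrightarrow> ?H f k \<in> hom_forms m k"
    "\<And>k. k \<ge> e \<Longrightarrow> ?H g k \<in> hom_forms m k" by blast
  show ?case
  proof (intro exI[of _ "d + e"] allI impI)
    fix k assume k: "k \<ge> d + e"
    \<comment> \<open>The exponent is split as \<open>d\<close> for the first factor and
      \<open>k - d\<close>, which is at least \<open>e\<close>, for the second.\<close>
    have "b m ^ k = b m ^ d * b m ^ (k - d)" for b :: "nat \<Rightarrow> 'k" using k by (simp flip: power_add)
    hence "?H (\<lambda>x. f x * g x) k = (\<lambda>b. ?H f d b * ?H g (k - d) b)" by (intro ext) (simp add: mult_ac)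
    also have "\<dots> \<in> hom_forms m (d + (k - d))" using k by (intro hom_forms_mult de) auto
    finally show "?H (\<lambda>x. f x * g x) k \<in> hom_forms m k"
      using k by simp
  qed
qed

section \<open>Linear functions as combinations of powers\<close>

text \<open>The span of the polynomials (X + a)^s. It is stable under X \<mapsto> X + 1, hence under
  finite differences.\<close>

inductive_set power_span :: "nat \<Rightarrow> 'k::field poly set" for s where
  power_span_0: "0 \<in> power_span s"
| power_span_step: "f \<in> power_span s \<Longrightarrow> smult c ([:a, 1:] ^ s) + f \<in> power_span s"

lemma power_span_add: "f \<in> power_span s \<Longrightarrow> g \<in> power_span s \<Longrightarrow> f + g \<in> power_span s"
  by (induction rule: power_span.induct) (auto simp: add.assoc intro: power_span_step)

lemma power_span_smult: "f \<in> power_span s \<Longrightarrow> smult c f \<in> power_span s"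
  by (induction rule: power_span.induct) (auto simp: smult_add_right intro: power_span.intros)

lemma power_span_shift: "f \<in> power_span s \<Longrightarrow> pcompose f [:1, 1:] \<in> power_span s"
proof (induction rule: power_span.induct)
  case (power_span_step f c a)
  have "pcompose ([:a, 1:] ^ s) [:1, 1:] = [:a + 1, 1:] ^ s"
  proof (induction s)
    case (Suc s)
    have "pcompose [:a, 1:] [:1, 1:] = [:a + 1, 1:]" by (simp add: pcompose_pCons)
    thus ?case by (simp only: power_Suc pcompose_mult Suc.IH)
  qed (simp add: pcompose_1)
  thus ?case using power_span_step by (auto simp: pcompose_add pcompose_smult intro: power_span.intros)
qed (auto intro: power_span_0)

lemma power_span_poly:
  assumes "f \<in> power_span s"
  shows "\<exists>(r :: nat) c a. \<forall>x. poly f x = (\<Sum>j<r. c j * (x + a j) ^ s)"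
  using assms
proof induction
  case power_span_0
  thus ?case by (intro exI[of _ 0]) auto
next
  case (power_span_step f b d)
  then obtain r :: nat and c a where *: "\<forall>x. poly f x = (\<Sum>j<r. c j * (x + a j) ^ s)" by blast
  show ?case
    by (rule exI[of _ "Suc r"], rule exI[of _ "c(r := b)"], rule exI[of _ "a(r := d)"])
      (simp add: * add.commute)
qed

lemma coeff_pcompose_shift:
  "coeff (pcompose f [:1, 1:]) k = (\<Sum>i\<le>degree f. coeff f i * of_nat (i choose k))"
  for f :: "'k::field poly"
proof -
  have "pcompose f [:1, 1:] = pcompose (\<Sum>i\<le>degree f. monom (coeff f i) i) [:1, 1:]"
    by (simp add: poly_as_sum_of_monoms)
  also have "\<dots> = (\<Sum>i\<le>degree f. smult (coeff f i) ([:1, 1:] ^ i))"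
    unfolding pcompose_sum
  proof (intro sum.cong refl)
    fix i
    show "pcompose (monom (coeff f i) i) [:1, 1:] = smult (coeff f i) ([:1, 1:] ^ i)"
    proof (induction i)
      case (Suc i)
      have "pcompose (monom c (Suc i)) [:1, 1:] = [:1, 1:] * pcompose (monom c i) [:1, 1:]" for c :: 'k
        by (simp add: monom_Suc pcompose_pCons)
      moreover have "pcompose (monom c n) [:1, 1:] = smult c ([:1, 1:] ^ n)" for c :: 'k and n
        by (induction n) (simp_all add: monom_0 monom_Suc pcompose_pCons)
      ultimately show ?case by simp
    qed (simp add: monom_0)
  qed
  moreover have "coeff ([:1, 1 :: 'k:] ^ i) k = of_nat (i choose k)" for i
  proof (cases "k \<le> i")
    case True
    thus ?thesis by (simp add: coeff_linear_poly_power)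
  next
    case False
    thus ?thesis by (simp add: coeff_eq_0 degree_linear_power binomial_eq_0)
  qed
  ultimately show ?thesis by (simp add: coeff_sum)
qed

text \<open>Finite differences of X^s: each one lowers the degree and multiplies the leading
  coefficient by the old degree, which leads to s!/n! in degree \<open>n\<close>. The equation is
  multiplied out by n!, so it makes sense in every characteristic.\<close>

lemma power_span_degree:
  assumes "n \<le> s"
  shows "\<exists>f \<in> power_span s. degree f \<le> n \<and> coeff f n * of_nat (fact n) = (of_nat (fact s) :: 'k::field)"
  using assms
proof (induction rule: inc_induct)
  case base
  have "[:0, 1:] ^ s \<in> (power_span s :: 'k poly set)"
    using power_span_step[OF power_span_0, of 1 0 s] by simp
  moreover have "degree ([:0, 1 :: 'k:] ^ s) = s" by (simp add: degree_linear_power)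
  ultimately show ?case using coeff_linear_power[of "0 :: 'k" s] by (intro bexI[of _ "[:0, 1:] ^ s"]) auto
next
  case (step n)
  then obtain f :: "'k poly" where f: "f \<in> power_span s" "degree f \<le> Suc n"
    "coeff f (Suc n) * of_nat (fact (Suc n)) = of_nat (fact s)" by blast
  define g where "g = pcompose f [:1, 1:] - f"
  have c: "coeff (pcompose f [:1, 1:]) k = (\<Sum>i\<le>Suc n. coeff f i * of_nat (i choose k))" for k
    unfolding coeff_pcompose_shift using f(2) by (intro sum.mono_neutral_left) (auto simp: coeff_eq_0)
  have "g = pcompose f [:1, 1:] + smult (- 1) f" by (simp add: g_def)
  hence "g \<in> power_span s" by (simp only:) (intro power_span_add power_span_shift power_span_smult f(1))
  moreover have "degree g \<le> n"
  proof (rule degree_le, intro allI impI)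
    fix k assume "k > n"
    show "coeff g k = 0"
    proof (cases "k = Suc n")
      case True
      moreover have "(\<Sum>i\<le>n. coeff f i * of_nat (i choose Suc n)) = 0"
        by (intro sum.neutral) (simp add: binomial_eq_0)
      ultimately show ?thesis by (simp add: g_def c)
    next
      case False
      with \<open>k > n\<close> have "k > Suc n" by simp
      moreover have "(\<Sum>i\<le>Suc n. coeff f i * of_nat (i choose k)) = 0"
        using \<open>k > Suc n\<close> by (intro sum.neutral) (simp add: binomial_eq_0)
      ultimately show ?thesis using f(2) by (simp add: g_def c coeff_eq_0 del: sum.atMost_Suc)
    qed
  qed
  moreover have "coeff g n = coeff f (Suc n) * of_nat (Suc n)"
  proof -
    have "(\<Sum>i\<le>n. coeff f i * of_nat (i choose n)) = (\<Sum>i\<in>{n}. coeff f i * of_nat (i choose n))"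
      by (intro sum.mono_neutral_right) (auto simp: binomial_eq_0)
    thus ?thesis by (simp add: g_def c)
  qed
  hence "coeff g n * of_nat (fact n) = of_nat (fact s)"
    using f(3) by (simp add: algebra_simps)
  ultimately show ?case by blast
qed

text \<open>In degrees 1 and 0 the differences have leading coefficient s!, a unit by assumption; a
  multiple of the constant one removes the constant term of the linear one.\<close>

lemma linear_from_powers:
  assumes "of_nat (fact s) \<noteq> (0 :: 'k::field)" "s \<ge> 1"
  shows "\<exists>(r :: nat) c a. \<forall>x :: 'k. x = (\<Sum>j<r. c j * (x + a j) ^ s)"
proof -
  let ?F = "of_nat (fact s) :: 'k"
  obtain f where f: "f \<in> power_span s" "degree f \<le> 1" "coeff f 1 = ?F"
    using power_span_degree[of 1 s] assms(2) by auto
  obtain g where g: "g \<in> power_span s" "degree g \<le> 0" "coeff g 0 = ?F"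
    using power_span_degree[of 0 s] by auto
  have fp: "poly f x = coeff f 0 + ?F * x" for x
  proof -
    have "poly f x = (\<Sum>i\<le>1. coeff f i * x ^ i)"
      unfolding poly_altdef using f(2) by (intro sum.mono_neutral_left) (auto simp: coeff_eq_0)
    thus ?thesis using f(3) by simp
  qed
  have gp: "poly g x = ?F" for x
    using g(2,3) by (simp add: poly_altdef)
  define h where "h = smult (inverse ?F) f + smult (- (inverse ?F * inverse ?F * coeff f 0)) g"
  have "h \<in> power_span s" unfolding h_def by (intro power_span_add power_span_smult f g)
  moreover have "poly h x = x" for x
    using assms(1) by (simp add: h_def fp gp distrib_left flip: mult.assoc)
  ultimately show ?thesis using power_span_poly[of h s] by simp
qed

section \<open>A density theorem\<close>

text \<open>The setting of Jacobson's density theorem with commutant reduced to scalars. It is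
  instantiated twice, by D under two-sided multiplications and by a minimal module over the closure;
  the latter is a subset of a function type, hence the carrier \<open>W\<close>. In
  \<open>schur\<close> the commuting map is not assumed linear.\<close>

locale irreducible_action = vector_space scale
  for scale :: "'k::field \<Rightarrow> 'v::ab_group_add \<Rightarrow> 'v" (infixr \<open>*s\<close> 75) +
  fixes W :: "'v set" and A :: "('v \<Rightarrow> 'v) set"
  assumes W: "subspace W"
    and A_add: "S \<in> A \<Longrightarrow> T \<in> A \<Longrightarrow> (\<lambda>v. S v + T v) \<in> A"
    and A_scale: "T \<in> A \<Longrightarrow> (\<lambda>v. c *s T v) \<in> A"
    and A_comp: "S \<in> A \<Longrightarrow> T \<in> A \<Longrightarrow> (\<lambda>v. S (T v)) \<in> A"
    and A_W: "T \<in> A \<Longrightarrow> w \<in> W \<Longrightarrow> T w \<in> W"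
    and A_linear: "T \<in> A \<Longrightarrow> T (u + v) = T u + T v" "T \<in> A \<Longrightarrow> T (c *s v) = c *s T v"
    and A_irred: "w \<in> W \<Longrightarrow> w \<noteq> 0 \<Longrightarrow> u \<in> W \<Longrightarrow> \<exists>T\<in>A. T w = u"
    and schur: "(\<And>w. w \<in> W \<Longrightarrow> \<sigma> w \<in> W) \<Longrightarrow>
      (\<And>T w. T \<in> A \<Longrightarrow> w \<in> W \<Longrightarrow> \<sigma> (T w) = T (\<sigma> w)) \<Longrightarrow> \<exists>c. \<forall>w\<in>W. \<sigma> w = c *s w"
    and A_nonempty: "A \<noteq> {}"
begin

lemma A_zero: "(\<lambda>_. 0) \<in> A"
  using A_nonempty A_scale[where c = 0] by auto

lemma A_diff: "S \<in> A \<Longrightarrow> T \<in> A \<Longrightarrow> (\<lambda>v. S v - T v) \<in> A"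
  using A_add[OF _ A_scale[where c = "- 1"], of S T] by simp

lemma A_sum: "(\<And>j. j \<in> I \<Longrightarrow> f j \<in> A) \<Longrightarrow> (\<lambda>v. \<Sum>j\<in>I. f j v) \<in> A"
  by (induction I rule: infinite_finite_induct) (auto intro: A_zero A_add)

lemma A_at_0: "T \<in> A \<Longrightarrow> T 0 = 0"
  using A_linear(2)[of T 0 0] by simp

lemma A_at_diff: "T \<in> A \<Longrightarrow> T (u - v) = T u - T v"
  using A_linear(1)[of T "u - v" v] by simp

text \<open>If every T that kills \<open>E\<close> and \<open>e\<close> also killed
  \<open>d\<close>, then T e \<mapsto> T d, for T killing \<open>E\<close>, would be a well-defined
  map of \<open>W\<close> commuting with \<open>A\<close>, hence a scalar c. All these T would then
  kill d - c e, against the induction hypothesis.\<close>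

lemma separate:
  assumes "finite E" "independent E" "E \<subseteq> W" "d \<in> W" "d \<notin> span E"
  shows "\<exists>T\<in>A. (\<forall>e\<in>E. T e = 0) \<and> T d \<noteq> 0"
  using assms
proof (induction E arbitrary: d)
  case empty
  hence "d \<noteq> 0" by simp
  then obtain T where "T \<in> A" "T d = d" using A_irred[of d d] empty by auto
  with \<open>d \<noteq> 0\<close> show ?case by (intro bexI[of _ T]) auto
next
  case (insert e E)
  show ?case
  proof (rule ccontr)
    assume no: "\<not> ?case"
    define K where "K = {T \<in> A. \<forall>e\<in>E. T e = 0}"
    have kill: "T d = 0" if "T \<in> K" "T e = 0" for T using no that by (auto simp: K_def)
    have E: "independent E" "e \<notin> span E" "E \<subseteq> W" "e \<in> W"
      using insert.prems insert.hyps by (auto simp: independent_insert)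
    obtain T1 where T1: "T1 \<in> K" "T1 e \<noteq> 0" using insert.IH[OF E(1,3,4,2)] by (auto simp: K_def)
    have KA: "T \<in> A" if "T \<in> K" for T using that by (simp add: K_def)
    have K_diff: "(\<lambda>v. S v - T v) \<in> K" if "S \<in> K" "T \<in> K" for S T
      using that by (auto simp: K_def A_diff)
    have K_comp: "(\<lambda>v. S (T v)) \<in> K" if "S \<in> A" "T \<in> K" for S T
      using that by (auto simp: K_def A_comp A_at_0)
    \<comment> \<open>The map T e \<mapsto> T d. It is defined on all of \<open>W\<close>, since
      some T in \<open>K\<close> does not kill \<open>e\<close> and irreducibility moves its value
      anywhere.\<close>
    define \<sigma> where "\<sigma> w = (SOME T. T \<in> K \<and> T e = w) d" for w
    have ex: "\<exists>T. T \<in> K \<and> T e = w" if w: "w \<in> W" for w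
    proof -
      obtain S where "S \<in> A" "S (T1 e) = w"
        using A_irred[OF A_W[OF KA[OF T1(1)] E(4)] T1(2) w] by blast
      thus ?thesis using K_comp[OF _ T1(1)] by blast
    qed
    have \<sigma>: "\<sigma> (T e) = T d" if T: "T \<in> K" for T
    proof -
      define T' where "T' = (SOME T'. T' \<in> K \<and> T' e = T e)"
      have "T' \<in> K \<and> T' e = T e" unfolding T'_def by (rule someI[of _ T]) (use T in simp)
      hence "T' d - T d = 0" using kill[OF K_diff[of T' T]] T by simp
      thus ?thesis by (simp add: \<sigma>_def T'_def)
    qed
    have "\<exists>c. \<forall>w\<in>W. \<sigma> w = c *s w"
    proof (rule schur)
      fix w assume "w \<in> W"
      then obtain T where T: "T \<in> K" "w = T e" using ex by blast
      thus "\<sigma> w \<in> W" using A_W[OF KA[OF T(1)] insert.prems(3)] by (simp add: \<sigma>)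
      fix S assume S: "S \<in> A"
      show "\<sigma> (S w) = S (\<sigma> w)" using \<sigma>[OF K_comp[OF S T(1)]] \<sigma>[OF T(1)] T(2) by simp
    qed
    then obtain c where c: "\<And>w. w \<in> W \<Longrightarrow> \<sigma> w = c *s w" by blast
    have "T (d - c *s e) = 0" if T: "T \<in> K" for T
      using c[OF A_W[OF KA[OF T] E(4)]] \<sigma>[OF T] KA[OF T] by (simp add: A_at_diff A_linear)
    moreover have "d - c *s e \<in> W" using W E(4) insert.prems(3) by (intro subspace_diff subspace_scale)
    moreover have "d - c *s e \<notin> span E" using insert.prems(4) by (auto simp: span_breakdown_eq)
    ultimately show False using insert.IH[of "d - c *s e"] E by (auto simp: K_def)
  qed
qed

text \<open>Lagrange interpolation: separation gives for each \<open>e\<close> a map that kills the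
  other elements of \<open>E\<close>, irreducibility then moves its value at \<open>e\<close> to
  \<open>h e\<close>, and these maps are added.\<close>

lemma interpolate:
  assumes "finite E" "independent E" "E \<subseteq> W" "\<And>e. e \<in> E \<Longrightarrow> h e \<in> W"
  shows "\<exists>T\<in>A. \<forall>e\<in>E. T e = h e"
proof -
  have "\<exists>U. U \<in> A \<and> (\<forall>e'\<in>E. U e' = (if e' = e then h e else 0))" if e: "e \<in> E" for e
  proof -
    have "e \<notin> span (E - {e})" using assms(2) e by (auto simp: dependent_def)
    moreover have "independent (E - {e})" using assms(2) by (rule independent_mono) auto
    ultimately    obtain T where T: "T \<in> A" "\<forall>e'\<in>E - {e}. T e' = 0" "T e \<noteq> 0"
      using separate[of "E - {e}" e] assms e by auto
    obtain S where S: "S \<in> A" "S (T e) = h e"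
      using A_irred[OF A_W[OF T(1)] T(3) assms(4)[OF e]] e assms(3) by blast
    show ?thesis using S T A_at_0[OF S(1)] by (intro exI[of _ "\<lambda>v. S (T v)"]) (auto intro: A_comp)
  qed
  then obtain U where U: "\<And>e. e \<in> E \<Longrightarrow> U e \<in> A \<and> (\<forall>e'\<in>E. U e e' = (if e' = e then h e else 0))"
    by metis
  have "(\<lambda>v. \<Sum>e\<in>E. U e v) \<in> A" using U by (intro A_sum) blast
  moreover have "(\<Sum>e\<in>E. U e e') = h e'" if "e' \<in> E" for e'
  proof -
    have "(\<Sum>e\<in>E. U e e') = (\<Sum>e\<in>E. if e' = e then h e else 0)" using U that by (intro sum.cong) auto
    thus ?thesis using assms(1) that by simp
  qed
  ultimately show ?thesis by (intro bexI[of _ "\<lambda>v. \<Sum>e\<in>E. U e v"]) auto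
qed

end

section \<open>Linear maps of a central division algebra\<close>

text \<open>The image of D \<otimes> D^op in the additive maps of D.\<close>

inductive_set mult_maps :: "('d::ring_1 \<Rightarrow> 'd) set" where
  mult_maps_base: "(\<lambda>x. a * x * b) \<in> mult_maps"
| mult_maps_add: "S \<in> mult_maps \<Longrightarrow> T \<in> mult_maps \<Longrightarrow> (\<lambda>x. S x + T x) \<in> mult_maps"

lemma mult_maps_mult: "T \<in> mult_maps \<Longrightarrow> (\<lambda>x. a * T x * b) \<in> mult_maps"
proof (induction rule: mult_maps.induct)
  case (mult_maps_base c d)
  show ?case using mult_maps.mult_maps_base[of "a * c" "d * b"] by (simp add: mult.assoc)
qed (auto simp: algebra_simps intro: mult_maps_add)

lemma mult_maps_comp: "S \<in> mult_maps \<Longrightarrow> T \<in> mult_maps \<Longrightarrow> (\<lambda>x. S (T x)) \<in> mult_maps"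
  by (induction rule: mult_maps.induct) (auto intro: mult_maps_add mult_maps_mult)

locale cda_basis = central_division_algebra scale s
  for scale :: "'k::field \<Rightarrow> 'd::division_ring \<Rightarrow> 'd" (infixr \<open>*s\<close> 75) and s +
  fixes B :: "'d set"
  assumes B: "finite B" "independent B" "span B = UNIV"
begin

abbreviation crd :: "'d \<Rightarrow> 'd \<Rightarrow> 'k" where "crd b x \<equiv> representation B x b"

lemma card_B: "card B = s\<^sup>2"
  using dim_eq_card[of B UNIV] B dim_eq by simp

lemma s_pos: "s > 0"
proof (rule ccontr)
  assume "\<not> s > 0"
  hence "B = {}" using card_B B(1) by simp
  hence "(1 :: 'd) \<in> {0}" using B(3) span_empty by (metis UNIV_I)
  thus False by simp
qed

lemma crd_sum: "(\<Sum>b\<in>B. crd b x *s b) = x"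
  using sum_representation_eq[OF B(2) _ B(1)] B(3) by blast

lemma crd_eqI: "(\<And>b. b \<in> B \<Longrightarrow> crd b x = crd b y) \<Longrightarrow> x = y"
  by (metis (mono_tags, lifting) crd_sum sum.cong)

lemma crd_add: "crd b (x + y) = crd b x + crd b y"
  using representation_add[OF B(2)] B(3) by simp

lemma crd_scale: "crd b (c *s x) = c * crd b x"
  using representation_scale[OF B(2)] B(3) by simp

lemma crd_zero: "crd b 0 = 0"
  by (simp add: representation_zero)

lemma crd_sum': "crd b (\<Sum>i\<in>I. f i) = (\<Sum>i\<in>I. crd b (f i))"
  using representation_sum[OF B(2), of I f] B(3) by simp

lemma crd_basis: "b' \<in> B \<Longrightarrow> crd b b' = (if b = b' then 1 else 0)"
  using representation_basis[OF B(2)] by auto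

lemma crd_comb: "b \<in> B \<Longrightarrow> crd b (\<Sum>b'\<in>B. c b' *s b') = c b"
  using B(1) by (simp add: crd_sum' crd_scale crd_basis if_distrib cong: if_cong)

lemma central_imp_scalar: "(\<And>x. z * x = x * z) \<Longrightarrow> \<exists>c. z = c *s 1"
  using center_eq by blast

lemma scalar_commute: "(c *s 1) * x = x * (c *s 1)"
  by (simp add: scale_mult_left scale_mult_right)

lemma scale_eq_mult: "c *s x = (c *s 1) * x"
  by (simp add: scale_mult_left)

lemma mult_maps_linear:
  fixes T :: "'d \<Rightarrow> 'd"
  shows "T \<in> mult_maps \<Longrightarrow> T (x + y) = T x + T y" "T \<in> mult_maps \<Longrightarrow> T (c *s x) = c *s T x"
  by (induction rule: mult_maps.induct)
    (auto simp: algebra_simps scale_mult_left scale_mult_right scale_right_distrib)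

lemma mult_maps_sum:
  fixes T :: "'d \<Rightarrow> 'd"
  shows "T \<in> mult_maps \<Longrightarrow> T (\<Sum>i\<in>I. f i) = (\<Sum>i\<in>I. T (f i))"
proof (induction I rule: infinite_finite_induct)
  case empty
  thus ?case using mult_maps_linear(2)[of T 0 0] by simp
next
  case (infinite I)
  thus ?case using mult_maps_linear(2)[of T 0 0] by simp
qed (simp add: mult_maps_linear)

text \<open>Irreducibility holds because nonzero elements are invertible. A map that commutes with
  left and right multiplications is both left and right multiplication by its value at 1, which is
  therefore central, hence a scalar.\<close>

interpretation irreducible_action scale UNIV mult_maps
proof
  fix T :: "'d \<Rightarrow> 'd" and c assume "T \<in> mult_maps"
  thus "(\<lambda>v. c *s T v) \<in> mult_maps"
    using mult_maps_mult[of T "c *s 1" 1] by (simp add: scale_mult_left)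
next
  fix w u :: 'd assume "w \<noteq> 0"
  thus "\<exists>T\<in>mult_maps. T w = u"
    by (intro bexI[OF _ mult_maps_base[of "u * inverse w" 1]]) (simp add: mult.assoc)
next
  fix \<sigma> :: "'d \<Rightarrow> 'd" assume \<sigma>: "\<And>T w. T \<in> mult_maps \<Longrightarrow> w \<in> UNIV \<Longrightarrow> \<sigma> (T w) = T (\<sigma> w)"
  have r: "\<sigma> x = x * \<sigma> 1" for x using \<sigma>[OF mult_maps_base[of x 1], of 1] by simp
  have l: "\<sigma> x = \<sigma> 1 * x" for x using \<sigma>[OF mult_maps_base[of 1 x], of 1] by simp
  obtain c where "\<sigma> 1 = c *s 1" using central_imp_scalar[of "\<sigma> 1"] l r by metis
  thus "\<exists>c. \<forall>w\<in>UNIV. \<sigma> w = c *s w" using l by (metis scale_eq_mult)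
qed (use mult_maps_base in \<open>auto intro: mult_maps_add mult_maps_comp mult_maps_linear\<close>)

lemma mult_maps_interpolate: "\<exists>T\<in>mult_maps. \<forall>b\<in>B. T b = h b"
  by (rule interpolate[OF B(1,2)]) auto

lemma coordinate_mult_map:
  assumes "b \<in> B"
  shows "\<exists>T\<in>mult_maps. \<forall>x. T x = crd b x *s 1"
proof -
  obtain T where T: "T \<in> mult_maps" "\<forall>b'\<in>B. T b' = (if b' = b then 1 else 0)"
    using mult_maps_interpolate[of "\<lambda>b'. if b' = b then 1 else 0"] by blast
  have "T x = crd b x *s 1" for x
  proof -
    have "T x = T (\<Sum>b\<in>B. crd b x *s b)" by (simp add: crd_sum)
    also have "\<dots> = (\<Sum>b'\<in>B. if b' = b then crd b' x *s 1 else 0)"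
      unfolding mult_maps_sum[OF T(1)] mult_maps_linear(2)[OF T(1)] using T(2)
      by (intro sum.cong) auto
    also have "\<dots> = crd b x *s 1" using assms B(1) by simp
    finally show ?thesis .
  qed
  thus ?thesis using T(1) by blast
qed

end

section \<open>Splitting representations\<close>

text \<open>Stated for a family and not a set because iterates of a map may repeat; a repetition
  gives the relation at once.\<close>

lemma (in vector_space) family_dependent:
  assumes "finite T" "\<And>i. i \<le> card T \<Longrightarrow> f i \<in> span T"
  shows "\<exists>c. (\<exists>i\<le>card T. c i \<noteq> 0) \<and> (\<Sum>i\<le>card T. c i *s f i) = 0"
proof (cases "inj_on f {..card T}")
  case True
  have "\<not> independent (f ` {..card T})"
  proof
    assume "independent (f ` {..card T})"
    hence "card (f ` {..card T}) \<le> card T"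
      using independent_span_bound[OF assms(1)] assms(2) by blast
    thus False using True by (simp add: card_image)
  qed
  then obtain u where u: "\<exists>v\<in>f ` {..card T}. u v \<noteq> 0" "(\<Sum>v\<in>f ` {..card T}. u v *s v) = 0"
    using dependent_finite[of "f ` {..card T}"] by auto
  thus ?thesis using sum.reindex[OF True, of "\<lambda>v. u v *s v"]
    by (intro exI[of _ "\<lambda>i. u (f i)"]) auto
next
  case False
  then obtain i j where ij: "i \<le> card T" "j \<le> card T" "i \<noteq> j" "f i = f j" by (auto simp: inj_on_def)
  define c where "c = (\<lambda>k. if k = i then 1 else if k = j then - 1 else 0 :: 'a)"
  have "(\<Sum>k\<le>card T. c k *s f k) = (\<Sum>k\<in>{i, j}. c k *s f k)"
    using ij by (intro sum.mono_neutral_right) (auto simp: c_def)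
  also have "\<dots> = 0" using ij by (simp add: c_def)
  finally show ?thesis using ij by (intro exI[of _ c]) (auto simp: c_def)
qed

text \<open>Take a nonzero polynomial q of least degree with q(\<sigma>) w0 = 0 and split off a
  linear factor X - c: the cofactor, applied to \<open>w0\<close>, gives a nonzero vector by
  minimality, and \<sigma> multiplies it by c.\<close>

lemma eigenvector_exists:
  fixes scale :: "'l::alg_closed_field \<Rightarrow> 'v::ab_group_add \<Rightarrow> 'v" (infixr \<open>*s\<close> 75)
  assumes "vector_space scale" "finite T" "module.subspace scale W" "W \<subseteq> module.span scale T"
    and W: "\<And>w. w \<in> W \<Longrightarrow> \<sigma> w \<in> W" and w0: "w0 \<in> W" "w0 \<noteq> 0"
    and add: "\<And>u v. u \<in> W \<Longrightarrow> v \<in> W \<Longrightarrow> \<sigma> (u + v) = \<sigma> u + \<sigma> v"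
    and scl: "\<And>c v. v \<in> W \<Longrightarrow> \<sigma> (c *s v) = c *s \<sigma> v"
  shows "\<exists>u\<in>W. u \<noteq> 0 \<and> (\<exists>c. \<sigma> u = c *s u)"
proof -
  interpret vector_space scale by fact
  have sub: "subspace W" by fact
  define p where "p i = (\<sigma> ^^ i) w0" for i
  have pW: "p i \<in> W" for i by (induction i) (auto simp: p_def w0 W)
  \<comment> \<open>\<open>ev q\<close> is q(\<sigma>) applied to \<open>w0\<close>.\<close>
  define ev where "ev q = (\<Sum>i\<le>degree q. coeff q i *s p i)" for q
  have ev: "ev q = (\<Sum>i\<le>n. coeff q i *s p i)" if "degree q \<le> n" for q n
    unfolding ev_def using that by (intro sum.mono_neutral_left) (auto simp: coeff_eq_0)
  have evW: "ev q \<in> W" for q unfolding ev_def by (intro subspace_sum[OF sub] subspace_scale[OF sub] pW)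
  have \<sigma>_sum: "\<sigma> (\<Sum>i\<le>n. c i *s p i) = (\<Sum>i\<le>n. c i *s p (Suc i))" for c and n :: nat
  proof (induction n)
    case 0
    show ?case using scl[OF pW, of "c 0" 0] by (simp add: p_def)
  next
    case (Suc n)
    have "\<sigma> ((\<Sum>i\<le>n. c i *s p i) + c (Suc n) *s p (Suc n)) = \<sigma> (\<Sum>i\<le>n. c i *s p i) + \<sigma> (c (Suc n) *s p (Suc n))"
      by (intro add subspace_sum[OF sub] subspace_scale[OF sub] pW)
    also have "\<sigma> (c (Suc n) *s p (Suc n)) = c (Suc n) *s p (Suc (Suc n))"
      using scl[OF pW, of "c (Suc n)" "Suc n"] by (simp add: p_def)
    finally show ?case using Suc by simp
  qed
  have ev_shift: "ev ([:- c, 1:] * q) = \<sigma> (ev q) - c *s ev q" for c q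
  proof -
    let ?n = "degree q"
    have "degree ([:- c, 1:] * q) \<le> Suc ?n"
      by (rule order.trans[OF degree_mult_le]) simp
    hence "ev ([:- c, 1:] * q) = (\<Sum>i\<le>Suc ?n. coeff (pCons 0 q - smult c q) i *s p i)"
      by (subst ev) (auto simp: algebra_simps)
    also have "\<dots> = (\<Sum>i\<le>Suc ?n. coeff (pCons 0 q) i *s p i) - (\<Sum>i\<le>Suc ?n. c *s coeff q i *s p i)"
      by (simp only: coeff_diff coeff_smult scale_left_diff_distrib sum_subtractf scale_scale)
    also have "(\<Sum>i\<le>Suc ?n. coeff (pCons 0 q) i *s p i) = \<sigma> (ev q)"
      unfolding ev_def \<sigma>_sum by (subst sum.atMost_Suc_shift) simp
    also have "(\<Sum>i\<le>Suc ?n. c *s coeff q i *s p i) = c *s ev q"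
      unfolding scale_sum_right[symmetric] using ev[of q "Suc ?n"] by simp
    finally show ?thesis .
  qed
  have "\<exists>q. q \<noteq> 0 \<and> ev q = 0"
  proof -
    obtain c where c: "\<exists>i\<le>card T. c i \<noteq> 0" "(\<Sum>i\<le>card T. c i *s p i) = 0"
      using family_dependent[OF assms(2), of p] pW assms(4) by blast
    define q where "q = (\<Sum>i\<le>card T. monom (c i) i)"
    have cq: "coeff q k = (if k \<le> card T then c k else 0)" for k
      by (simp add: q_def coeff_sum)
    have "degree q \<le> card T" by (rule degree_le) (simp add: cq)
    hence "ev q = 0" using c(2) by (simp add: ev cq)
    moreover have "q \<noteq> 0" using c(1) cq by (metis coeff_0)
    ultimately show ?thesis by blast
  qed
  then obtain q where q: "q \<noteq> 0" "ev q = 0" and min: "\<And>q'. q' \<noteq> 0 \<Longrightarrow> ev q' = 0 \<Longrightarrow> degree q \<le> degree q'"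
    using ex_has_least_nat[of "\<lambda>q. q \<noteq> 0 \<and> ev q = 0" _ degree] by blast
  have "degree q > 0"
  proof (rule ccontr)
    assume "\<not> degree q > 0"
    hence "degree q = 0" by simp
    then obtain c where "q = [:c:]" by (rule degree_eq_zeroE)
    thus False using q w0 by (auto simp: ev_def p_def)
  qed
  then obtain c where "poly q c = 0" using alg_closed_imp_poly_has_root by blast
  then obtain q' where q': "q = [:- c, 1:] * q'" by (auto simp: poly_eq_0_iff_dvd elim: dvdE)
  have "q' \<noteq> 0" using q q' by auto
  hence "degree q = Suc (degree q')" unfolding q' by (subst degree_mult_eq) auto
  hence "ev q' \<noteq> 0" using min[of q'] \<open>q' \<noteq> 0\<close> by auto
  moreover have "\<sigma> (ev q') = c *s ev q'" using q(2) unfolding q' ev_shift by simp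
  ultimately show ?thesis using evW by blast
qed

section \<open>Representations of D by matrices over the algebraic closure\<close>

abbreviation (input) fun_scale :: "'l::times \<Rightarrow> ('x \<Rightarrow> 'l) \<Rightarrow> 'x \<Rightarrow> 'l" where
  "fun_scale c v \<equiv> (\<lambda>y. c * v y)"

lemma vector_space_fun: "vector_space (fun_scale :: 'l::field \<Rightarrow> ('x \<Rightarrow> 'l) \<Rightarrow> 'x \<Rightarrow> 'l)"
  by unfold_locales (auto simp: fun_eq_iff algebra_simps)

text \<open>A \<open>splitting_rep\<close> without surjectivity and of arbitrary size
  \<open>r\<close>; that the size is \<open>s\<close> emerges only by counting dimensions.\<close>

definition matrix_rep :: "('k::field \<Rightarrow> 'd::division_ring \<Rightarrow> 'd) \<Rightarrow> nat \<Rightarrow> ('d \<Rightarrow> 'k alg_closure mat) \<Rightarrow> bool" where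
  "matrix_rep scale r \<phi> \<longleftrightarrow> (\<forall>x. \<phi> x \<in> carrier_mat r r) \<and> \<phi> 1 = 1\<^sub>m r \<and>
     (\<forall>x y. \<phi> (x + y) = \<phi> x + \<phi> y) \<and> (\<forall>x y. \<phi> (x * y) = \<phi> x * \<phi> y) \<and>
     (\<forall>a x. \<phi> (scale a x) = to_ac a \<cdot>\<^sub>m \<phi> x)"

lemma entry_mult:
  assumes "M \<in> carrier_mat r r" "N \<in> carrier_mat r r" "i < r" "j < r"
  shows "(M * N) $$ (i, j) = (\<Sum>k<r. M $$ (i, k) * N $$ (k, j))"
  using assms by (auto simp: scalar_prod_def lessThan_atLeast0 intro!: sum.cong)

lemma comb_mult_zero:
  fixes M :: "'l::comm_ring_1 mat"
  assumes M: "M \<in> carrier_mat r r" "\<And>b. G b \<in> carrier_mat r r"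
    and z: "\<And>i j. i < r \<Longrightarrow> j < r \<Longrightarrow> (\<Sum>b\<in>S. c b * G b $$ (i, j)) = 0" and ij: "i < r" "j < r"
  shows "(\<Sum>b\<in>S. c b * (M * G b) $$ (i, j)) = 0" "(\<Sum>b\<in>S. c b * (G b * M) $$ (i, j)) = 0"
proof -
  have "(\<Sum>b\<in>S. c b * (M * G b) $$ (i, j)) = (\<Sum>b\<in>S. \<Sum>k<r. M $$ (i, k) * (c b * G b $$ (k, j)))"
    using M ij by (simp add: entry_mult[where r = r] sum_distrib_left mult_ac)
  also have "\<dots> = (\<Sum>k<r. M $$ (i, k) * (\<Sum>b\<in>S. c b * G b $$ (k, j)))"
    by (subst sum.swap) (simp add: sum_distrib_left)
  finally show "(\<Sum>b\<in>S. c b * (M * G b) $$ (i, j)) = 0" using z ij by simp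
  have "(\<Sum>b\<in>S. c b * (G b * M) $$ (i, j)) = (\<Sum>b\<in>S. \<Sum>k<r. M $$ (k, j) * (c b * G b $$ (i, k)))"
    using M ij by (simp add: entry_mult[where r = r] sum_distrib_left mult_ac)
  also have "\<dots> = (\<Sum>k<r. M $$ (k, j) * (\<Sum>b\<in>S. c b * G b $$ (i, k)))"
    by (subst sum.swap) (simp add: sum_distrib_left)
  finally show "(\<Sum>b\<in>S. c b * (G b * M) $$ (i, j)) = 0" using z ij by simp
qed

context cda_basis
begin

lemma matrix_rep_zero:
  assumes "matrix_rep scale r \<phi>" "i < r" "j < r"
  shows "\<phi> 0 $$ (i, j) = 0"
proof -
  have "\<phi> (0 *s 0) = to_ac 0 \<cdot>\<^sub>m \<phi> 0" "\<phi> 0 \<in> carrier_mat r r" using assms unfolding matrix_rep_def by blast+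
  hence "\<phi> 0 = to_ac 0 \<cdot>\<^sub>m \<phi> 0" "\<phi> 0 \<in> carrier_mat r r" by simp_all
  thus ?thesis using assms(2,3) by (metis carrier_matD index_smult_mat(1) mult_zero_left to_ac_0)
qed

lemma matrix_rep_sum:
  assumes "matrix_rep scale r \<phi>" "i < r" "j < r"
  shows "\<phi> (\<Sum>k\<in>I. a k *s x k) $$ (i, j) = (\<Sum>k\<in>I. to_ac (a k) * \<phi> (x k) $$ (i, j))"
proof (induction I rule: infinite_finite_induct)
  case (insert k I)
  have c: "\<phi> y \<in> carrier_mat r r" "\<phi> (y + z) = \<phi> y + \<phi> z" "\<phi> (c *s y) = to_ac c \<cdot>\<^sub>m \<phi> y" for y z c
    using assms(1) unfolding matrix_rep_def by blast+
  have "\<phi> (a k *s x k + y) $$ (i, j) = to_ac (a k) * \<phi> (x k) $$ (i, j) + \<phi> y $$ (i, j)" for y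
    using c(1)[of "x k"] c(1)[of y] assms(2,3) by (simp add: c(2,3))
  thus ?case using insert by simp
qed (auto simp: matrix_rep_zero[OF assms])

lemma matrix_rep_entry:
  assumes "matrix_rep scale r \<phi>" "i < r" "j < r"
  shows "\<phi> x $$ (i, j) = (\<Sum>b\<in>B. to_ac (crd b x) * \<phi> b $$ (i, j))"
  using matrix_rep_sum[OF assms, of "\<lambda>b. crd b x" "\<lambda>b. b" B] by (simp add: crd_sum)

text \<open>This says that \<open>D \<otimes> L\<close> is simple: a map that singles out one basis element is a combination
  of two-sided multiplications, so it preserves linear relations between the matrices.\<close>

lemma matrix_rep_independent:
  assumes \<phi>: "matrix_rep scale r \<phi>" and "r > 0"
    and z: "\<And>i j. i < r \<Longrightarrow> j < r \<Longrightarrow> (\<Sum>b\<in>B. c b * \<phi> b $$ (i, j)) = 0" and b: "b \<in> B"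
  shows "c b = 0"
proof -
  have c: "\<phi> y \<in> carrier_mat r r" "\<phi> (y + z) = \<phi> y + \<phi> z" "\<phi> (y * z) = \<phi> y * \<phi> z" "\<phi> 1 = 1\<^sub>m r" for y z
    using \<phi> unfolding matrix_rep_def by blast+
  have *: "\<forall>i<r. \<forall>j<r. (\<Sum>b\<in>B. c b * \<phi> (T b) $$ (i, j)) = 0" if "T \<in> mult_maps" for T
    using that
  proof induction
    case (mult_maps_base d e)
    have "(\<Sum>b\<in>B. c b * (\<phi> d * \<phi> b) $$ (i, j)) = 0" if "i < r" "j < r" for i j
      using comb_mult_zero(1)[where G = \<phi>, OF c(1) c(1) z that] .
    hence "(\<Sum>b\<in>B. c b * (\<phi> d * \<phi> b * \<phi> e) $$ (i, j)) = 0" if "i < r" "j < r" for i j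
      using comb_mult_zero(2)[where G = "\<lambda>b. \<phi> d * \<phi> b", OF c(1) mult_carrier_mat[OF c(1) c(1)] _ that] by blast
    thus ?case by (simp add: c(3))
  next
    case (mult_maps_add S T)
    have "\<phi> (S b + T b) $$ (i, j) = \<phi> (S b) $$ (i, j) + \<phi> (T b) $$ (i, j)" if "i < r" "j < r" for i j b
      using that c(1)[of "S b"] c(1)[of "T b"] by (simp add: c(2))
    thus ?case using mult_maps_add.IH by (simp add: distrib_left sum.distrib)
  qed
  obtain T where T: "T \<in> mult_maps" "\<forall>b'\<in>B. T b' = (if b' = b then 1 else 0)"
    using mult_maps_interpolate[of "\<lambda>b'. if b' = b then 1 else 0"] by blast
  \<comment> \<open>The map turns the relation into \<open>c b\<close> times the identity matrix,
    and the entry (0, 0) reads off \<open>c b\<close>.\<close>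
  have "0 = (\<Sum>b'\<in>B. c b' * \<phi> (T b') $$ (0, 0))" using *[OF T(1)] assms(2) by simp
  also have "\<dots> = (\<Sum>b'\<in>B. if b' = b then c b' else 0)"
    using T(2) assms(2) matrix_rep_zero[OF \<phi> assms(2,2)] by (intro sum.cong) (auto simp: c(4))
  also have "\<dots> = c b" using B(1) b by simp
  finally show ?thesis by simp
qed

text \<open>The matrices of the basis elements are independent and span all matrices, so s^2 =
  r^2.\<close>

lemma matrix_rep_full_degree:
  assumes \<phi>: "matrix_rep scale r \<phi>" and r: "r > 0"
    and full: "\<And>M. M \<in> carrier_mat r r \<Longrightarrow> \<exists>A c. finite A \<and>
        (\<forall>i<r. \<forall>j<r. M $$ (i, j) = (\<Sum>x\<in>A. c x * \<phi> x $$ (i, j)))"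
  shows "r = s"
proof -
  interpret V: vector_space "fun_scale :: 'k alg_closure \<Rightarrow> (nat \<times> nat \<Rightarrow> 'k alg_closure) \<Rightarrow> _"
    by (rule vector_space_fun)
  define I where "I = {..<r} \<times> {..<r}"
  \<comment> \<open>Matrices become functions on index pairs, zero outside the range, so that
    dimensions can be compared in one vector space; \<open>E\<close> gives the matrix units.\<close>
  define flat where "flat b = (\<lambda>p. if p \<in> I then \<phi> b $$ p else 0)" for b
  define E where "E p = (\<lambda>q :: nat \<times> nat. if q = p then 1 else 0 :: 'k alg_closure)" for p
  have finI: "finite I" by (simp add: I_def)
  have indep: "c b = 0" if "\<And>p. (\<Sum>b\<in>B. c b * flat b p) = 0" "b \<in> B" for c b
  proof (rule matrix_rep_independent[OF \<phi> r _ that(2)])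
    fix i j assume "i < r" "j < r"
    thus "(\<Sum>b\<in>B. c b * \<phi> b $$ (i, j)) = 0" using that(1)[of "(i, j)"] by (simp add: flat_def I_def)
  qed
  have inj: "inj_on flat B"
  proof (rule inj_onI, rule ccontr)
    fix b b' assume bb: "b \<in> B" "b' \<in> B" "flat b = flat b'" "b \<noteq> b'"
    define c where "c = (\<lambda>k. if k = b then 1 else if k = b' then - 1 else 0 :: 'k alg_closure)"
    have "c b = 0"
    proof (rule indep[OF _ bb(1)])
      fix p
      have "(\<Sum>k\<in>B. c k * flat k p) = (\<Sum>k\<in>{b, b'}. c k * flat k p)"
        using bb B(1) by (intro sum.mono_neutral_right) (auto simp: c_def)
      thus "(\<Sum>k\<in>B. c k * flat k p) = 0" using bb by (simp add: c_def)
    qed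
    thus False by (simp add: c_def)
  qed
  have indep_flat: "V.independent (flat ` B)"
  proof (rule V.independent_if_scalars_zero)
    fix f v assume f: "(\<Sum>x\<in>flat ` B. fun_scale (f x) x) = 0" and "v \<in> flat ` B"
    then obtain b where b: "b \<in> B" "v = flat b" by blast
    have "(\<Sum>b\<in>B. f (flat b) * flat b p) = 0" for p
      using fun_cong[OF f, of p] by (simp add: sum.reindex[OF inj] sum_fun_apply)
    thus "f v = 0" using indep[of "\<lambda>b. f (flat b)"] b by simp
  qed (simp add: B(1))
  have injE: "inj_on E I" by (rule inj_onI) (metis E_def zero_neq_one)
  have E_sum: "(\<Sum>p\<in>I. c p * E p q) = (if q \<in> I then c q else 0)" for c q
    using finI by (simp add: E_def if_distrib cong: if_cong)
  have indep_E: "V.independent (E ` I)"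
  proof (rule V.independent_if_scalars_zero)
    fix f v assume f: "(\<Sum>x\<in>E ` I. fun_scale (f x) x) = 0" and "v \<in> E ` I"
    then obtain q where q: "q \<in> I" "v = E q" by blast
    have "(\<Sum>p\<in>I. f (E p) * E p q) = 0"
      using fun_cong[OF f, of q] by (simp add: sum.reindex[OF injE] sum_fun_apply)
    thus "f v = 0" using E_sum[of "\<lambda>p. f (E p)" q] q by simp
  qed (simp add: finI)
  have span1: "flat ` B \<subseteq> V.span (E ` I)"
  proof
    fix v assume "v \<in> flat ` B"
    then obtain b where b: "v = flat b" by blast
    have "flat b = (\<Sum>p\<in>I. fun_scale (flat b p) (E p))"
      by (rule ext) (simp add: sum_fun_apply E_sum, simp add: flat_def)
    also have "\<dots> \<in> V.span (E ` I)" by (intro V.span_sum V.span_scale V.span_base) simp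
    finally show "v \<in> V.span (E ` I)" by (simp add: b)
  qed
  have span2: "E ` I \<subseteq> V.span (flat ` B)"
  proof
    fix v assume "v \<in> E ` I"
    then obtain p where p: "v = E p" "p \<in> I" by blast
    obtain A c where A: "finite A" "\<And>i j. i < r \<Longrightarrow> j < r \<Longrightarrow> mat r r (E p) $$ (i, j) = (\<Sum>x\<in>A. c x * \<phi> x $$ (i, j))"
      using full[of "mat r r (E p)"] by auto
    have "E p q = (\<Sum>b\<in>B. (\<Sum>x\<in>A. c x * to_ac (crd b x)) * flat b q)" for q
    proof (cases "q \<in> I")
      case True
      then obtain i j where q: "q = (i, j)" "i < r" "j < r" by (auto simp: I_def)
      have "E p q = (\<Sum>x\<in>A. c x * \<phi> x $$ (i, j))" using A(2)[OF q(2,3)] q by simp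
      also have "\<dots> = (\<Sum>x\<in>A. \<Sum>b\<in>B. c x * to_ac (crd b x) * \<phi> b $$ (i, j))"
      proof (intro sum.cong refl)
        fix x
        show "c x * \<phi> x $$ (i, j) = (\<Sum>b\<in>B. c x * to_ac (crd b x) * \<phi> b $$ (i, j))"
          by (subst matrix_rep_entry[OF \<phi> q(2,3)]) (simp only: sum_distrib_left mult.assoc)
      qed
      also have "\<dots> = (\<Sum>b\<in>B. (\<Sum>x\<in>A. c x * to_ac (crd b x)) * \<phi> b $$ (i, j))"
        by (subst sum.swap) (simp add: sum_distrib_right)
      finally show ?thesis using True q by (simp add: flat_def)
    qed (use p in \<open>auto simp: E_def flat_def\<close>)
    hence "E p = (\<Sum>b\<in>B. fun_scale (\<Sum>x\<in>A. c x * to_ac (crd b x)) (flat b))"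
      by (intro ext) (simp add: sum_fun_apply)
    also have "\<dots> \<in> V.span (flat ` B)" by (intro V.span_sum V.span_scale V.span_base) simp
    finally show "v \<in> V.span (flat ` B)" by (simp add: p)
  qed
  have "card (flat ` B) = card (E ` I)"
    using V.independent_span_bound[OF _ indep_flat span1] V.independent_span_bound[OF _ indep_E span2]
      finI B(1) by (intro antisym) auto
  hence "s\<^sup>2 = r\<^sup>2" using card_image[OF inj] card_image[OF injE] card_B
    by (simp add: I_def card_cartesian_product power2_eq_square)
  thus ?thesis by (simp add: power2_eq_iff_nonneg)
qed

end

text \<open>Combinations over L of the translations R_x v = (y \<mapsto> v(y x)). Translating the
  argument on the right gives R_x R_z = R_{xz}, so the order of products is kept and these maps are
  an action of D \<otimes> L.\<close>

inductive_set acts :: "(('d::ring_1 \<Rightarrow> 'l::comm_ring_1) \<Rightarrow> 'd \<Rightarrow> 'l) set" where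
  acts_base: "(\<lambda>v y. c * v (y * x)) \<in> acts"
| acts_add: "S \<in> acts \<Longrightarrow> T \<in> acts \<Longrightarrow> (\<lambda>v. S v + T v) \<in> acts"

lemma acts_scale: "T \<in> acts \<Longrightarrow> (\<lambda>v. fun_scale c (T v)) \<in> acts"
proof (induction rule: acts.induct)
  case (acts_base d x)
  show ?case using acts.acts_base[of "c * d" x] by (simp add: mult.assoc)
next
  case (acts_add S T)
  have "(\<lambda>v. fun_scale c ((S v + T v) :: 'a \<Rightarrow> 'b)) = (\<lambda>v. fun_scale c (S v) + fun_scale c (T v))"
    by (intro ext) (simp add: distrib_left)
  thus ?case using acts.acts_add[OF acts_add.IH] by simp
qed

lemma acts_right: "T \<in> acts \<Longrightarrow> (\<lambda>v y. c * T v (y * x)) \<in> acts"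
proof (induction rule: acts.induct)
  case (acts_base d z)
  show ?case using acts.acts_base[of "c * d" "x * z"] by (simp add: mult.assoc)
next
  case (acts_add S T)
  have "(\<lambda>v y. c * ((S v + T v) :: 'a \<Rightarrow> 'b) (y * x)) = (\<lambda>v. (\<lambda>y. c * S v (y * x)) + (\<lambda>y. c * T v (y * x)))"
    by (intro ext) (simp add: distrib_left)
  thus ?case using acts.acts_add[OF acts_add.IH] by simp
qed

lemma acts_comp: "S \<in> acts \<Longrightarrow> T \<in> acts \<Longrightarrow> (\<lambda>v. S (T v)) \<in> acts"
  by (induction rule: acts.induct) (auto intro: acts_add acts_right)

lemma acts_linear:
  "T \<in> acts \<Longrightarrow> T (u + v) = T u + T v" "T \<in> acts \<Longrightarrow> T (fun_scale c v) = fun_scale c (T v)"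
  by (induction rule: acts.induct) (auto simp: fun_eq_iff algebra_simps)

lemma acts_sum_form:
  assumes "T \<in> acts"
  shows "\<exists>Xs c. finite Xs \<and> (\<forall>v y. T v y = (\<Sum>x\<in>Xs. c x * v (y * x)))"
  using assms
proof induction
  case (acts_base c x)
  show ?case by (intro exI[of _ "{x}"] exI[of _ "\<lambda>_. c"]) auto
next
  case (acts_add S T)
  then obtain Xs c Y d where *: "finite Xs" "\<And>v y. S v y = (\<Sum>x\<in>Xs. c x * v (y * x))"
    "finite Y" "\<And>v y. T v y = (\<Sum>x\<in>Y. d x * v (y * x))" by metis
  define e where "e x = (if x \<in> Xs then c x else 0) + (if x \<in> Y then d x else 0)" for x
  have "(\<Sum>x\<in>Xs. c x * v (y * x)) + (\<Sum>x\<in>Y. d x * v (y * x)) = (\<Sum>x\<in>Xs \<union> Y. e x * v (y * x))" for v y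
  proof -
    have "(\<Sum>x\<in>Xs. c x * v (y * x)) = (\<Sum>x\<in>Xs \<union> Y. (if x \<in> Xs then c x else 0) * v (y * x))"
      using * by (intro sum.mono_neutral_cong_left) auto
    moreover have "(\<Sum>x\<in>Y. d x * v (y * x)) = (\<Sum>x\<in>Xs \<union> Y. (if x \<in> Y then d x else 0) * v (y * x))"
      using * by (intro sum.mono_neutral_cong_left) auto
    ultimately show ?thesis by (simp add: e_def distrib_right sum.distrib)
  qed
  thus ?case using * by (intro exI[of _ "Xs \<union> Y"] exI[of _ e]) auto
qed

section \<open>The module of K-linear maps from D to the closure, and a splitting of D\<close>

context cda_basis
begin

text \<open>Hom_K(D, L), a space over L spanned by the coordinate functions. Being
  finite-dimensional, it has a nonzero submodule of least dimension.\<close>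

definition hom_space :: "('d \<Rightarrow> 'k alg_closure) set" where
  "hom_space = {v. (\<forall>x y. v (x + y) = v x + v y) \<and> (\<forall>a x. v (a *s x) = to_ac a * v x)}"

abbreviation (input) L_scale :: "'k alg_closure \<Rightarrow> ('d \<Rightarrow> 'k alg_closure) \<Rightarrow> _" where
  "L_scale \<equiv> fun_scale"

abbreviation (input) L_acts :: "(('d \<Rightarrow> 'k alg_closure) \<Rightarrow> _) set" where "L_acts \<equiv> acts"

interpretation V: vector_space L_scale
  by (rule vector_space_fun)

lemma hom_space_span: "hom_space \<subseteq> V.span ((\<lambda>b x. to_ac (crd b x)) ` B)"
proof
  fix v :: "'d \<Rightarrow> 'k alg_closure" assume "v \<in> hom_space"
  hence v: "v (x + y) = v x + v y" "v (a *s x) = to_ac a * v x" for x y a by (auto simp: hom_space_def)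
  have v0: "v 0 = 0" using v(2)[of 0 0] by simp
  have vs: "v (\<Sum>i\<in>I. f i) = (\<Sum>i\<in>I. v (f i))" for f :: "'d \<Rightarrow> 'd" and I
    by (induction I rule: infinite_finite_induct) (auto simp: v v0)
  have "v = (\<Sum>b\<in>B. fun_scale (v b) (\<lambda>x. to_ac (crd b x)))"
  proof
    fix x
    have "v x = v (\<Sum>b\<in>B. crd b x *s b)" by (simp add: crd_sum)
    thus "v x = (\<Sum>b\<in>B. fun_scale (v b) (\<lambda>x. to_ac (crd b x))) x"
      by (simp add: vs v sum_fun_apply mult.commute)
  qed
  also have "\<dots> \<in> V.span ((\<lambda>b x. to_ac (crd b x)) ` B)"
    by (intro V.span_sum V.span_scale V.span_base) simp
  finally show "v \<in> V.span ((\<lambda>b x. to_ac (crd b x)) ` B)" .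
qed

definition submodule :: "('d \<Rightarrow> 'k alg_closure) set \<Rightarrow> bool" where
  "submodule W \<longleftrightarrow> V.subspace W \<and> W \<subseteq> hom_space \<and> (\<exists>w\<in>W. w \<noteq> 0) \<and>
     (\<forall>x. \<forall>w\<in>W. (\<lambda>y. w (y * x)) \<in> W)"

lemma submodule_hom_space: "submodule hom_space"
  unfolding submodule_def
proof (intro conjI allI ballI)
  show "V.subspace hom_space"
    by (rule V.subspaceI) (auto simp: hom_space_def algebra_simps)
  obtain b where b: "b \<in> B" using card_B s_pos by fastforce
  have "(\<lambda>x. to_ac (crd b x)) \<in> hom_space" by (simp add: hom_space_def crd_add crd_scale)
  moreover have "(\<lambda>x. to_ac (crd b x)) b \<noteq> 0" using b by (simp add: crd_basis)
  ultimately show "\<exists>w\<in>hom_space. w \<noteq> 0" by (metis zero_fun_apply)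
qed (auto simp: hom_space_def distrib_right scale_mult_left)

lemma submodule_acts:
  assumes "submodule W" "T \<in> acts" "w \<in> W" shows "T w \<in> W"
  using assms(2)
proof induction
  case (acts_base c x)
  thus ?case using assms V.subspace_scale unfolding submodule_def by blast
next
  case (acts_add S T)
  thus ?case using assms V.subspace_add unfolding submodule_def by blast
qed

lemma submodule_finite_basis:
  assumes "submodule W"
  obtains C where "finite C" "V.independent C" "C \<subseteq> W" "W \<subseteq> V.span C" "card C = V.dim W"
proof -
  obtain C where C: "C \<subseteq> W" "V.independent C" "W \<subseteq> V.span C" "card C = V.dim W"
    using V.basis_exists by blast
  have "C \<subseteq> V.span ((\<lambda>b x. to_ac (crd b x)) ` B)"
    using C(1) assms hom_space_span unfolding submodule_def by blast
  hence "finite C" using V.independent_span_bound[OF _ C(2)] B(1) by blast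
  thus thesis using that C by blast
qed

text \<open>A vector of \<open>W\<close> outside a smaller submodule would extend a basis of that
  submodule, so its dimension would be below the least one.\<close>

lemma minimal_submodule_eq:
  assumes W: "submodule W" "\<And>W'. submodule W' \<Longrightarrow> V.dim W \<le> V.dim W'"
    and W': "submodule W'" "W' \<subseteq> W"
  shows "W' = W"
proof (rule ccontr)
  assume "W' \<noteq> W"
  then obtain w where w: "w \<in> W" "w \<notin> W'" using W'(2) by blast
  obtain C where C: "finite C" "V.independent C" "C \<subseteq> W" "W \<subseteq> V.span C" "card C = V.dim W"
    using submodule_finite_basis[OF W(1)] by metis
  obtain C' where C': "finite C'" "V.independent C'" "C' \<subseteq> W'" "W' \<subseteq> V.span C'" "card C' = V.dim W'"
    using submodule_finite_basis[OF W'(1)] by metis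
  have "V.span C' \<subseteq> W'" using C'(3) W'(1) unfolding submodule_def by (intro V.span_minimal) auto
  hence nw: "w \<notin> V.span C'" using w by blast
  hence "V.independent (insert w C')" using C'(2) by (rule V.independent_insertI)
  moreover have "insert w C' \<subseteq> V.span C" using w(1) C'(3) W'(2) C(4) by blast
  ultimately have "card (insert w C') \<le> card C" using V.independent_span_bound[OF C(1)] by blast
  moreover have "w \<notin> C'" using nw V.span_base by blast
  ultimately show False using C'(1,5) C(5) W(2)[OF W'(1)] by simp
qed

text \<open>In a submodule of least dimension every nonzero vector generates everything. A commuting
  map has an eigenvector, because the closure is algebraically closed, and the eigenvalue spreads
  from it to all of \<open>W\<close>.\<close>

lemma irreducible_submodule:
  obtains W where "submodule W"
    "irreducible_action L_scale W acts"
proof -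
  obtain W where W: "submodule W" and min: "\<And>W'. submodule W' \<Longrightarrow> V.dim W \<le> V.dim W'"
    using ex_has_least_nat[of submodule hom_space V.dim] submodule_hom_space by blast
  have sub: "V.subspace W" using W by (simp add: submodule_def)
  have idact: "(\<lambda>v. v) \<in> L_acts" using acts_base[of 1 1] by simp
  have irred: "\<exists>T\<in>acts. T w = u" if w: "w \<in> W" "w \<noteq> 0" and u: "u \<in> W" for w u
  proof -
    define W' where "W' = (\<lambda>T. T w) ` L_acts"
    have sW': "W' \<subseteq> W" using submodule_acts[OF W] w(1) by (auto simp: W'_def)
    have "submodule W'"
      unfolding submodule_def
    proof (intro conjI allI ballI)
      show "V.subspace W'"
      proof (rule V.subspaceI)
        show "0 \<in> W'" unfolding W'_def using acts_base[of 0 1]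
          by (intro image_eqI[where x = "\<lambda>v y. 0 * v (y * 1)"]) (auto simp: fun_eq_iff)
      next
        fix x y assume "x \<in> W'" "y \<in> W'"
        then obtain S T where ST: "S \<in> acts" "T \<in> acts" "x = S w" "y = T w" by (auto simp: W'_def)
        show "x + y \<in> W'" unfolding W'_def
          by (rule image_eqI[OF _ acts_add[OF ST(1,2)]]) (simp add: ST)
      next
        fix c x assume "x \<in> W'"
        then obtain T where T: "T \<in> acts" "x = T w" by (auto simp: W'_def)
        show "fun_scale c x \<in> W'" unfolding W'_def
          by (rule image_eqI[OF _ acts_scale[OF T(1), of c]]) (simp add: T)
      qed
      show "W' \<subseteq> hom_space" using sW' W by (auto simp: submodule_def)
      have "w \<in> W'" unfolding W'_def by (rule image_eqI[OF _ idact]) simp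
      thus "\<exists>w\<in>W'. w \<noteq> 0" using w(2) by blast
    next
      fix x v assume "v \<in> W'"
      then obtain T where T: "T \<in> acts" "v = T w" by (auto simp: W'_def)
      show "(\<lambda>y. v (y * x)) \<in> W'" unfolding W'_def
        by (rule image_eqI[OF _ acts_right[OF T(1), of 1 x]]) (simp add: T)
    qed
    hence "W' = W" using minimal_submodule_eq[OF W min _ sW'] by blast
    thus ?thesis using u unfolding W'_def by blast
  qed
  have "irreducible_action L_scale W acts"
  proof
    show "V.subspace W" by (rule sub)
    show "L_acts \<noteq> {}" using idact by blast
    fix \<sigma> :: "('d \<Rightarrow> 'k alg_closure) \<Rightarrow> ('d \<Rightarrow> 'k alg_closure)"
    assume \<sigma>W: "\<And>w. w \<in> W \<Longrightarrow> \<sigma> w \<in> W" and \<sigma>: "\<And>T w. T \<in> acts \<Longrightarrow> w \<in> W \<Longrightarrow> \<sigma> (T w) = T (\<sigma> w)"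
    have scl: "\<sigma> (fun_scale c w) = fun_scale c (\<sigma> w)" if "w \<in> W" for c w
      using \<sigma>[OF acts_base[of c 1] that] by simp
    \<comment> \<open>Additivity comes from commutation alone: v = S u for some action S, and u + v
      is the image of \<open>u\<close> under id + S.\<close>
    have add: "\<sigma> (u + v) = \<sigma> u + \<sigma> v" if u: "u \<in> W" and v: "v \<in> W" for u v
    proof (cases "u = 0")
      case True
      have "\<sigma> 0 = 0" using scl[OF V.subspace_0[OF sub], of 0] by (simp add: zero_fun_def)
      thus ?thesis using True by simp
    next
      case False
      then obtain S where S: "S \<in> acts" "S u = v" using irred[OF u _ v] by blast
      show ?thesis using \<sigma>[OF acts_add[OF idact S(1)] u] \<sigma>[OF S(1) u] S(2) by simp
    qed
    obtain w0 where w0: "w0 \<in> W" "w0 \<noteq> 0" using W by (auto simp: submodule_def)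
    obtain C where C: "finite C" "W \<subseteq> V.span C" using submodule_finite_basis[OF W] by metis
    note ev = eigenvector_exists[where \<sigma> = \<sigma>, OF vector_space_fun C(1) sub C(2)]
    have "\<exists>u\<in>W. u \<noteq> 0 \<and> (\<exists>c. \<sigma> u = fun_scale c u)"
      by (rule ev; (rule \<sigma>W w0 add scl; assumption?))
    then obtain u c where u: "u \<in> W" "u \<noteq> 0" "\<sigma> u = fun_scale c u" by blast
    have "\<sigma> w = fun_scale c w" if w: "w \<in> W" for w
    proof -
      obtain S where S: "S \<in> acts" "S u = w" using irred[OF u(1,2) w] by blast
      show ?thesis using \<sigma>[OF S(1) u(1)] S u(3) acts_linear(2)[OF S(1), of c u] by simp
    qed
    thus "\<exists>c. \<forall>w\<in>W. \<sigma> w = fun_scale c w" by blast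
  qed (auto intro: acts_add acts_scale acts_comp submodule_acts[OF W] irred simp: acts_linear)
  thus thesis using that W by blast
qed

text \<open>The translations, written as matrices in a basis of an irreducible submodule, represent
  D. Density makes every matrix a combination of them, and the dimension count then forces the size
  to be \<open>s\<close>.\<close>

lemma splitting_rep_exists: "\<exists>\<phi>. splitting_rep scale s \<phi>"
proof -
  obtain W where sm: "submodule W"
    and ia: "irreducible_action L_scale W acts"
    by (rule irreducible_submodule)
  interpret irreducible_action L_scale W acts
    by (rule ia)
  obtain C where C: "finite C" "V.independent C" "C \<subseteq> W" "W \<subseteq> V.span C"
    using submodule_finite_basis[OF sm] by metis
  obtain ws where ws: "set ws = C" "distinct ws" using finite_distinct_list[OF C(1)] by blast
  define r where "r = length ws"
  define rp where "rp v i = V.representation C v (ws ! i)" for v i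
  have wsC: "ws ! i \<in> C" if "i < r" for i using that ws(1) by (auto simp: r_def)
  have bij: "bij_betw ((!) ws) {..<r} C"
    using bij_betw_nth[OF ws(2), of "{..<r}" C] ws(1) by (auto simp: r_def lessThan_atLeast0)
  have r: "r > 0"
  proof (rule ccontr)
    assume "\<not> r > 0"
    hence "C = {}" using ws(1) by (simp add: r_def)
    thus False using C(4) sm by (auto simp: submodule_def)
  qed
  have rp_expand: "v = (\<Sum>i<r. fun_scale (rp v i) (ws ! i))" if "v \<in> W" for v
  proof -
    have "v = (\<Sum>c\<in>C. fun_scale (V.representation C v c) c)"
      using V.sum_representation_eq[OF C(2) _ C(1)] C(4) that by auto
    also have "\<dots> = (\<Sum>i<r. fun_scale (rp v i) (ws ! i))"
      unfolding rp_def by (rule sum.reindex_bij_betw[OF bij, symmetric])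
    finally show ?thesis .
  qed
  have rp_comb: "rp (\<Sum>i<r. fun_scale (c i) (ws ! i)) j = c j" if j: "j < r" for c j
  proof -
    have sp: "ws ! i \<in> V.span C" if "i < r" for i by (intro V.span_base wsC that)
    have "rp (\<Sum>i<r. fun_scale (c i) (ws ! i)) j = (\<Sum>i<r. rp (fun_scale (c i) (ws ! i)) j)"
      unfolding rp_def by (subst V.representation_sum[OF C(2)]) (auto intro: V.span_scale sp)
    also have "\<dots> = (\<Sum>i<r. c i * rp (ws ! i) j)"
      unfolding rp_def by (intro sum.cong refl) (simp add: V.representation_scale[OF C(2) sp])
    also have "\<dots> = (\<Sum>i<r. if i = j then c i else 0)"
      using j ws(2) wsC unfolding rp_def
      by (intro sum.cong refl) (auto simp: V.representation_basis[OF C(2)] nth_eq_iff_index_eq r_def)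
    finally show ?thesis using j by simp
  qed
  define R where "R x v = (\<lambda>y. v (y * x) :: 'k alg_closure)" for x :: 'd and v
  have RW: "R x v \<in> W" if "v \<in> W" for x v using sm that by (simp add: submodule_def R_def)
  have wsW: "ws ! i \<in> W" if "i < r" for i using wsC[OF that] C(3) by blast
  \<comment> \<open>Column \<open>j\<close> holds the coordinates of the translate of the
    \<open>j\<close>-th basis vector.\<close>
  define \<phi> where "\<phi> x = mat r r (\<lambda>(i, j). rp (R x (ws ! j)) i)" for x
  have \<phi>_eq: "\<phi> x $$ (i, j) = d i"
    if "i < r" "j < r" "R x (ws ! j) = (\<Sum>i<r. fun_scale (d i) (ws ! i))" for x i j d
    using that rp_comb[of i d] by (simp add: \<phi>_def)
  have col: "R x (ws ! j) = (\<Sum>i<r. fun_scale (\<phi> x $$ (i, j)) (ws ! i))" if j: "j < r" for x j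
  proof -
    have "R x (ws ! j) = (\<Sum>i<r. fun_scale (rp (R x (ws ! j)) i) (ws ! i))"
      by (rule rp_expand[OF RW[OF wsW[OF j]]])
    thus ?thesis using j by (simp add: \<phi>_def)
  qed
  have hom: "v (y + z) = v y + v z" "v (a *s y) = to_ac a * v y" if "v \<in> W" for v y z a
    using sm that by (auto simp: submodule_def hom_space_def subset_iff)
  have R_at: "ws ! j = u \<Longrightarrow> R x u z = (\<Sum>i<r. \<phi> x $$ (i, j) * (ws ! i) z)" if j: "j < r" for x j u z
    using fun_cong[OF col[OF j, of x], of z] by (simp add: sum_fun_apply)
  have "matrix_rep scale r \<phi>"
    unfolding matrix_rep_def
  proof (intro conjI allI)
    show "\<phi> x \<in> carrier_mat r r" for x by (simp add: \<phi>_def)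
    show "\<phi> 1 = 1\<^sub>m r"
    proof (rule eq_matI)
      fix i j assume ij: "i < dim_row (1\<^sub>m r :: 'k alg_closure mat)" "j < dim_col (1\<^sub>m r :: 'k alg_closure mat)"
      show "\<phi> 1 $$ (i, j) = 1\<^sub>m r $$ (i, j)"
      proof (rule \<phi>_eq)
        have "(\<Sum>k<r. 1\<^sub>m r $$ (k, j) * (ws ! k) z) = (\<Sum>k<r. if k = j then (ws ! k) z else 0)" for z
          using ij by (intro sum.cong) auto
        thus "R 1 (ws ! j) = (\<Sum>k<r. fun_scale (1\<^sub>m r $$ (k, j)) (ws ! k))"
          using ij by (intro ext) (simp add: R_def sum_fun_apply)
      qed (use ij in auto)
    qed (auto simp: \<phi>_def)
    show "\<phi> (x + y) = \<phi> x + \<phi> y" for x y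
    proof (rule eq_matI)
      fix i j assume "i < dim_row (\<phi> x + \<phi> y)" "j < dim_col (\<phi> x + \<phi> y)"
      hence ij: "i < r" "j < r" by (auto simp: \<phi>_def)
      have "\<phi> (x + y) $$ (i, j) = \<phi> x $$ (i, j) + \<phi> y $$ (i, j)"
      proof (rule \<phi>_eq[OF ij])
        have "R (x + y) (ws ! j) z = R x (ws ! j) z + R y (ws ! j) z" for z
          by (simp add: R_def distrib_left hom[OF wsW[OF ij(2)]])
        thus "R (x + y) (ws ! j) = (\<Sum>i<r. fun_scale (\<phi> x $$ (i, j) + \<phi> y $$ (i, j)) (ws ! i))"
          by (intro ext) (simp add: sum_fun_apply R_at[OF ij(2)] distrib_right sum.distrib)
      qed
      thus "\<phi> (x + y) $$ (i, j) = (\<phi> x + \<phi> y) $$ (i, j)" using ij by (simp add: \<phi>_def)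
    qed (auto simp: \<phi>_def)
    show "\<phi> (a *s x) = to_ac a \<cdot>\<^sub>m \<phi> x" for a x
    proof (rule eq_matI)
      fix i j assume "i < dim_row (to_ac a \<cdot>\<^sub>m \<phi> x)" "j < dim_col (to_ac a \<cdot>\<^sub>m \<phi> x)"
      hence ij: "i < r" "j < r" by (auto simp: \<phi>_def)
      have "\<phi> (a *s x) $$ (i, j) = to_ac a * \<phi> x $$ (i, j)"
      proof (rule \<phi>_eq[OF ij])
        have "R (a *s x) (ws ! j) z = to_ac a * R x (ws ! j) z" for z
          by (simp add: R_def scale_mult_right hom[OF wsW[OF ij(2)]])
        also have "to_ac a * R x (ws ! j) z = (\<Sum>i<r. to_ac a * \<phi> x $$ (i, j) * (ws ! i) z)" for z
          by (simp only: R_at[OF ij(2) refl] sum_distrib_left mult.assoc)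
        finally show "R (a *s x) (ws ! j) = (\<Sum>i<r. fun_scale (to_ac a * \<phi> x $$ (i, j)) (ws ! i))"
          by (intro ext) (simp add: sum_fun_apply)
      qed
      thus "\<phi> (a *s x) $$ (i, j) = (to_ac a \<cdot>\<^sub>m \<phi> x) $$ (i, j)" using ij by (simp add: \<phi>_def)
    qed (auto simp: \<phi>_def)
    show "\<phi> (x * y) = \<phi> x * \<phi> y" for x y
    proof (rule eq_matI)
      fix i j assume "i < dim_row (\<phi> x * \<phi> y)" "j < dim_col (\<phi> x * \<phi> y)"
      hence ij: "i < r" "j < r" by (auto simp: \<phi>_def)
      have "\<phi> (x * y) $$ (i, j) = (\<Sum>k<r. \<phi> x $$ (i, k) * \<phi> y $$ (k, j))"
      proof (rule \<phi>_eq[OF ij])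
        have "R (x * y) (ws ! j) z = R y (ws ! j) (z * x)" for z by (simp add: R_def mult.assoc)
        also have "R y (ws ! j) (z * x) = (\<Sum>k<r. \<phi> y $$ (k, j) * R x (ws ! k) z)" for z
          unfolding R_at[OF ij(2) refl] by (simp add: R_def)
        also have "(\<Sum>k<r. \<phi> y $$ (k, j) * R x (ws ! k) z) =
            (\<Sum>k<r. \<Sum>i<r. \<phi> y $$ (k, j) * (\<phi> x $$ (i, k) * (ws ! i) z))" for z
          by (intro sum.cong refl) (simp add: R_at[OF _ refl] sum_distrib_left)
        also have "(\<Sum>k<r. \<Sum>i<r. \<phi> y $$ (k, j) * (\<phi> x $$ (i, k) * (ws ! i) z)) =
            (\<Sum>i<r. (\<Sum>k<r. \<phi> x $$ (i, k) * \<phi> y $$ (k, j)) * (ws ! i) z)" for z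
          by (subst sum.swap, unfold sum_distrib_right, intro sum.cong refl) (simp only: mult_ac)
        finally show "R (x * y) (ws ! j) = (\<Sum>i<r. fun_scale (\<Sum>k<r. \<phi> x $$ (i, k) * \<phi> y $$ (k, j)) (ws ! i))"
          by (intro ext) (simp add: sum_fun_apply)
      qed
      also have "\<dots> = (\<phi> x * \<phi> y) $$ (i, j)"
        using ij by (intro entry_mult[symmetric]) (auto simp: \<phi>_def)
      finally show "\<phi> (x * y) $$ (i, j) = (\<phi> x * \<phi> y) $$ (i, j)" .
    qed (auto simp: \<phi>_def)
  qed
  moreover have full: "\<exists>A c. finite A \<and> (\<forall>i<r. \<forall>j<r. M $$ (i, j) = (\<Sum>x\<in>A. c x * \<phi> x $$ (i, j)))"
    if "M \<in> carrier_mat r r" for M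
  proof -
    \<comment> \<open>The images of the basis vectors prescribed by the columns of \<open>M\<close>;
      density realises them by an action, whose expression as a sum of translations gives the
      coefficients.\<close>
    define h where "h w = (\<Sum>i<r. fun_scale (M $$ (i, the_inv_into {..<r} ((!) ws) w)) (ws ! i))" for w
    have hj: "h (ws ! j) = (\<Sum>i<r. fun_scale (M $$ (i, j)) (ws ! i))" if "j < r" for j
      using the_inv_into_f_f[of "(!) ws" "{..<r}" j] bij that by (simp add: h_def bij_betw_def)
    have "h w \<in> W" for w
      unfolding h_def using sm wsW unfolding submodule_def
      by (intro V.subspace_sum V.subspace_scale) auto
    then obtain T where T: "T \<in> acts" "\<And>w. w \<in> C \<Longrightarrow> T w = h w"
      using interpolate[OF C(1-3), of h] by blast
    obtain Xs c where Xs: "finite Xs" "\<And>v y. T v y = (\<Sum>x\<in>Xs. c x * v (y * x))"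
      using acts_sum_form[OF T(1)] by blast
    have "M $$ (i, j) = (\<Sum>x\<in>Xs. c x * \<phi> x $$ (i, j))" if ij: "i < r" "j < r" for i j
    proof -
      have "h (ws ! j) = (\<Sum>i<r. fun_scale (\<Sum>x\<in>Xs. c x * \<phi> x $$ (i, j)) (ws ! i))"
      proof
        fix z
        have "h (ws ! j) z = (\<Sum>x\<in>Xs. c x * R x (ws ! j) z)"
          using Xs(2)[of "ws ! j" z] T(2)[OF wsC[OF ij(2)]] by (simp add: R_def)
        also have "\<dots> = (\<Sum>x\<in>Xs. \<Sum>i<r. c x * (\<phi> x $$ (i, j) * (ws ! i) z))"
          by (simp add: R_at[OF ij(2) refl] sum_distrib_left)
        also have "\<dots> = (\<Sum>i<r. (\<Sum>x\<in>Xs. c x * \<phi> x $$ (i, j)) * (ws ! i) z)"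
          by (subst sum.swap) (simp add: sum_distrib_right mult.assoc)
        finally show "h (ws ! j) z = (\<Sum>i<r. fun_scale (\<Sum>x\<in>Xs. c x * \<phi> x $$ (i, j)) (ws ! i)) z"
          by (simp add: sum_fun_apply)
      qed
      thus ?thesis using rp_comb[OF ij(1), of "\<lambda>i. M $$ (i, j)"]
          rp_comb[OF ij(1), of "\<lambda>i. \<Sum>x\<in>Xs. c x * \<phi> x $$ (i, j)"] hj[OF ij(2)] by simp
    qed
    thus ?thesis using Xs(1) by blast
  qed
  ultimately have "r = s" using matrix_rep_full_degree[OF _ r] by blast
  hence "splitting_rep scale s \<phi>"
    using \<open>matrix_rep scale r \<phi>\<close> full unfolding splitting_rep_def matrix_rep_def by blast
  thus ?thesis by blast
qed

end

section \<open>Polynomial functions under field extension\<close>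

lemma polyfun_det:
  assumes "\<And>c. M c \<in> carrier_mat n n" "\<And>i j. i < n \<Longrightarrow> j < n \<Longrightarrow> (\<lambda>c. M c $$ (i, j)) \<in> polyfun V"
  shows "(\<lambda>c. det (M c)) \<in> polyfun V"
  unfolding det_def'[OF assms(1)]
proof (intro polyfun_sum polyfun_mult polyfun_const polyfun_prod)
  fix p i assume "p \<in> {p. p permutes {0..<n}}" "i \<in> {0..<n}"
  thus "(\<lambda>c. M c $$ (i, p i)) \<in> polyfun V" using permutes_in_image[of p] by (intro assms(2)) auto
qed

lemma polyfun_line:
  assumes "f \<in> polyfun V"
  shows "\<exists>q. \<forall>t. poly q t = f (\<lambda>i. a i + t * d i)"
  using assms
proof induction
  case (polyfun_const c)
  show ?case by (intro exI[of _ "[:c:]"]) simp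
next
  case (polyfun_var i)
  show ?case by (intro exI[of _ "[:a i, d i:]"]) simp
next
  case (polyfun_add f g)
  then obtain p q where "\<forall>t. poly p t = f (\<lambda>i. a i + t * d i)" "\<forall>t. poly q t = g (\<lambda>i. a i + t * d i)" by blast
  thus ?case by (intro exI[of _ "p + q"]) simp
next
  case (polyfun_mult f g)
  then obtain p q where "\<forall>t. poly p t = f (\<lambda>i. a i + t * d i)" "\<forall>t. poly q t = g (\<lambda>i. a i + t * d i)" by blast
  thus ?case by (intro exI[of _ "p * q"]) simp
qed

lemma poly_eq_0_on_infinite:
  fixes q :: "'k::idom poly"
  assumes "infinite S" "\<And>t. t \<in> S \<Longrightarrow> poly q t = 0"
  shows "q = 0"
proof (rule ccontr)
  assume "q \<noteq> 0"
  hence "finite {t. poly q t = 0}" by (rule poly_roots_finite)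
  thus False using assms finite_subset[of S "{t. poly q t = 0}"] by blast
qed

text \<open>The variables are released from \<open>S\<close> one at a time, \<open>T\<close> being
  those already free: in a single variable f is a polynomial with infinitely many zeros.\<close>

lemma polyfun_zero_on_grid:
  fixes f :: "('i \<Rightarrow> 'k::idom) \<Rightarrow> 'k"
  assumes "infinite S" "f \<in> polyfun V" "finite V" "\<And>a. (\<And>i. i \<in> V \<Longrightarrow> a i \<in> S) \<Longrightarrow> f a = 0"
  shows "f a = 0"
proof -
  have "\<forall>a. (\<forall>i\<in>V - T. a i \<in> S) \<longrightarrow> f a = 0" if "finite T" for T
    using that
  proof (induction T)
    case empty
    show ?case using assms(4) by simp
  next
    case (insert i T)
    show ?case
    proof (intro allI impI)
      fix a assume a: "\<forall>j\<in>V - insert i T. a j \<in> S"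
      obtain q where q: "\<And>t. poly q t = f (\<lambda>j. (a(i := 0)) j + t * (if j = i then 1 else 0))"
        using polyfun_line[OF assms(2), of "a(i := 0)" "\<lambda>j. if j = i then 1 else 0"] by blast
      have upd: "(\<lambda>j. (a(i := 0)) j + t * (if j = i then 1 else 0)) = a(i := t)" for t by auto
      have "q = 0"
      proof (rule poly_eq_0_on_infinite[OF assms(1)])
        fix t assume "t \<in> S"
        hence "\<forall>j\<in>V - T. (a(i := t)) j \<in> S" using a by auto
        thus "poly q t = 0" using insert.IH unfolding q upd by blast
      qed
      thus "f a = 0" using q[of "a i"] upd[of "a i"] by simp
    qed
  qed
  from this[OF assms(3)] show ?thesis by simp
qed

lemma infinite_range_to_ac: "infinite (UNIV :: 'k::field set) \<Longrightarrow> infinite (range (to_ac :: 'k \<Rightarrow> 'k alg_closure))"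
  using finite_imageD[OF _ inj_to_ac] by blast

lemma polyfun_to_ac:
  assumes "g \<in> polyfun V"
  shows "\<exists>G\<in>polyfun V. \<forall>a. G (\<lambda>i. to_ac (a i)) = to_ac (g a)"
  using assms
proof induction
  case (polyfun_const c)
  show ?case by (rule bexI[OF _ polyfun.polyfun_const[of "to_ac c"]]) simp
next
  case (polyfun_var i)
  show ?case by (rule bexI[OF _ polyfun.polyfun_var[OF polyfun_var]]) simp
next
  case (polyfun_add f g)
  then obtain F G where "F \<in> polyfun V" "\<forall>a. F (\<lambda>i. to_ac (a i)) = to_ac (f a)"
    "G \<in> polyfun V" "\<forall>a. G (\<lambda>i. to_ac (a i)) = to_ac (g a)" by blast
  thus ?case by (intro bexI[of _ "\<lambda>x. F x + G x"] polyfun.polyfun_add) auto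
next
  case (polyfun_mult f g)
  then obtain F G where "F \<in> polyfun V" "\<forall>a. F (\<lambda>i. to_ac (a i)) = to_ac (f a)"
    "G \<in> polyfun V" "\<forall>a. G (\<lambda>i. to_ac (a i)) = to_ac (g a)" by blast
  thus ?case by (intro bexI[of _ "\<lambda>x. F x * G x"] polyfun.polyfun_mult) auto
qed

text \<open>Combinations over the closure of polynomial functions over K, at points over K. In this
  shape a K-linear projection can be applied term by term.\<close>

inductive_set ext_polyfun :: "'i set \<Rightarrow> (('i \<Rightarrow> 'k::field) \<Rightarrow> 'k alg_closure) set" for V where
  ext_base: "g \<in> polyfun V \<Longrightarrow> (\<lambda>a. e * to_ac (g a)) \<in> ext_polyfun V"
| ext_add: "f \<in> ext_polyfun V \<Longrightarrow> h \<in> ext_polyfun V \<Longrightarrow> (\<lambda>a. f a + h a) \<in> ext_polyfun V"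

lemma ext_mult_base:
  "f \<in> ext_polyfun V \<Longrightarrow> g \<in> polyfun V \<Longrightarrow> (\<lambda>a. f a * (e * to_ac (g a))) \<in> ext_polyfun V"
proof (induction rule: ext_polyfun.induct)
  case (ext_base h d)
  show ?case using ext_polyfun.ext_base[OF polyfun_mult[OF ext_base(1,2)], of "d * e"] by (simp add: mult_ac)
next
  case (ext_add f h)
  thus ?case using ext_polyfun.ext_add by (simp add: distrib_right)
qed

lemma ext_mult: "h \<in> ext_polyfun V \<Longrightarrow> f \<in> ext_polyfun V \<Longrightarrow> (\<lambda>a. f a * h a) \<in> ext_polyfun V"
proof (induction rule: ext_polyfun.induct)
  case (ext_base g e)
  thus ?case by (intro ext_mult_base)
next
  case (ext_add h h')
  thus ?case using ext_polyfun.ext_add by (simp add: distrib_left)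
qed

lemma polyfun_restrict_ext: "f \<in> polyfun V \<Longrightarrow> (\<lambda>a. f (\<lambda>i. to_ac (a i))) \<in> ext_polyfun V"
proof (induction rule: polyfun.induct)
  case (polyfun_const c)
  show ?case using ext_base[OF polyfun.polyfun_const[of 1], of c] by simp
next
  case (polyfun_var i)
  show ?case using ext_base[OF polyfun.polyfun_var[OF polyfun_var], of 1] by simp
qed (auto intro: ext_add ext_mult)

text \<open>A linear projection of the algebraic closure onto \<open>K\<close> turns a polynomial with coefficients in
  the closure into one with coefficients in \<open>K\<close>.\<close>

definition K_projection :: "('k::field alg_closure \<Rightarrow> 'k) \<Rightarrow> bool" where
  "K_projection \<pi> \<longleftrightarrow> (\<forall>x y. \<pi> (x + y) = \<pi> x + \<pi> y) \<and>
     (\<forall>a x. \<pi> (to_ac a * x) = a * \<pi> x) \<and> (\<forall>a. \<pi> (to_ac a) = a)"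

lemma K_projectionD:
  assumes "K_projection \<pi>"
  shows "\<pi> (x + y) = \<pi> x + \<pi> y" "\<pi> (to_ac a * x) = a * \<pi> x" "\<pi> (to_ac a) = a"
  using assms by (auto simp: K_projection_def)

lemma projection_exists: "\<exists>\<pi> :: 'k::field alg_closure \<Rightarrow> 'k. K_projection \<pi>"
proof -
  interpret L: vector_space "\<lambda>(a :: 'k) x. to_ac a * x"
    by unfold_locales (auto simp: algebra_simps)
  interpret K: vector_space "(*) :: 'k \<Rightarrow> _"
    by unfold_locales (auto simp: algebra_simps)
  interpret vector_space_pair "\<lambda>(a :: 'k) x. to_ac a * x" "(*) :: 'k \<Rightarrow> _" ..
  have "L.independent {1}" by (simp add: L.independent_insert)
  then obtain \<pi> where \<pi>: "Vector_Spaces.linear (\<lambda>(a :: 'k) x. to_ac a * x) (*) \<pi>" "\<pi> 1 = 1"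
    using linear_independent_extend[of "{1}" "\<lambda>_. 1"] by auto
  interpret p: Vector_Spaces.linear "\<lambda>(a :: 'k) x. to_ac a * x" "(*)" \<pi> by (rule \<pi>(1))
  have "\<pi> (to_ac a * x) = a * \<pi> x" for a x by (rule p.scale)
  moreover from this[of _ 1] have "\<pi> (to_ac a) = a" for a using \<pi>(2) by simp
  ultimately have "K_projection \<pi>" unfolding K_projection_def using p.add by blast
  thus ?thesis by blast
qed

lemma ext_polyfun_project:
  assumes "K_projection \<pi>"
  shows "f \<in> ext_polyfun V \<Longrightarrow> (\<lambda>a. \<pi> (f a)) \<in> polyfun V"
proof (induction rule: ext_polyfun.induct)
  case (ext_base g e)
  have "\<pi> (e * to_ac (g a)) = g a * \<pi> e" for a using K_projectionD(2)[OF assms, of "g a" e] by (simp add: mult.commute)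
  thus ?case using polyfun_mult[OF ext_base polyfun_const[of "\<pi> e"]] by simp
qed (auto simp: K_projectionD(1)[OF assms] intro: polyfun_add)

section \<open>The reduced norm\<close>

text \<open>Entry \<open>i\<close> of M^j e, with e the first basis vector. With these as columns,
  \<open>krylov_mat\<close> is invertible exactly if e is cyclic; fixing e makes this a polynomial
  condition on the entries of M.\<close>

primrec krylov :: "nat \<Rightarrow> 'a::comm_ring_1 mat \<Rightarrow> nat \<Rightarrow> nat \<Rightarrow> 'a" where
  "krylov n M 0 i = (if i = 0 then 1 else 0)"
| "krylov n M (Suc j) i = (\<Sum>k<n. M $$ (i, k) * krylov n M j k)"

definition krylov_mat :: "nat \<Rightarrow> 'a::comm_ring_1 mat \<Rightarrow> 'a mat" where
  "krylov_mat n M = mat n n (\<lambda>(i, j). krylov n M j i)"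

text \<open>The shift of the basis vectors witnesses that the determinant of
  \<open>krylov_mat\<close> does not vanish identically.\<close>

lemma krylov_mat_shift: "krylov_mat n (mat n n (\<lambda>(i, j). if i = Suc j then 1 else 0)) = 1\<^sub>m n"
proof -
  define M where "M = mat n n (\<lambda>(i, j). if i = Suc j then 1 else 0 :: 'a)"
  have "krylov n M j i = (if i = j then 1 else 0)" if "i < n" "j < n" for i j
    using that
  proof (induction j arbitrary: i)
    case (Suc j)
    have "krylov n M (Suc j) i = (\<Sum>k<n. if k = j then M $$ (i, k) else 0)"
      unfolding krylov.simps using Suc by (intro sum.cong) auto
    also have "\<dots> = M $$ (i, j)" using Suc.prems by simp
    finally show ?case using Suc.prems by (simp add: M_def)
  qed simp
  thus ?thesis unfolding M_def[symmetric] krylov_mat_def by (intro eq_matI) auto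
qed

lemma polyfun_krylov:
  assumes "\<And>i k. i < n \<Longrightarrow> k < n \<Longrightarrow> (\<lambda>c. M c $$ (i, k)) \<in> polyfun V" "i < n"
  shows "(\<lambda>c. krylov n (M c) j i) \<in> polyfun V"
  using assms(2)
proof (induction j arbitrary: i)
  case 0
  show ?case by (simp add: polyfun_const)
next
  case (Suc j)
  thus ?case unfolding krylov.simps by (intro polyfun_sum polyfun_mult assms(1)) auto
qed

lemma splitting_rep_matrix_rep: "splitting_rep scale s \<phi> \<Longrightarrow> matrix_rep scale s \<phi>"
  unfolding splitting_rep_def matrix_rep_def by blast

section \<open>Rationality of the determinant of a splitting\<close>

context cda_basis
begin

abbreviation L_crd :: "'d \<Rightarrow> 'd \<Rightarrow> 'k alg_closure" where
  "L_crd x \<equiv> \<lambda>b. to_ac (crd b x)"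

lemma crd_surj: "\<exists>x. \<forall>b\<in>B. crd b x = c b"
  using crd_comb by blast

context
  fixes \<phi> :: "'d \<Rightarrow> 'k alg_closure mat"
  assumes \<phi>: "splitting_rep scale s \<phi>"
begin

lemma splitting: "matrix_rep scale s \<phi>"
  by (rule splitting_rep_matrix_rep[OF \<phi>])

lemma splitting_simps: "\<phi> x \<in> carrier_mat s s" "\<phi> 1 = 1\<^sub>m s" "\<phi> (x + y) = \<phi> x + \<phi> y"
  "\<phi> (x * y) = \<phi> x * \<phi> y" "\<phi> (a *s x) = to_ac a \<cdot>\<^sub>m \<phi> x"
  using splitting unfolding matrix_rep_def by blast+

text \<open>The linear extension of \<phi> to D \<otimes> L, in coordinates with respect to
  \<open>B\<close>. Since \<phi> is a splitting it reaches every matrix, in particular the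
  shift.\<close>

definition gen_mat :: "('d \<Rightarrow> 'k alg_closure) \<Rightarrow> 'k alg_closure mat" where
  "gen_mat c = mat s s (\<lambda>(i, j). \<Sum>b\<in>B. c b * \<phi> b $$ (i, j))"

lemma gen_mat_carrier: "gen_mat c \<in> carrier_mat s s"
  by (simp add: gen_mat_def)

lemma gen_mat_crd: "gen_mat (L_crd x) = \<phi> x"
proof (rule eq_matI)
  fix i j assume "i < dim_row (\<phi> x)" "j < dim_col (\<phi> x)"
  hence "i < s" "j < s" using splitting_simps(1)[of x] by auto
  thus "gen_mat (L_crd x) $$ (i, j) = \<phi> x $$ (i, j)"
    using matrix_rep_entry[OF splitting, of i j x] by (simp add: gen_mat_def)
qed (use splitting_simps(1)[of x] in \<open>auto simp: gen_mat_def\<close>)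

lemma gen_mat_surj:
  assumes "M \<in> carrier_mat s s"
  shows "\<exists>c. gen_mat c = M"
proof -
  have "\<exists>A d. finite A \<and> (\<forall>i<s. \<forall>j<s. M $$ (i, j) = (\<Sum>x\<in>A. d x * \<phi> x $$ (i, j)))"
    using \<phi> assms unfolding splitting_rep_def by blast
  then obtain A d where A: "\<And>i j. i < s \<Longrightarrow> j < s \<Longrightarrow> M $$ (i, j) = (\<Sum>x\<in>A. d x * \<phi> x $$ (i, j))"
    by blast
  define c where "c b = (\<Sum>x\<in>A. d x * L_crd x b)" for b
  have "gen_mat c = M"
  proof (rule eq_matI)
    fix i j assume "i < dim_row M" "j < dim_col M"
    hence ij: "i < s" "j < s" using assms by auto
    have "M $$ (i, j) = (\<Sum>x\<in>A. \<Sum>b\<in>B. d x * L_crd x b * \<phi> b $$ (i, j))"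
      unfolding A[OF ij]
    proof (intro sum.cong refl)
      fix x
      show "d x * \<phi> x $$ (i, j) = (\<Sum>b\<in>B. d x * L_crd x b * \<phi> b $$ (i, j))"
        by (subst matrix_rep_entry[OF splitting ij]) (simp only: sum_distrib_left mult.assoc)
    qed
    also have "\<dots> = (\<Sum>b\<in>B. c b * \<phi> b $$ (i, j))"
      unfolding c_def sum_distrib_right by (rule sum.swap)
    finally show "gen_mat c $$ (i, j) = M $$ (i, j)" using ij by (simp add: gen_mat_def)
  qed (use assms in \<open>auto simp: gen_mat_def\<close>)
  thus ?thesis by blast
qed

lemma polyfun_gen_mat: "i < s \<Longrightarrow> j < s \<Longrightarrow> (\<lambda>c. gen_mat c $$ (i, j)) \<in> polyfun B"
  by (simp add: gen_mat_def) (intro polyfun_sum polyfun_mult polyfun_const polyfun_var)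

lemma krylov_rep: "i < s \<Longrightarrow> krylov s (\<phi> x) j i = \<phi> (x ^ j) $$ (i, 0)"
proof (induction j arbitrary: i)
  case 0
  thus ?case by (simp add: splitting_simps)
next
  case (Suc j)
  have "krylov s (\<phi> x) (Suc j) i = (\<Sum>k<s. \<phi> x $$ (i, k) * \<phi> (x ^ j) $$ (k, 0))"
    using Suc by simp
  also have "\<dots> = (\<phi> x * \<phi> (x ^ j)) $$ (i, 0)"
    using Suc.prems s_pos by (intro entry_mult[symmetric] splitting_simps)
  finally show ?case by (simp add: splitting_simps)
qed

text \<open>If \<open>1, x, \<dots>, x\<^bsup>s-1\<^esup>\<close> act independently on the first basis vector, then \<open>\<phi> x\<close> is conjugate to a
  companion matrix, whose entries lie in \<open>K\<close> because the relation expressing \<open>x\<^sup>s\<close> by lower powers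
  is unique and can be projected to \<open>K\<close>.\<close>

lemma det_rational_cyclic:
  assumes nz: "det (krylov_mat s (\<phi> x)) \<noteq> 0"
  shows "det (\<phi> x) \<in> range to_ac"
proof -
  define P where "P = krylov_mat s (\<phi> x)"
  define G where "G n i j = \<phi> (x ^ n) $$ (i, j)" for n i j
  have G_mult: "G (m + n) i j = (\<Sum>k<s. G m i k * G n k j)" if "i < s" "j < s" for m n i j
    using that by (simp add: G_def power_add splitting_simps(4) entry_mult[OF splitting_simps(1) splitting_simps(1)])
  have P: "P \<in> carrier_mat s s" "\<And>i j. i < s \<Longrightarrow> j < s \<Longrightarrow> P $$ (i, j) = G j i 0"
    by (auto simp: P_def krylov_mat_def krylov_rep G_def)
  have "P \<in> Units (ring_mat TYPE('k alg_closure) s ())"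
    by (rule det_non_zero_imp_unit[OF P(1)]) (use nz P_def in simp)
  then obtain Q where Q: "Q \<in> carrier_mat s s" "P * Q = 1\<^sub>m s" "Q * P = 1\<^sub>m s"
    by (auto simp: Units_def ring_mat_simps)
  have PQ: "(\<Sum>k<s. P $$ (i, k) * Q $$ (k, j)) = (if i = j then 1 else 0)"
    and QP: "(\<Sum>k<s. Q $$ (i, k) * P $$ (k, j)) = (if i = j then 1 else 0)" if "i < s" "j < s" for i j
    using entry_mult[OF P(1) Q(1) that] entry_mult[OF Q(1) P(1) that] Q that by auto
  \<comment> \<open>The coordinates of the s-th Krylov vector with respect to the first s of them,
    which are the columns of \<open>P\<close>.\<close>
  define a where "a j = (\<Sum>k<s. Q $$ (j, k) * G s k 0)" for j
  have a_unique: "c j = d j" if "\<And>i. i < s \<Longrightarrow> (\<Sum>k<s. c k * G k i 0) = (\<Sum>k<s. d k * G k i 0)" "j < s" for c d j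
  proof -
    have *: "c j = (\<Sum>i<s. Q $$ (j, i) * (\<Sum>k<s. c k * G k i 0))" for c
    proof -
      have "(\<Sum>i<s. Q $$ (j, i) * (\<Sum>k<s. c k * G k i 0)) = (\<Sum>i<s. \<Sum>k<s. c k * (Q $$ (j, i) * P $$ (i, k)))"
        by (simp add: P(2) sum_distrib_left mult_ac)
      also have "\<dots> = (\<Sum>k<s. c k * (\<Sum>i<s. Q $$ (j, i) * P $$ (i, k)))"
        by (subst sum.swap) (simp add: sum_distrib_left)
      also have "\<dots> = (\<Sum>k<s. if k = j then c k else 0)"
        using that(2) by (intro sum.cong) (auto simp: QP)
      finally show ?thesis using that(2) by simp
    qed
    show ?thesis using *[of c] *[of d] that(1) by simp
  qed
  have a_col: "(\<Sum>j<s. a j * G j i 0) = G s i 0" if i: "i < s" for i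
  proof -
    have "(\<Sum>j<s. a j * G j i 0) = (\<Sum>j<s. \<Sum>k<s. G s k 0 * (P $$ (i, j) * Q $$ (j, k)))"
      unfolding a_def sum_distrib_right using i by (intro sum.cong refl) (simp add: P(2) mult_ac)
    also have "\<dots> = (\<Sum>k<s. G s k 0 * (\<Sum>j<s. P $$ (i, j) * Q $$ (j, k)))"
      by (subst sum.swap) (simp add: sum_distrib_left)
    also have "\<dots> = (\<Sum>k<s. if k = i then G s k 0 else 0)"
      using i by (intro sum.cong) (auto simp: PQ)
    finally show ?thesis using i by simp
  qed
  \<comment> \<open>The s-th power of \<phi> x minus the combination of lower powers. It kills the
    first Krylov vector and commutes with \<phi> x, so it kills all columns of the invertible
    \<open>P\<close> and is zero.\<close>
  define R where "R i l = G s i l - (\<Sum>j<s. a j * G j i l)" for i l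
  have R_P: "(\<Sum>l<s. R i l * P $$ (l, k)) = 0" if ik: "i < s" "k < s" for i k
  proof -
    have "(\<Sum>l<s. R i l * P $$ (l, k)) =
        (\<Sum>l<s. G s i l * G k l 0) - (\<Sum>l<s. \<Sum>j<s. a j * (G j i l * G k l 0))"
      using ik by (simp add: R_def P(2) left_diff_distrib sum_subtractf sum_distrib_right mult.assoc)
    also have "(\<Sum>l<s. \<Sum>j<s. a j * (G j i l * G k l 0)) = (\<Sum>j<s. a j * (\<Sum>l<s. G j i l * G k l 0))"
      by (subst sum.swap) (simp add: sum_distrib_left)
    also have "\<dots> = (\<Sum>j<s. a j * (\<Sum>l<s. G k i l * G j l 0))"
      using ik s_pos by (simp flip: G_mult add: add.commute)
    also have "\<dots> = (\<Sum>l<s. G k i l * (\<Sum>j<s. a j * G j l 0))"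
      unfolding sum_distrib_left by (subst sum.swap) (simp add: mult_ac)
    also have "\<dots> = (\<Sum>l<s. G k i l * G s l 0)" using a_col by simp
    also have "\<dots> = (\<Sum>l<s. G s i l * G k l 0)"
      using ik s_pos by (simp flip: G_mult add: add.commute)
    finally show ?thesis by simp
  qed
  have R0: "R i j = 0" if ij: "i < s" "j < s" for i j
  proof -
    have "R i j = (\<Sum>l<s. if l = j then R i l else 0)" using ij by simp
    also have "\<dots> = (\<Sum>l<s. R i l * (\<Sum>k<s. P $$ (l, k) * Q $$ (k, j)))"
      using ij by (intro sum.cong) (auto simp: PQ)
    also have "\<dots> = (\<Sum>k<s. (\<Sum>l<s. R i l * P $$ (l, k)) * Q $$ (k, j))"
      unfolding sum_distrib_left sum_distrib_right by (subst sum.swap) (simp only: mult.assoc)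
    also have "\<dots> = 0" using R_P ij by simp
    finally show ?thesis .
  qed
  \<comment> \<open>Independence of the matrices \<phi> b turns the matrix relation into one between
    coordinates, which lie in K.\<close>
  have rel: "(\<Sum>j<s. a j * L_crd (x ^ j) b) = L_crd (x ^ s) b" if b: "b \<in> B" for b
  proof -
    have "(\<Sum>j<s. a j * L_crd (x ^ j) b) - L_crd (x ^ s) b = 0"
    proof (rule matrix_rep_independent[OF splitting s_pos _ b, where c = "\<lambda>b. (\<Sum>j<s. a j * L_crd (x ^ j) b) - L_crd (x ^ s) b"])
      fix i l assume il: "i < s" "l < s"
      have G_exp: "G n i l = (\<Sum>b\<in>B. L_crd (x ^ n) b * \<phi> b $$ (i, l))" for n
        unfolding G_def by (rule matrix_rep_entry[OF splitting il])
      have "(\<Sum>b\<in>B. ((\<Sum>j<s. a j * L_crd (x ^ j) b) - L_crd (x ^ s) b) * \<phi> b $$ (i, l)) =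
          (\<Sum>b\<in>B. \<Sum>j<s. a j * (L_crd (x ^ j) b * \<phi> b $$ (i, l))) - G s i l"
        by (simp add: G_exp left_diff_distrib sum_subtractf sum_distrib_right mult.assoc)
      also have "(\<Sum>b\<in>B. \<Sum>j<s. a j * (L_crd (x ^ j) b * \<phi> b $$ (i, l))) = (\<Sum>j<s. a j * G j i l)"
        by (subst sum.swap) (simp add: G_exp sum_distrib_left)
      finally show "(\<Sum>b\<in>B. ((\<Sum>j<s. a j * L_crd (x ^ j) b) - L_crd (x ^ s) b) * \<phi> b $$ (i, l)) = 0"
        using R0[OF il] by (simp add: R_def)
    qed
    thus ?thesis by simp
  qed
  obtain \<pi> :: "'k alg_closure \<Rightarrow> 'k" where proj: "K_projection \<pi>" using projection_exists by blast
  note \<pi> = K_projectionD[OF proj]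
  have \<pi>0: "\<pi> 0 = 0" using \<pi>(3)[of 0] by simp
  have \<pi>_sum: "\<pi> (\<Sum>i\<in>I. f i) = (\<Sum>i\<in>I. \<pi> (f i))" for f :: "nat \<Rightarrow> _" and I
    by (induction I rule: infinite_finite_induct) (auto simp: \<pi> \<pi>0)
  \<comment> \<open>Projecting the coordinate relations gives another solution, now in K; by
    uniqueness it is the same one.\<close>
  have "(\<Sum>j<s. \<pi> (a j) *s x ^ j) = x ^ s"
  proof (rule crd_eqI)
    fix b assume "b \<in> B"
    hence "\<pi> (\<Sum>j<s. L_crd (x ^ j) b * a j) = crd b (x ^ s)" using rel[of b] \<pi>(3) by (simp only: mult.commute[of "a _"])
    thus "crd b (\<Sum>j<s. \<pi> (a j) *s x ^ j) = crd b (x ^ s)"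
      by (simp add: \<pi>_sum \<pi>(2) crd_sum' crd_scale mult.commute[of "\<pi> _"])
  qed
  hence a_proj: "(\<Sum>j<s. to_ac (\<pi> (a j)) * G j i 0) = G s i 0" if "i < s" for i
    using matrix_rep_sum[OF splitting that s_pos, of "\<lambda>j. \<pi> (a j)" "\<lambda>j. x ^ j" "{..<s}"] by (simp add: G_def)
  have a_rat: "a j = to_ac (\<pi> (a j))" if "j < s" for j
    by (rule a_unique[of a "\<lambda>j. to_ac (\<pi> (a j))"]) (simp_all only: a_col a_proj that)
  \<comment> \<open>The companion matrix: \<open>P\<close> conjugates \<phi> x into it, so both have
    the same determinant.\<close>
  define C where "C = mat s s (\<lambda>(i, j). if Suc j = s then \<pi> (a i) else if i = Suc j then 1 else 0)"
  interpret hom: comm_ring_hom "to_ac :: 'k \<Rightarrow> 'k alg_closure" by unfold_locales auto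
  have "\<phi> x * P = P * map_mat to_ac C"
  proof (rule eq_matI)
    fix i j assume "i < dim_row (P * map_mat to_ac C)" "j < dim_col (P * map_mat to_ac C)"
    hence ij: "i < s" "j < s" using P(1) by (auto simp: C_def)
    have "(\<phi> x * P) $$ (i, j) = (\<Sum>k<s. G 1 i k * G j k 0)"
      using ij by (simp add: entry_mult[OF splitting_simps(1) P(1)] P(2) G_def)
    also have "\<dots> = G (Suc j) i 0" using ij s_pos by (simp flip: G_mult)
    also have "\<dots> = (\<Sum>k<s. P $$ (i, k) * to_ac (C $$ (k, j)))"
    proof (cases "Suc j = s")
      case True
      have "(\<Sum>k<s. P $$ (i, k) * to_ac (C $$ (k, j))) = (\<Sum>k<s. a k * G k i 0)"
        using ij True a_rat by (intro sum.cong) (auto simp: C_def P(2))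
      thus ?thesis using a_col[OF ij(1)] True by simp
    next
      case False
      have "(\<Sum>k<s. P $$ (i, k) * to_ac (C $$ (k, j))) = (\<Sum>k<s. if k = Suc j then P $$ (i, k) else 0)"
        using ij False by (intro sum.cong) (auto simp: C_def)
      thus ?thesis using False ij by (simp add: P(2))
    qed
    also have "\<dots> = (P * map_mat to_ac C) $$ (i, j)"
      using ij by (subst entry_mult[OF P(1)]) (auto simp: C_def)
    finally show "(\<phi> x * P) $$ (i, j) = (P * map_mat to_ac C) $$ (i, j)" .
  qed (use P(1) splitting_simps(1)[of x] in \<open>auto simp: C_def\<close>)
  hence "det (\<phi> x) * det P = det P * det (map_mat to_ac C)"
    using det_mult[OF splitting_simps(1) P(1), of x] det_mult[OF P(1), of "map_mat to_ac C"] by (simp add: C_def)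
  hence "det (\<phi> x) = to_ac (det C)" using nz by (simp add: P_def)
  thus ?thesis by blast
qed

text \<open>The defect N - \<pi>(N) extends to a polynomial function over the closure, and its
  product with the cyclicity determinant \<Delta> vanishes at all points over K. Along a line
  through a point with \<Delta> \<noteq> 0 the defect must then vanish.\<close>

lemma det_rational:
  assumes inf: "infinite (UNIV :: 'k set)"
  shows "det (\<phi> x) \<in> range to_ac"
proof -
  obtain \<pi> :: "'k alg_closure \<Rightarrow> 'k" where proj: "K_projection \<pi>" using projection_exists by blast
  note \<pi> = K_projectionD[OF proj]
  define \<Delta> where "\<Delta> c = det (krylov_mat s (gen_mat c))" for c
  have "(\<lambda>c. det (krylov_mat s (gen_mat c))) \<in> polyfun B"
  proof (rule polyfun_det)
    fix i j assume ij: "i < s" "j < s"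
    show "(\<lambda>c. krylov_mat s (gen_mat c) $$ (i, j)) \<in> polyfun B"
      using ij polyfun_krylov[of s gen_mat B i j] polyfun_gen_mat by (simp add: krylov_mat_def)
  qed (simp add: krylov_mat_def)
  hence \<Delta>: "\<Delta> \<in> polyfun B" by (simp add: \<Delta>_def[abs_def])
  \<comment> \<open>A polynomial that vanishes at the points over the infinite field K vanishes
    everywhere, but \<Delta> is 1 at coordinates of the shift matrix.\<close>
  have "\<exists>x0. \<Delta> (L_crd x0) \<noteq> 0"
  proof (rule ccontr)
    assume no: "\<nexists>x0. \<Delta> (L_crd x0) \<noteq> 0"
    have "\<Delta> c = 0" for c
    proof (rule polyfun_zero_on_grid[OF infinite_range_to_ac[OF inf] \<Delta> B(1)])
      fix c :: "'d \<Rightarrow> 'k alg_closure" assume c: "\<And>b. b \<in> B \<Longrightarrow> c b \<in> range to_ac"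
      obtain y where y: "\<forall>b\<in>B. crd b y = of_ac (c b)" using crd_surj[of "\<lambda>b. of_ac (c b)"] by blast
      have "\<Delta> c = \<Delta> (L_crd y)"
        by (rule polyfun_cong[OF \<Delta>]) (simp add: y to_ac_of_ac c)
      thus "\<Delta> c = 0" using no by simp
    qed
    moreover obtain c where c: "gen_mat c = mat s s (\<lambda>(i, j). if i = Suc j then 1 else 0)"
      using gen_mat_surj[of "mat s s (\<lambda>(i, j). if i = Suc j then 1 else 0)"] by auto
    ultimately show False by (metis \<Delta>_def krylov_mat_shift det_one zero_neq_one)
  qed
  then obtain x0 where x0: "\<Delta> (L_crd x0) \<noteq> 0" by blast
  define N where "N c = det (gen_mat c)" for c
  have N: "N \<in> polyfun B" unfolding N_def[abs_def]
    by (rule polyfun_det[OF gen_mat_carrier polyfun_gen_mat])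
  have "(\<lambda>a. \<pi> (N (\<lambda>b. to_ac (a b)))) \<in> polyfun B"
    by (rule ext_polyfun_project[OF proj polyfun_restrict_ext[OF N]])
  then obtain N' where N': "N' \<in> polyfun B" "\<And>a. N' (\<lambda>b. to_ac (a b)) = to_ac (\<pi> (N (\<lambda>b. to_ac (a b))))"
    using polyfun_to_ac by blast
  define R where "R = (\<lambda>c. N c - N' c)"
  have R: "R \<in> polyfun B" unfolding R_def by (rule polyfun_subtract[OF N N'(1)])
  have R_val: "R (L_crd y) = det (\<phi> y) - to_ac (\<pi> (det (\<phi> y)))" for y
    by (simp add: R_def N'(2) N_def gen_mat_crd)
  have prod0: "R (L_crd y) * \<Delta> (L_crd y) = 0" for y
  proof (cases "\<Delta> (L_crd y) = 0")
    case False
    hence "det (\<phi> y) \<in> range to_ac" by (intro det_rational_cyclic) (simp add: \<Delta>_def gen_mat_crd)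
    then obtain k where "det (\<phi> y) = to_ac k" by blast
    thus ?thesis by (simp add: R_val \<pi>(3))
  qed simp
  \<comment> \<open>The direction of the line from \<open>x0\<close>, at t = 0, to \<open>x\<close>,
    at t = 1; parameters in K give points of D.\<close>
  define d where "d b = L_crd x b - L_crd x0 b" for b
  obtain p q where p: "\<And>t. poly p t = R (\<lambda>b. L_crd x0 b + t * d b)"
    and q: "\<And>t. poly q t = \<Delta> (\<lambda>b. L_crd x0 b + t * d b)"
    using polyfun_line[OF R] polyfun_line[OF \<Delta>] by metis
  have "p * q = 0"
  proof (rule poly_eq_0_on_infinite[OF infinite_range_to_ac[OF inf]])
    fix t :: "'k alg_closure" assume "t \<in> range to_ac"
    then obtain u where u: "t = to_ac u" by blast
    define y where "y = x0 + u *s (x - x0)"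
    have "crd b x = crd b (x - x0) + crd b x0" for b
      using crd_add[of "x - x0" x0 b] by (simp only: diff_add_cancel)
    hence "crd b y = crd b x0 + u * (crd b x - crd b x0)" for b
      by (simp add: y_def crd_add crd_scale)
    hence "L_crd y = (\<lambda>b. L_crd x0 b + t * d b)" by (simp add: u d_def)
    thus "poly (p * q) t = 0" using prod0[of y] by (simp add: p q)
  qed
  moreover have "q \<noteq> 0" using q[of 0] x0 by auto
  ultimately have "p = 0" by simp
  hence "R (L_crd x) = 0" using p[of 1] by (simp add: d_def)
  thus ?thesis by (simp add: R_val)
qed

end

abbreviation rn :: "'d \<Rightarrow> 'k" where "rn \<equiv> reduced_norm scale s"

section \<open>Basic properties of the reduced norm\<close>

context
  assumes inf: "infinite (UNIV :: 'k set)"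
begin

text \<open>The choice in the definition picks a splitting because one exists, and
  \<open>of_ac\<close> loses nothing because the determinant is rational.\<close>

lemma reduced_norm_det:
  obtains \<phi> where "splitting_rep scale s \<phi>" "\<And>x. to_ac (rn x) = det (\<phi> x)"
proof -
  define \<phi> where "\<phi> = (SOME \<phi>. splitting_rep scale s \<phi>)"
  have \<phi>: "splitting_rep scale s \<phi>" unfolding \<phi>_def by (rule someI_ex[OF splitting_rep_exists])
  have "to_ac (rn x) = det (\<phi> x)" for x
    using to_ac_of_ac[OF det_rational[OF \<phi> inf, of x]] by (simp add: reduced_norm_def \<phi>_def)
  thus thesis using that \<phi> by blast
qed

text \<open>The determinant of \<open>gen_mat\<close> is a polynomial over the closure. Its values
  at points over K lie in K, so projecting the coefficients does not change them.\<close>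

lemma reduced_norm_polyfun: "\<exists>g\<in>polyfun B. \<forall>x. rn x = g (\<lambda>b. crd b x)"
proof -
  obtain \<phi> where \<phi>: "splitting_rep scale s \<phi>" "\<And>x. to_ac (rn x) = det (\<phi> x)"
    using reduced_norm_det by blast
  obtain \<pi> :: "'k alg_closure \<Rightarrow> 'k" where proj: "K_projection \<pi>" using projection_exists by blast
  note \<pi> = K_projectionD[OF proj]
  have "(\<lambda>c. det (gen_mat \<phi> c)) \<in> polyfun B"
    by (rule polyfun_det[OF gen_mat_carrier[OF \<phi>(1)] polyfun_gen_mat[OF \<phi>(1)]])
  hence "(\<lambda>a. \<pi> (det (gen_mat \<phi> (\<lambda>b. to_ac (a b))))) \<in> polyfun B"
    by (intro ext_polyfun_project[OF proj] polyfun_restrict_ext)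
  thus ?thesis
    by (rule bexI[rotated]) (simp add: gen_mat_crd[OF \<phi>(1)] \<phi>(2)[symmetric] \<pi>(3))
qed

lemma reduced_norm_scalar: "rn (a *s 1) = a ^ s"
proof -
  obtain \<phi> where \<phi>: "splitting_rep scale s \<phi>" "\<And>x. to_ac (rn x) = det (\<phi> x)"
    using reduced_norm_det by blast
  have "to_ac (rn (a *s 1)) = to_ac (a ^ s)"
    by (simp add: \<phi>(2) splitting_simps[OF \<phi>(1)])
  thus ?thesis by (simp only: to_ac_eq_iff)
qed

lemma reduced_norm_eq_0: "rn x = 0 \<longleftrightarrow> x = 0"
proof
  assume "x = 0"
  thus "rn x = 0" using reduced_norm_scalar[of 0] s_pos by simp
next
  assume 0: "rn x = 0"
  obtain \<phi> where \<phi>: "splitting_rep scale s \<phi>" "\<And>x. to_ac (rn x) = det (\<phi> x)"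
    using reduced_norm_det by blast
  show "x = 0"
  proof (rule ccontr)
    assume "x \<noteq> 0"
    hence "\<phi> x * \<phi> (inverse x) = 1\<^sub>m s"
      using splitting_simps(4)[OF \<phi>(1), of x "inverse x"] splitting_simps(2)[OF \<phi>(1)] by simp
    hence "det (\<phi> x) * det (\<phi> (inverse x)) = 1"
      using det_mult[OF splitting_simps(1)[OF \<phi>(1)] splitting_simps(1)[OF \<phi>(1)], of x "inverse x"] by simp
    thus False using 0 \<phi>(2)[of x] by simp
  qed
qed

end

end

section \<open>Coordinates of polynomial functions\<close>

lemma poly_funs_const: "(\<lambda>_. a) \<in> poly_funs"
  unfolding poly_funs_def by (intro CollectI exI[of _ "[(a, [])]"]) (simp add: word_fun_def)

lemma poly_funs_add: "f \<in> poly_funs \<Longrightarrow> g \<in> poly_funs \<Longrightarrow> (\<lambda>x. f x + g x) \<in> poly_funs"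
proof -
  assume "f \<in> poly_funs" "g \<in> poly_funs"
  then obtain ws ws' where "f = (\<lambda>x. \<Sum>w\<leftarrow>ws. word_fun w x)" "g = (\<lambda>x. \<Sum>w\<leftarrow>ws'. word_fun w x)"
    unfolding poly_funs_def by blast
  thus ?thesis unfolding poly_funs_def by (intro CollectI exI[of _ "ws @ ws'"]) simp
qed

lemma poly_funs_word: "word_fun w \<in> poly_funs"
  unfolding poly_funs_def by (intro CollectI exI[of _ "[w]"]) simp

lemma poly_funs_var: "(\<lambda>x. x i) \<in> poly_funs"
  using poly_funs_word[of "(1, [(i, 1)])"] by (simp add: word_fun_def[abs_def])

lemma poly_funs_word_induct [consumes 1, case_names zero add]:
  assumes "f \<in> poly_funs" "Q (\<lambda>_. 0)" "\<And>w g. g \<in> poly_funs \<Longrightarrow> Q g \<Longrightarrow> Q (\<lambda>x. word_fun w x + g x)"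
  shows "Q f"
proof -
  obtain ws where f: "f = (\<lambda>x. \<Sum>w\<leftarrow>ws. word_fun w x)" using assms(1) unfolding poly_funs_def by blast
  have "Q (\<lambda>x. \<Sum>w\<leftarrow>ws. word_fun w x)"
  proof (induction ws)
    case (Cons w ws)
    have "(\<lambda>x. \<Sum>w\<leftarrow>ws. word_fun w x) \<in> poly_funs" unfolding poly_funs_def by blast
    thus ?case using assms(3)[OF _ Cons] by simp
  qed (simp add: assms(2))
  thus ?thesis by (simp add: f)
qed

lemma poly_funs_lmult: "f \<in> poly_funs \<Longrightarrow> (\<lambda>x. a * f x) \<in> poly_funs"
proof (induction rule: poly_funs_word_induct)
  case zero
  show ?case unfolding mult_zero_right mult_zero_left by (rule poly_funs_const)
next
  case (add w g)
  have "(\<lambda>x. a * word_fun w x) = word_fun (a * fst w, snd w)"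
    by (rule ext) (simp add: word_fun_def mult.assoc)
  hence "(\<lambda>x. a * word_fun w x) \<in> poly_funs" by (simp add: poly_funs_word)
  thus ?case using poly_funs_add[OF _ add(2)] by (simp add: distrib_left)
qed

lemma poly_funs_var_mult: "f \<in> poly_funs \<Longrightarrow> (\<lambda>x. x i * f x) \<in> poly_funs"
proof (induction rule: poly_funs_word_induct)
  case zero
  show ?case unfolding mult_zero_right mult_zero_left by (rule poly_funs_const)
next
  case (add w g)
  have "(\<lambda>x. x i * word_fun w x) = word_fun (1, (i, fst w) # snd w)"
    by (rule ext) (simp add: word_fun_def mult.assoc)
  hence "(\<lambda>x. x i * word_fun w x) \<in> poly_funs" by (simp add: poly_funs_word)
  thus ?case using poly_funs_add[OF _ add(2)] by (simp add: distrib_left)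
qed

lemma poly_funs_mult:
  assumes "f \<in> poly_funs" "g \<in> poly_funs" shows "(\<lambda>x. f x * g x) \<in> poly_funs"
  using assms(1)
proof (induction rule: poly_funs_word_induct)
  case zero
  show ?case unfolding mult_zero_right mult_zero_left by (rule poly_funs_const)
next
  case (add w h)
  have "(\<lambda>x. prod_list (map (\<lambda>(i, a). x i * a) l) * g x) \<in> poly_funs" for l
  proof (induction l)
    case Nil thus ?case using assms(2) by simp
  next
    case (Cons p l)
    obtain i a where p: "p = (i, a)" by (cases p)
    show ?case using poly_funs_var_mult[OF poly_funs_lmult[OF Cons, of a], of i] by (simp add: p mult.assoc)
  qed
  from poly_funs_lmult[OF this, of "fst w" "snd w"]
  have "(\<lambda>x. word_fun w x * g x) \<in> poly_funs" by (simp add: word_fun_def mult.assoc)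
  thus ?case using poly_funs_add[OF _ add(2)] by (simp add: distrib_right)
qed

text \<open>Words are products of constants and variables, so \<open>poly_funs\<close> is the ring
  generated by these.\<close>

lemma poly_funs_induct [consumes 1, case_names const var add mult]:
  assumes "f \<in> poly_funs" "\<And>a. Q (\<lambda>_. a)" "\<And>i. Q (\<lambda>x. x i)"
    "\<And>f g. Q f \<Longrightarrow> Q g \<Longrightarrow> Q (\<lambda>x. f x + g x)" "\<And>f g. Q f \<Longrightarrow> Q g \<Longrightarrow> Q (\<lambda>x. f x * g x)"
  shows "Q f"
  using assms(1)
proof (induction rule: poly_funs_word_induct)
  case (add w g)
  have l: "Q (\<lambda>x. prod_list (map (\<lambda>(i, a). x i * a) l))" for l
  proof (induction l)
    case (Cons p l)
    obtain i a where p: "p = (i, a)" by (cases p)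
    show ?case using assms(5)[OF assms(5)[OF assms(3,2), of i a] Cons] by (simp add: p)
  qed (simp add: assms(2))
  have "Q (word_fun w)" using assms(5)[OF assms(2) l, of "fst w" "snd w"] by (simp add: word_fun_def[abs_def])
  thus ?case using add by (intro assms(4))
qed (rule assms(2))

lemma mult_maps_poly_funs: "T \<in> mult_maps \<Longrightarrow> f \<in> poly_funs \<Longrightarrow> (\<lambda>x. T (f x)) \<in> poly_funs"
  by (induction rule: mult_maps.induct) (intro poly_funs_add poly_funs_mult poly_funs_const; assumption)+

lemma polyfun_subst:
  assumes "g \<in> polyfun W" "\<And>i. i \<in> W \<Longrightarrow> h i \<in> polyfun V"
  shows "(\<lambda>y. g (\<lambda>i. h i y)) \<in> polyfun V"
  using assms(1) by (induction rule: polyfun.induct) (auto intro: polyfun.intros assms(2))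

lemma mveval_cong:
  assumes "\<And>i. i \<in> {1..m} \<Longrightarrow> v i = w i"
  shows "mveval sc m p v = mveval sc m p w"
proof -
  have "map (\<lambda>i. v i ^ Poly_Mapping.lookup t i) [1..<Suc m] = map (\<lambda>i. w i ^ Poly_Mapping.lookup t i) [1..<Suc m]" for t
    using assms by (intro map_cong) auto
  thus ?thesis unfolding mveval_def by (simp only:)
qed

lemma poly_fun_ring_simps [simp]:
  "carrier poly_fun_ring = poly_funs" "f \<otimes>\<^bsub>poly_fun_ring\<^esub> g = (\<lambda>x. f x * g x)"
  "f \<oplus>\<^bsub>poly_fun_ring\<^esub> g = (\<lambda>x. f x + g x)" "\<zero>\<^bsub>poly_fun_ring\<^esub> = (\<lambda>_. 0)"
  by (simp_all add: poly_fun_ring_def)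

lemma ideal_poly_fun_ringD:
  assumes "ideal J poly_fun_ring"
  shows "f \<in> J \<Longrightarrow> f \<in> poly_funs" "(\<lambda>_. 0) \<in> J" "f \<in> J \<Longrightarrow> g \<in> J \<Longrightarrow> (\<lambda>x. f x + g x) \<in> J"
    "f \<in> J \<Longrightarrow> h \<in> poly_funs \<Longrightarrow> (\<lambda>x. h x * f x) \<in> J" "f \<in> J \<Longrightarrow> h \<in> poly_funs \<Longrightarrow> (\<lambda>x. f x * h x) \<in> J"
  using additive_subgroup.a_subset[OF ideal.axioms(1)[OF assms]]
    additive_subgroup.zero_closed[OF ideal.axioms(1)[OF assms]]
    additive_subgroup.a_closed[OF ideal.axioms(1)[OF assms], of f g]
    ideal.I_l_closed[OF assms, of f h] ideal.I_r_closed[OF assms, of f h]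
  unfolding poly_fun_ring_simps by blast+

lemma mult_maps_ideal:
  assumes "ideal J poly_fun_ring" "T \<in> mult_maps" "f \<in> J"
  shows "(\<lambda>x. T (f x)) \<in> J"
  using assms(2)
proof induction
  case (mult_maps_base a b)
  show ?case by (intro ideal_poly_fun_ringD[OF assms(1)] assms(3) poly_funs_const)
next
  case (mult_maps_add S T)
  show ?case by (rule ideal_poly_fun_ringD(3)[OF assms(1) mult_maps_add.IH])
qed

section \<open>Central functions as polynomials in the coordinates\<close>

context cda_basis
begin

abbreviation coord_index :: "('n::finite \<times> 'd) set" where
  "coord_index \<equiv> UNIV \<times> B"

definition coords :: "('n::finite \<Rightarrow> 'd) \<Rightarrow> 'n \<times> 'd \<Rightarrow> 'k" where
  "coords x = (\<lambda>(i, b). crd b (x i))"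

lemma coords_surj: "\<exists>x. \<forall>j\<in>coord_index. coords x j = a j"
proof -
  have "\<exists>y. \<forall>b\<in>B. crd b y = a (i, b)" for i by (rule crd_surj)
  then obtain x where "\<forall>b\<in>B. crd b (x i) = a (i, b)" for i by metis
  thus ?thesis by (intro exI[of _ x]) (auto simp: coords_def)
qed

lemma scalar_add: "(a *s 1) + (b *s 1) = (a + b) *s 1"
  by (simp add: scale_left_distrib)

lemma scalar_mult: "(a *s 1) * (b *s 1) = (a * b) *s 1"
  by (simp add: scale_mult_left)

lemma scalar_power: "(a *s 1) ^ n = (a ^ n) *s 1"
  by (induction n) (simp_all add: scalar_mult)

lemma scalar_prod_list: "(\<Prod>i\<leftarrow>l. c i *s 1) = (\<Prod>i\<leftarrow>l. c i) *s 1"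
  by (induction l) (simp_all add: scalar_mult)

text \<open>A coordinate function is polynomial on D^n because it is a sum of two-sided
  multiplications of a variable; the ring operations do the rest.\<close>

lemma scalar_poly_funs:
  assumes "P \<in> polyfun coord_index"
  shows "(\<lambda>x. P (coords x) *s 1) \<in> poly_funs"
  using assms
proof induction
  case (polyfun_const c)
  show ?case by (rule poly_funs_const)
next
  case (polyfun_var j)
  obtain i b where j: "j = (i, b)" by (cases j)
  obtain T where T: "T \<in> mult_maps" "\<And>x. T x = crd b x *s 1"
    using coordinate_mult_map[of b] polyfun_var j by auto
  show ?case using mult_maps_poly_funs[OF T(1) poly_funs_var[of i]] by (simp add: T(2) coords_def j)
next
  case (polyfun_add f g)
  show ?case using poly_funs_add[OF polyfun_add.IH] by (simp add: scalar_add)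
next
  case (polyfun_mult f g)
  show ?case using poly_funs_mult[OF polyfun_mult.IH] by (simp add: scalar_mult)
qed

lemma crd_mult: "crd b (x * y) = (\<Sum>c\<in>B. \<Sum>d\<in>B. crd c x * crd d y * crd b (c * d))"
proof -
  have "x * y = (\<Sum>c\<in>B. crd c x *s c) * (\<Sum>d\<in>B. crd d y *s d)" by (simp add: crd_sum)
  also have "\<dots> = (\<Sum>c\<in>B. \<Sum>d\<in>B. (crd c x * crd d y) *s (c * d))"
    by (simp add: sum_product scale_mult_left scale_mult_right mult.commute)
  finally show ?thesis by (simp add: crd_sum' crd_scale)
qed

lemma poly_funs_coord:
  assumes "f \<in> poly_funs"
  shows "\<forall>b\<in>B. \<exists>P\<in>polyfun coord_index. \<forall>x. crd b (f x) = P (coords x)"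
  using assms
proof (induction rule: poly_funs_induct)
  case (const a)
  show ?case by (intro ballI) (rule bexI[OF _ polyfun_const], simp)
next
  case (var i)
  show ?case
  proof
    fix b assume "b \<in> B"
    thus "\<exists>P\<in>polyfun coord_index. \<forall>x. crd b (x i) = P (coords x)"
      by (intro bexI[OF _ polyfun_var[of "(i, b)"]]) (auto simp: coords_def)
  qed
next
  case (add f g)
  show ?case
  proof
    fix b assume "b \<in> B"
    then obtain P Q where "P \<in> polyfun coord_index" "\<forall>x. crd b (f x) = P (coords x)"
      "Q \<in> polyfun coord_index" "\<forall>x. crd b (g x) = Q (coords x)" using add by blast
    thus "\<exists>P\<in>polyfun coord_index. \<forall>x. crd b (f x + g x) = P (coords x)"
      by (intro bexI[OF _ polyfun_add[of P _ Q]]) (auto simp: crd_add)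
  qed
next
  case (mult f g)
  then obtain P Q where PQ: "\<And>b. b \<in> B \<Longrightarrow> P b \<in> polyfun coord_index" "\<And>b x. b \<in> B \<Longrightarrow> crd b (f x) = P b (coords x)"
    "\<And>b. b \<in> B \<Longrightarrow> Q b \<in> polyfun coord_index" "\<And>b x. b \<in> B \<Longrightarrow> crd b (g x) = Q b (coords x)"
    by metis
  show ?case
  proof
    fix b assume "b \<in> B"
    \<comment> \<open>The product in terms of the structure constants \<open>crd b (c * d)\<close>
      of D.\<close>
    define R where "R = (\<lambda>y. \<Sum>c\<in>B. \<Sum>d\<in>B. P c y * Q d y * crd b (c * d))"
    have "R \<in> polyfun coord_index"
      unfolding R_def by (intro polyfun_sum polyfun_mult polyfun_const PQ)
    moreover have "crd b (f x * g x) = R (coords x)" for x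
      unfolding R_def by (subst crd_mult, intro sum.cong refl) (simp add: PQ)
    ultimately show "\<exists>P\<in>polyfun coord_index. \<forall>x. crd b (f x * g x) = P (coords x)"
      by (intro bexI[of _ R] allI) simp_all
  qed
qed

text \<open>Commuting with the constant functions already forces every value into the centre of
  D.\<close>

lemma poly_fun_center_iff: "f \<in> poly_fun_center \<longleftrightarrow> f \<in> poly_funs \<and> (\<forall>x. \<exists>c. f x = c *s 1)"
proof
  assume f: "f \<in> poly_fun_center"
  have "\<exists>c. f x = c *s 1" for x
  proof (rule central_imp_scalar)
    fix a
    have "(\<lambda>x. f x * a) = (\<lambda>x. a * f x)"
      using f poly_funs_const[of a] unfolding poly_fun_center_def by auto
    thus "f x * a = a * f x" by (rule fun_cong)
  qed
  thus "f \<in> poly_funs \<and> (\<forall>x. \<exists>c. f x = c *s 1)" using f by (simp add: poly_fun_center_def)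
next
  assume f: "f \<in> poly_funs \<and> (\<forall>x. \<exists>c. f x = c *s 1)"
  have "f x * g x = g x * f x" for g x
    using f scalar_commute by metis
  thus "f \<in> poly_fun_center" using f by (simp add: poly_fun_center_def)
qed

lemma mveval_scalar:
  assumes "\<And>i. i \<in> {1..m} \<Longrightarrow> v i = b i *s 1"
  shows "mveval scale m p v = mveval (*) m p b *s 1"
proof -
  have "mveval scale m p v = mveval scale m p (\<lambda>i. b i *s 1)"
    by (rule mveval_cong) (rule assms)
  thus ?thesis by (simp add: mveval_def scalar_power scalar_prod_list scale_sum_left)
qed

end

section \<open>The two radicals\<close>

context cda_basis
begin

context
  fixes J :: "(('n::finite \<Rightarrow> 'd) \<Rightarrow> 'd) set"
  assumes J: "ideal J poly_fun_ring" and inf: "infinite (UNIV :: 'k set)"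
begin

lemmas J_closed = ideal_poly_fun_ringD[OF J]

text \<open>The central part of \<open>J\<close>, read as an ideal of polynomial functions over K in
  the coordinates.\<close>

definition scalar_ideal :: "(('n \<times> 'd \<Rightarrow> 'k) \<Rightarrow> 'k) set" where
  "scalar_ideal = {P \<in> polyfun coord_index. (\<lambda>x. P (coords x) *s 1) \<in> J}"

lemma ideal_of_scalar_ideal: "ideal_of (polyfun coord_index) scalar_ideal"
  unfolding ideal_of_def
proof (intro conjI ballI)
  show "scalar_ideal \<subseteq> polyfun coord_index" by (auto simp: scalar_ideal_def)
  show "0 \<in> scalar_ideal" using polyfun_closed(1) J_closed(2) by (simp add: scalar_ideal_def)
next
  fix P Q :: "('n \<times> 'd \<Rightarrow> 'k) \<Rightarrow> 'k"
  assume PQ: "P \<in> scalar_ideal" "Q \<in> scalar_ideal"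
  hence "P + Q \<in> polyfun coord_index" by (intro polyfun_closed) (auto simp: scalar_ideal_def)
  moreover have "(\<lambda>x. P (coords x) *s 1 + Q (coords x) *s 1) \<in> J"
    using PQ by (intro J_closed) (auto simp: scalar_ideal_def)
  ultimately show "P + Q \<in> scalar_ideal" by (simp add: scalar_ideal_def scalar_add)
next
  fix Q P :: "('n \<times> 'd \<Rightarrow> 'k) \<Rightarrow> 'k"
  assume PQ: "Q \<in> polyfun coord_index" "P \<in> scalar_ideal"
  hence "Q * P \<in> polyfun coord_index" by (intro polyfun_closed) (auto simp: scalar_ideal_def)
  moreover have "(\<lambda>x. (Q (coords x) *s 1) * (P (coords x) *s 1)) \<in> J"
    using PQ by (intro J_closed(4) scalar_poly_funs) (auto simp: scalar_ideal_def)
  ultimately show "Q * P \<in> scalar_ideal" by (simp add: scalar_ideal_def scalar_mult)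
qed

text \<open>An ideal contains the coordinates of its members, since these are obtained by two-sided
  multiplications.\<close>

lemma zero_locus_scalar_ideal:
  assumes "\<And>P. P \<in> scalar_ideal \<Longrightarrow> P (coords x) = 0"
  shows "x \<in> zero_locus J"
  unfolding zero_locus_def
proof (intro CollectI ballI)
  fix f assume f: "f \<in> J"
  show "f x = 0"
  proof (rule crd_eqI)
    fix b assume b: "b \<in> B"
    obtain P where P: "P \<in> polyfun coord_index" "\<And>x. crd b (f x) = P (coords x)"
      using poly_funs_coord[OF J_closed(1)[OF f]] b by blast
    obtain T where T: "T \<in> mult_maps" "\<And>x. T x = crd b x *s 1"
      using coordinate_mult_map[OF b] by blast
    have "(\<lambda>x. P (coords x) *s 1) \<in> J"
      using mult_maps_ideal[OF J T(1) f] by (simp add: T(2) P(2))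
    hence "P \<in> scalar_ideal" using P(1) by (simp add: scalar_ideal_def)
    thus "crd b (f x) = crd b 0" using assms P(2) by (simp add: crd_zero)
  qed
qed

lemma norm_coord:
  assumes "f \<in> poly_funs"
  shows "\<exists>P\<in>polyfun coord_index. \<forall>x. rn (f x) = P (coords x)"
proof -
  obtain g where g: "g \<in> polyfun B" "\<And>x. rn x = g (\<lambda>b. crd b x)"
    using reduced_norm_polyfun[OF inf] by blast
  obtain P where P: "\<And>b. b \<in> B \<Longrightarrow> P b \<in> polyfun coord_index" "\<And>b x. b \<in> B \<Longrightarrow> crd b (f x) = P b (coords x)"
    using poly_funs_coord[OF assms] by metis
  define R where "R = (\<lambda>y. g (\<lambda>b. P b y))"
  have "R \<in> polyfun coord_index" unfolding R_def by (rule polyfun_subst[OF g(1) P(1)])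
  moreover have "rn (f x) = R (coords x)" for x
    unfolding g(2) R_def by (rule polyfun_cong[OF g(1)]) (simp add: P(2))
  ultimately show ?thesis by (intro bexI[of _ R] allI) simp_all
qed

lemma norm_fun_center: "f \<in> poly_funs \<Longrightarrow> norm_fun scale s f \<in> poly_fun_center"
proof -
  assume f: "f \<in> poly_funs"
  obtain P where P: "P \<in> polyfun coord_index" "\<And>x. rn (f x) = P (coords x)"
    using norm_coord[OF f] by blast
  have "norm_fun scale s f = (\<lambda>x. P (coords x) *s 1)"
    by (rule ext) (simp add: norm_fun_def P(2))
  thus ?thesis using scalar_poly_funs[OF P(1)] by (auto simp: poly_fun_center_iff)
qed

text \<open>At a zero of \<open>J\<close> all arguments of the form are scalars, so quasi-anisotropy
  over K makes the norm of f vanish there, and only 0 has norm 0.\<close>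

lemma Rad_subset: "Rad scale s J \<subseteq> vanishing_ideal (zero_locus J)"
proof
  fix f assume "f \<in> Rad scale s J"
  then obtain m p g where f: "f \<in> poly_funs" and m: "m \<ge> 1" and p: "quasi_anisotropic m p"
    and g: "\<forall>i \<in> {1..<m}. g i \<in> poly_fun_center" "g m = norm_fun scale s f"
    and J': "(\<lambda>x. mveval scale m p (\<lambda>i. g i x)) \<in> J"
    unfolding Rad_def by auto
  have "f x = 0" if x: "x \<in> zero_locus J" for x
  proof -
    have "\<exists>c. g i x = c *s 1" if "i \<in> {1..<m}" for i using g(1) that poly_fun_center_iff by blast
    then obtain b' where b': "\<And>i. i \<in> {1..<m} \<Longrightarrow> g i x = b' i *s 1" by metis
    define b where "b = b'(m := rn (f x))"
    have "g i x = b i *s 1" if "i \<in> {1..m}" for i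
      using that b' g(2) by (cases "i = m") (auto simp: b_def norm_fun_def)
    hence "mveval scale m p (\<lambda>i. g i x) = mveval (*) m p b *s 1" by (rule mveval_scalar)
    moreover have "mveval scale m p (\<lambda>i. g i x) = 0" using J' x by (auto simp: zero_locus_def)
    ultimately have "mveval (*) m p b = 0" by simp
    hence "b m = 0" using p by (simp add: quasi_anisotropic_def)
    thus ?thesis using reduced_norm_eq_0[OF inf] by (simp add: b_def)
  qed
  thus "f \<in> vanishing_ideal (zero_locus J)" using f by (simp add: vanishing_ideal_def)
qed

text \<open>Membership in terms of a form given as a function and of arguments with values in K,
  which is how the form below is produced.\<close>

lemma RadI:
  assumes f: "f \<in> poly_funs" and m: "m \<ge> 1" and F: "F \<in> hom_forms m e" "\<And>b. F b = 0 \<Longrightarrow> b m = 0"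
    and \<gamma>: "\<And>i. i \<in> {1..<m} \<Longrightarrow> (\<lambda>x. \<gamma> i x *s 1) \<in> poly_funs" "\<And>x. \<gamma> m x = rn (f x)"
    and J': "(\<lambda>x. F (\<lambda>i. \<gamma> i x) *s 1) \<in> J"
  shows "f \<in> Rad scale s J"
proof -
  obtain p where p: "F = mveval (*) m p" "in_vars m p"
      "\<forall>t \<in> Poly_Mapping.keys p. total_degree t = e"
    using F(1) unfolding hom_forms_def by blast
  define g where "g i = (\<lambda>x. \<gamma> i x *s 1)" for i
  have "homogeneous p" using p(3) unfolding homogeneous_def by blast
  moreover have "quasi_anisotropic m p" using F(2) p(1) by (simp add: quasi_anisotropic_def)
  moreover have "\<forall>i\<in>{1..<m}. g i \<in> poly_fun_center" using \<gamma>(1) by (auto simp: g_def poly_fun_center_iff)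
  moreover have "g m = norm_fun scale s f" by (simp add: g_def \<gamma>(2) norm_fun_def fun_eq_iff)
  moreover have "mveval scale m p (\<lambda>i. g i x) = F (\<lambda>i. \<gamma> i x) *s 1" for x
    unfolding p(1) by (rule mveval_scalar) (simp add: g_def)
  hence "(\<lambda>x. mveval scale m p (\<lambda>i. g i x)) \<in> J" using J' by simp
  ultimately show ?thesis unfolding Rad_def using f m p(2) by auto
qed

lemma vanishing_subset: "vanishing_ideal (zero_locus J) \<subseteq> Rad scale s J"
proof
  fix f assume "f \<in> vanishing_ideal (zero_locus J)"
  hence f: "f \<in> poly_funs" "\<And>x. x \<in> zero_locus J \<Longrightarrow> f x = 0" by (auto simp: vanishing_ideal_def)
  obtain G where G: "G \<in> polyfun coord_index" "\<And>x. rn (f x) = G (coords x)"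
    using norm_coord[OF f(1)] by blast
  let ?V = "coord_index :: ('n \<times> 'd) set"
  have finV: "finite ?V" using B(1) by simp
  \<comment> \<open>Every point of the coordinate space comes from a point of D^n, so a common zero
    of the central part is a zero of \<open>J\<close>, where f and hence its norm \<open>G\<close>
    vanish.\<close>
  have G0: "G a = 0" if a: "\<forall>P\<in>scalar_ideal. P a = 0" for a
  proof -
    obtain x where x: "\<forall>j\<in>coord_index. coords x j = a j" using coords_surj by blast
    have *: "P (coords x) = P a" if "P \<in> polyfun coord_index" for P
      by (rule polyfun_cong[OF that]) (use x in blast)
    have "x \<in> zero_locus J"
    proof (rule zero_locus_scalar_ideal)
      fix P assume P: "P \<in> scalar_ideal"
      hence "P (coords x) = P a" by (intro *) (simp add: scalar_ideal_def)
      thus "P (coords x) = 0" using a P by simp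
    qed
    thus ?thesis using f(2) *[OF G(1)] G(2)[of x] reduced_norm_eq_0[OF inf, of 0] by simp
  qed
  show "f \<in> Rad scale s J"
  proof (cases "\<forall>h :: 'k poly. degree h > 0 \<longrightarrow> (\<exists>x. poly h x = 0)")
    case True
    hence "\<exists>e. G ^ e \<in> scalar_ideal"
      using G0 by (intro nullstellensatz[OF inf _ finV ideal_of_scalar_ideal G(1)]) auto
    then obtain e where e: "G ^ e \<in> scalar_ideal" ..
    show ?thesis
    \<comment> \<open>The form is z_1^e with m = 1. For \<open>e = 0\<close> it is the constant 1,
      which never vanishes.\<close>
    proof (rule RadI[OF f(1), of 1 "\<lambda>b. b 1 ^ e" "e * 1" "\<lambda>_ x. rn (f x)"])
      show "(\<lambda>b. b 1 ^ e) \<in> hom_forms 1 (e * 1)" by (intro hom_forms_power hom_forms_var) simp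
      show "(\<lambda>x. rn (f x) ^ e *s 1) \<in> J"
        using e by (simp add: scalar_ideal_def power_fun_apply G(2))
    qed auto
  next
    case False
    then obtain h :: "'k poly" where h: "degree h > 0" "\<And>x. poly h x \<noteq> 0" by blast
    obtain F where F: "F \<in> scalar_ideal" "\<And>a. F a = 0 \<Longrightarrow> \<forall>P\<in>scalar_ideal. P a = 0"
      using single_equation[OF finV ideal_of_scalar_ideal h] by blast
    have FV: "F \<in> polyfun coord_index" using F(1) by (simp add: scalar_ideal_def)
    \<comment> \<open>\<open>None\<close> is the additional variable t, and \<open>Some j\<close>
      are the coordinates.\<close>
    define V' where "V' = insert None (Some ` ?V)"
    define P where "P = (\<lambda>z. binary_form h (F (\<lambda>j. z (Some j))) (1 - G (\<lambda>j. z (Some j)) * z None))"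
    have FG: "(\<lambda>z. F (\<lambda>j. z (Some j))) \<in> polyfun V'" "(\<lambda>z. G (\<lambda>j. z (Some j))) \<in> polyfun V'"
      by (rule polyfun_subst[OF FV] polyfun_subst[OF G(1)]; rule polyfun_var; simp add: V'_def)+
    have "P \<in> polyfun V'" unfolding P_def binary_form_def
      by (intro polyfun_sum polyfun_mult polyfun_power polyfun_subtract polyfun_const FG polyfun_var)
        (simp add: V'_def)
    moreover have P0: "P z \<noteq> 0" for z
    proof
      \<comment> \<open>A zero of the anisotropic form makes both arguments vanish: F = 0 gives G =
        0, and then the second argument is 1.\<close>
      assume "P z = 0"
      hence "F (\<lambda>j. z (Some j)) = 0" "1 - G (\<lambda>j. z (Some j)) * z None = 0"
        using binary_form_eq_0[OF h] unfolding P_def by blast+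
      thus False using G0[OF F(2)] by simp
    qed
    obtain idx where idx: "bij_betw idx ?V {..<card ?V}"
      using finite_same_card_bij[OF finV, of "{..<card ?V}"] by auto
    define N where "N = card ?V"
    \<comment> \<open>Variables 1 to \<open>N\<close> belong to the coordinates,
      \<open>N + 1\<close> to t, and \<open>m = N + 2\<close> is the homogenising variable.\<close>
    define m where "m = N + 2"
    define idx' where "idx' j = (case j of None \<Rightarrow> N + 1 | Some j \<Rightarrow> Suc (idx j))" for j
    have idxN: "idx j < N" if "j \<in> coord_index" for j using idx that by (auto simp: N_def bij_betw_def)
    have "idx' j \<in> {1..m}" if "j \<in> V'" for j
    proof (cases j)
      case None
      thus ?thesis by (simp add: idx'_def m_def)
    next
      case (Some i)
      hence "idx i < N" using that by (intro idxN) (auto simp: V'_def)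
      thus ?thesis using Some by (simp add: idx'_def m_def)
    qed
    moreover have "m \<ge> 1" by (simp add: m_def)
    ultimately have "\<exists>e0. \<forall>e\<ge>e0. (\<lambda>b. b m ^ e * P (\<lambda>j. b (idx' j) / b m)) \<in> hom_forms m e"
      by (intro hom_forms_homogenize[of P V'])
    then obtain e0 where e0: "\<And>e. e \<ge> e0 \<Longrightarrow> (\<lambda>b. b m ^ e * P (\<lambda>j. b (idx' j) / b m)) \<in> hom_forms m e"
      by blast
    \<comment> \<open>A positive exponent, so that the form vanishes where the norm does.\<close>
    define e where "e = Suc e0"
    let ?F = "\<lambda>b. b m ^ e * P (\<lambda>j. b (idx' j) / b m)"
    define jdx where "jdx = the_inv_into ?V idx"
    \<comment> \<open>Dividing by the last entry, the norm, recovers the coordinates and gives the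
      value 1/g for t.\<close>
    define \<gamma> where "\<gamma> i x = (if i = m then rn (f x) else if i = N + 1 then 1
      else coords x (jdx (i - 1)) * rn (f x))" for i x
    have jdx: "jdx (idx j) = j" if "j \<in> coord_index" for j
      unfolding jdx_def using idx that by (intro the_inv_into_f_f) (auto simp: bij_betw_def)
    have jdxV: "jdx i \<in> coord_index" if "i < N" for i
      unfolding jdx_def using idx that by (intro the_inv_into_into[of idx coord_index]) (auto simp: bij_betw_def N_def)
    show ?thesis
    proof (rule RadI[OF f(1), of m ?F e \<gamma>])
      show "m \<ge> 1" by (simp add: m_def)
      show "?F \<in> hom_forms m e" by (rule e0) (simp add: e_def)
      show "b m = 0" if "?F b = 0" for b using that P0 by simp
      show "\<gamma> m x = rn (f x)" for x by (simp add: \<gamma>_def)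
      show "(\<lambda>x. \<gamma> i x *s 1) \<in> poly_funs" if i: "i \<in> {1..<m}" for i
      proof (cases "i = N + 1")
        case True
        thus ?thesis using poly_funs_const[of "1 *s 1"] by (simp add: \<gamma>_def m_def)
      next
        case False
        hence "jdx (i - 1) \<in> coord_index" using i by (intro jdxV) (auto simp: m_def)
        hence "(\<lambda>a. a (jdx (i - 1)) * G a) \<in> polyfun coord_index"
          by (intro polyfun_mult polyfun_var G(1))
        from scalar_poly_funs[OF this] show ?thesis using False i by (simp add: \<gamma>_def G(2))
      qed
      obtain d where d: "degree h = Suc d" using h(1) by (cases "degree h") auto
      define c where "c = lead_coeff h"
      \<comment> \<open>With t = 1/g only the leading term of the form survives, a multiple of
        F^(d+1); one factor F is set apart because it lies in the ideal. At norm 0 both sides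
        vanish.\<close>
      have val: "\<gamma> m x ^ e * P (\<lambda>j. \<gamma> (idx' j) x / \<gamma> m x) =
          (G (coords x) ^ e * c * F (coords x) ^ d) * F (coords x)" for x
      proof (cases "rn (f x) = 0")
        case True
        thus ?thesis using G(2)[of x] by (simp add: \<gamma>_def e_def)
      next
        case False
        have "\<gamma> (Suc (idx j)) x / \<gamma> m x = coords x j" if "j \<in> coord_index" for j
          using idxN[OF that] jdx[OF that] False by (simp add: \<gamma>_def m_def)
        hence "F (\<lambda>j. \<gamma> (Suc (idx j)) x / \<gamma> m x) = F (coords x)" "G (\<lambda>j. \<gamma> (Suc (idx j)) x / \<gamma> m x) = G (coords x)"
          by (auto intro!: polyfun_cong[OF FV] polyfun_cong[OF G(1)])
        moreover have "\<gamma> (N + 1) x / \<gamma> m x = 1 / G (coords x)" by (simp add: \<gamma>_def m_def G(2))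
        ultimately have "P (\<lambda>j. \<gamma> (idx' j) x / \<gamma> m x) = binary_form h (F (coords x)) 0"
          using False by (simp add: P_def idx'_def G(2))
        thus ?thesis by (simp add: binary_form_right_0 d c_def \<gamma>_def G(2))
      qed
      have "(\<lambda>a. G a ^ e * c * F a ^ d) * F \<in> scalar_ideal"
        by (intro ideal_ofD(4)[OF ideal_of_scalar_ideal] polyfun_mult polyfun_power polyfun_const FV G(1) F(1))
      thus "(\<lambda>x. (\<gamma> m x ^ e * P (\<lambda>j. \<gamma> (idx' j) x / \<gamma> m x)) *s 1) \<in> J"
        unfolding val by (simp add: scalar_ideal_def)
    qed
  qed
qed

lemma Rad'_subset: "Rad' scale s J \<subseteq> Rad scale s J"
proof
  fix f assume "f \<in> Rad' scale s J"
  then obtain m p g where f: "f \<in> poly_funs" and m: "m \<ge> 1"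
    and p: "in_vars m p" "homogeneous p" "quasi_anisotropic m p"
    and g: "\<forall>i \<in> {1..<m}. g i \<in> poly_funs" "g m = f"
    and J': "(\<lambda>x. mveval scale m p (\<lambda>i. norm_fun scale s (g i) x)) \<in> J"
    unfolding Rad'_def by auto
  show "f \<in> Rad scale s J"
    unfolding Rad_def using f m p g J' norm_fun_center
    by (intro CollectI conjI exI[of _ m] exI[of _ p] exI[of _ "\<lambda>i. norm_fun scale s (g i)"]) auto
qed

text \<open>Central functions are linear combinations of \<open>s\<close>-th powers of central functions, that is, of
  norms; substituting these preserves quasi-anisotropy because the last variable is untouched.\<close>

lemma Rad_subset_Rad':
  assumes char: "\<not> CHAR('k) dvd fact s"
  shows "Rad scale s J \<subseteq> Rad' scale s J"
proof
  fix f assume "f \<in> Rad scale s J"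
  then obtain m p g where f: "f \<in> poly_funs" and m: "m \<ge> 1"
    and p: "in_vars m p" "homogeneous p" "quasi_anisotropic m p"
    and g: "\<forall>i \<in> {1..<m}. g i \<in> poly_fun_center" "g m = norm_fun scale s f"
    and J': "(\<lambda>x. mveval scale m p (\<lambda>i. g i x)) \<in> J"
    unfolding Rad_def by auto
  have "of_nat (fact s) \<noteq> (0 :: 'k)" using char by (simp add: of_nat_eq_0_iff_char_dvd)
  then obtain r :: nat and c a where lin: "\<And>x :: 'k. x = (\<Sum>j<r. c j * (x + a j) ^ s)"
    using linear_from_powers[of s] s_pos by auto
  \<comment> \<open>An empty combination would give 1 = 0. Positivity makes division by
    \<open>r\<close> usable for the numbering below.\<close>
  have r: "r > 0" using lin[of 1] by (cases r) auto
  have "\<exists>\<gamma>. \<forall>x. g i x = \<gamma> x *s 1" if "i \<in> {1..<m}" for i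
  proof -
    have "\<forall>x. \<exists>c. g i x = c *s 1" using g(1) that poly_fun_center_iff by blast
    thus ?thesis by (rule choice)
  qed
  then obtain \<gamma> where \<gamma>: "\<And>i x. i \<in> {1..<m} \<Longrightarrow> g i x = \<gamma> i x *s 1" by metis
  \<comment> \<open>Each of the \<open>m - 1\<close> central variables is replaced by
    \<open>r\<close> new ones, and variable \<open>j\<close> of block \<open>i\<close> has number
    \<open>(i - 1) * r + j + 1\<close>; the last number \<open>M\<close> keeps the norm of
    f.\<close>
  define M where "M = (m - 1) * r + 1"
  define l where "l i v = (if i = m then v M else (\<Sum>j<r. c j * v ((i - 1) * r + j + 1)))"
    for i and v :: "nat \<Rightarrow> 'k"
  obtain e where e: "\<forall>t \<in> Poly_Mapping.keys p. total_degree t = e"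
    using p(2) unfolding homogeneous_def by blast
  have idx: "(i - 1) * r + j + 1 < M" if "i \<in> {1..<m}" "j < r" for i j
  proof -
    have "(i - 1) * r + j < (i - 1) * r + r" using that by simp
    also have "\<dots> = i * r" using that by (cases i) auto
    also have "\<dots> \<le> (m - 1) * r" using that by (intro mult_right_mono) auto
    finally show ?thesis by (simp add: M_def)
  qed
  have "(\<lambda>v. mveval (*) m p (\<lambda>i. l i v)) \<in> hom_forms M e"
  proof (rule hom_forms_linear_subst[where f = "mveval (*) m p" and m = m])
    show "mveval (*) m p \<in> hom_forms m e" unfolding hom_forms_def using p(1) e by blast
    fix i assume i: "i \<in> {1..m}"
    show "l i \<in> hom_forms M 1"
    proof (cases "i = m")
      case True
      thus ?thesis using hom_forms_var[of M M] by (simp add: l_def[abs_def] M_def)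
    next
      case False
      have "(\<lambda>v. \<Sum>j<r. c j * v ((i - 1) * r + j + 1)) \<in> hom_forms M 1"
        using idx[of i] i False by (intro hom_forms_sum hom_forms_smult hom_forms_var) (auto simp: less_imp_le)
      thus ?thesis using False by (simp add: l_def[abs_def])
    qed
  qed
  then obtain q where q: "(\<lambda>v. mveval (*) m p (\<lambda>i. l i v)) = mveval (*) M q" "in_vars M q"
      "\<forall>t \<in> Poly_Mapping.keys q. total_degree t = e"
    unfolding hom_forms_def by blast
  have q_val: "mveval (*) M q v = mveval (*) m p (\<lambda>i. l i v)" for v using fun_cong[OF q(1), of v] by simp
  \<comment> \<open>Block and position are recovered by division with remainder. The function is
    scalar-valued, so its norm is the s-th power that \<open>linear_from_powers\<close> asks
    for.\<close>
  define g' where "g' k = (if k = M then f else (\<lambda>x. g ((k - 1) div r + 1) x + a ((k - 1) mod r) *s 1))" for k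
  have dm: "((i - 1) * r + j + 1 - 1) div r + 1 = i" "((i - 1) * r + j + 1 - 1) mod r = j"
    if "i \<in> {1..<m}" "j < r" for i j using that by auto
  have val: "mveval scale M q (\<lambda>i. norm_fun scale s (g' i) x) = mveval scale m p (\<lambda>i. g i x)" for x
  proof -
    define \<beta> where "\<beta> k = rn (g' k x)" for k
    have "mveval scale M q (\<lambda>i. norm_fun scale s (g' i) x) = mveval (*) M q \<beta> *s 1"
      by (rule mveval_scalar) (simp add: norm_fun_def \<beta>_def)
    also have "mveval (*) M q \<beta> = mveval (*) m p (\<lambda>i. l i \<beta>)" by (rule q_val)
    also have "\<dots> *s 1 = mveval scale m p (\<lambda>i. g i x)"
    proof (rule mveval_scalar[symmetric])
      fix i assume i: "i \<in> {1..m}"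
      show "g i x = l i \<beta> *s 1"
      proof (cases "i = m")
        case True
        thus ?thesis by (simp add: g(2) norm_fun_def l_def \<beta>_def g'_def)
      next
        case False
        hence i': "i \<in> {1..<m}" using i by auto
        have "\<beta> ((i - 1) * r + j + 1) = (\<gamma> i x + a j) ^ s" if "j < r" for j
        proof -
          have "g' ((i - 1) * r + j + 1) x = g i x + a j *s 1"
            unfolding g'_def dm[OF i' that] using idx[OF i' that] by simp
          thus ?thesis
            by (simp add: \<beta>_def \<gamma>[OF i'] scalar_add reduced_norm_scalar[OF inf])
        qed
        hence "l i \<beta> = \<gamma> i x" using False lin[of "\<gamma> i x"] by (simp add: l_def)
        thus ?thesis by (simp add: \<gamma>[OF i'])
      qed
    qed
    finally show ?thesis .
  qed
  \<comment> \<open>The form \<open>l m\<close> is just the last variable, so a zero of the new form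
    forces it to be 0.\<close>
  have "quasi_anisotropic M q"
    unfolding quasi_anisotropic_def q_val using p(3) unfolding quasi_anisotropic_def
    by (metis (full_types) l_def)
  moreover have "g' k \<in> poly_funs" if k: "k \<in> {1..<M}" for k
  proof -
    have "(k - 1) div r < m - 1" using k r by (intro div_less_iff_less_mult[THEN iffD2]) (auto simp: M_def)
    hence "g ((k - 1) div r + 1) \<in> poly_funs" using g(1) poly_fun_center_iff by force
    thus ?thesis using k poly_funs_add[OF _ poly_funs_const] by (simp add: g'_def)
  qed
  moreover have "homogeneous q" using q(3) unfolding homogeneous_def by blast
  moreover have "(\<lambda>x. mveval scale M q (\<lambda>i. norm_fun scale s (g' i) x)) \<in> J" using J' by (simp add: val)
  ultimately show "f \<in> Rad' scale s J"
    unfolding Rad'_def using f q(2)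
    by (intro CollectI conjI exI[of _ M] exI[of _ q] exI[of _ g']) (auto simp: M_def g'_def)
qed

end

end

theorem theorem1:
  fixes scale :: "'k::field \<Rightarrow> 'd::division_ring \<Rightarrow> 'd"
    and s :: nat
    and J :: "(('n::finite \<Rightarrow> 'd) \<Rightarrow> 'd) set"
  assumes "infinite (UNIV :: 'k set)"
    and "central_division_algebra scale s"
    and "ideal J poly_fun_ring"
  shows "vanishing_ideal (zero_locus J) = Rad scale s J \<and>
    (\<not> CHAR('k) dvd fact s \<longrightarrow> Rad scale s J = Rad' scale s J)"
proof -
  interpret central_division_algebra scale s by fact
  obtain B0 where B0: "finite B0" "span B0 = UNIV" using finite_dim by blast
  obtain B where B: "B \<subseteq> B0" "independent B" "B0 \<subseteq> span B"
    using maximal_independent_subset[of B0] by blast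
  have "span B = UNIV" using B(3) B0(2) span_minimal[OF _ subspace_span, of B0 B] by auto
  then interpret cda_basis scale s B
    using B finite_subset[OF B(1) B0(1)] by unfold_locales auto
  show ?thesis
    using Rad_subset[OF assms(3,1)] vanishing_subset[OF assms(3,1)]
      Rad'_subset[OF assms(3,1)] Rad_subset_Rad'[OF assms(3,1)] by blast
qed

end
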